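(* Let $\Omega=(0,1)^2$. Consider the Helmholtz equation $\Delta u+k^2u=0$ in $\Omega$ (vanishing source term), with boundary conditions $\mathcal{B}_ju=g_j$ on $\Gamma_j$, $j=1,\dots,4$, where: $\mathcal{B}_1,\mathcal{B}_3\in\{\mathbf{I}_d,\frac{\partial}{\partial\nu}\}$ with $g_1=0$ and $g_3=0$; $\mathcal{B}_2\in\{\mathbf{I}_d,\frac{\partial}{\partial\nu},\frac{\partial}{\partial\nu}-ik\mathbf{I}_d\}$ with $g_2=0$; and $\mathcal{B}_4=\frac{\partial}{\partial\nu}-ik\mathbf{I}_d$ with $g_4\in L^2(\Gamma_4)$. Then the unique (weak) solution $u$ satisfies $$\|\nabla u\|_{0,\Omega}+k\|u\|_{0,\Omega}\le\sqrt{12}\,\max\{k,1\}\,\|g_4\|_{0,\Gamma_4},\qquad\forall\,k>0.$$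
   Context: All functions are complex valued. $\Omega:=(0,1)^2$ with sides $\Gamma_1:=(0,1)\times\{0\}$, $\Gamma_2:=\{1\}\times(0,1)$, $\Gamma_3:=(0,1)\times\{1\}$, $\Gamma_4:=\{0\}\times(0,1)$. On $\Gamma_j$ the boundary operator $\mathcal{B}_j$ is $\mathbf{I}_d$ ($\mathbf{I}_du=u$, Dirichlet), $\frac{\partial}{\partial\nu}$ (Neumann), or $\frac{\partial}{\partial\nu}-ik\mathbf{I}_d$ (impedance), with $\nu$ the outward normal vector and $k>0$ a constant. $\Gamma_D,\Gamma_N,\Gamma_R$ denote the unions of the sides carrying respectively Dirichlet, Neumann and impedance conditions, and $\mathcal{H}:=\{v\in H^1(\Omega):v=0\text{ on }\Gamma_D\}$. With homogeneous Dirichlet data, and $g_N$, $g_R$ denoting the Neumann and impedance data, the solution is the unique $u\in\mathcal{H}$ (existence and uniqueness hold) with $$\int_\Omega(\nabla u\cdot\nabla\overline v-k^2u\overline v)-ik\int_{\Gamma_R}u\overline v=\int_\Omega f\overline v+\int_{\Gamma_R}g_R\overline v+\int_{\Gamma_N}g_N\overline v\quad\forall v\in\mathcal{H},$$ where $f$ is the source term ($\Delta u+k^2u=-f$), here $f=0$. $\|\cdot\|_{0,\Omega}$ and $\|\cdot\|_{0,\Gamma}$ denote the $L^2(\Omega)$ and $L^2(\Gamma)$ norms. *)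

theory Defs
  imports "HOL-Analysis.Analysis"
begin

section \<open>The unit square, its sides, and their measures\<close>

type_synonym plane = "real \<times> real"

definition unit_square :: "plane set" where
  "unit_square = {0<..<1} \<times> {0<..<1}"

text \<open>Arc-length parametrisation over \<open>(0,1)\<close> of the side with number \<open>j \<in> {1,2,3,4}\<close>:
  bottom, right, top, left.\<close>

definition side_param :: "nat \<Rightarrow> real \<Rightarrow> plane" where
  "side_param j s =
     (if j = 1 then (s, 0) else if j = 2 then (1, s) else if j = 3 then (s, 1) else (0, s))"

lemma side_param_image:
  "side_param 1 ` {0<..<1} = {0<..<1} \<times> {0}"
  "side_param 2 ` {0<..<1} = {1} \<times> {0<..<1}"
  "side_param 3 ` {0<..<1} = {0<..<1} \<times> {1}"
  "side_param 4 ` {0<..<1} = {0} \<times> {0<..<1}"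
  by (auto simp: side_param_def)

definition square_measure :: "plane measure" where
  "square_measure = restrict_space lborel unit_square"

text \<open>Arc length on side \<open>j\<close>, as a measure on the plane carried by that side.  Functions on
  the boundary are functions on the plane whose values off the boundary are irrelevant.\<close>

definition side_measure :: "nat \<Rightarrow> plane measure" where
  "side_measure j = distr (restrict_space lborel {0<..<1}) borel (side_param j)"


section \<open>The spaces \<open>L\<^sup>2\<close> and \<open>H\<^sup>1\<close>\<close>

text \<open>\<open>L\<^sup>2\<close> elements are given by Borel representatives, and equality is equality almost
  everywhere.  Vector fields take values in \<^typ>\<open>complex \<times> complex\<close>, whose norm is the
  Euclidean (Hermitian) one.\<close>

definition in_L2 :: "'a measure \<Rightarrow> ('a \<Rightarrow> 'b::{real_normed_vector,second_countable_topology}) \<Rightarrow> bool" where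
  "in_L2 M f \<longleftrightarrow> f \<in> borel_measurable M \<and> integrable M (\<lambda>x. (norm (f x))\<^sup>2)"

definition L2_norm :: "'a measure \<Rightarrow> ('a \<Rightarrow> 'b::real_normed_vector) \<Rightarrow> real" where
  "L2_norm M f = sqrt (\<integral>x. (norm (f x))\<^sup>2 \<partial>M)"

definition grad :: "(plane \<Rightarrow> complex) \<Rightarrow> plane \<Rightarrow> complex \<times> complex" where
  "grad \<phi> p = (frechet_derivative \<phi> (at p) (1, 0), frechet_derivative \<phi> (at p) (0, 1))"

primrec C_diff :: "nat \<Rightarrow> (plane \<Rightarrow> complex) \<Rightarrow> bool" where
  "C_diff 0 \<phi> \<longleftrightarrow> continuous_on UNIV \<phi>"
| "C_diff (Suc n) \<phi> \<longleftrightarrow> \<phi> differentiable_on UNIV \<and>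
     C_diff n (\<lambda>p. fst (grad \<phi> p)) \<and> C_diff n (\<lambda>p. snd (grad \<phi> p))"

definition smooth :: "(plane \<Rightarrow> complex) \<Rightarrow> bool" where
  "smooth \<phi> \<longleftrightarrow> (\<forall>n. C_diff n \<phi>)"

definition test_function :: "(plane \<Rightarrow> complex) \<Rightarrow> bool" where
  "test_function \<phi> \<longleftrightarrow> smooth \<phi> \<and>
     compact (closure {p. \<phi> p \<noteq> 0}) \<and> closure {p. \<phi> p \<noteq> 0} \<subseteq> unit_square"

text \<open>\<open>H1 u Du\<close>: the function \<open>u\<close> is in \<open>H\<^sup>1\<close> of the square and \<open>Du\<close> is its weak
  gradient, which is unique almost everywhere.\<close>

definition H1 :: "(plane \<Rightarrow> complex) \<Rightarrow> (plane \<Rightarrow> complex \<times> complex) \<Rightarrow> bool" where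
  "H1 u Du \<longleftrightarrow> in_L2 square_measure u \<and> in_L2 square_measure Du \<and>
     (\<forall>\<phi>. test_function \<phi> \<longrightarrow>
        (\<integral>p. u p * fst (grad \<phi> p) \<partial>square_measure) = - (\<integral>p. fst (Du p) * \<phi> p \<partial>square_measure) \<and>
        (\<integral>p. u p * snd (grad \<phi> p) \<partial>square_measure) = - (\<integral>p. snd (Du p) * \<phi> p \<partial>square_measure))"

text \<open>The trace operator is the continuous extension to \<open>H\<^sup>1\<close> of the restriction to the
  boundary of functions that are smooth up to the boundary.  Its graph is the following
  relation: \<open>T\<close> is a trace of the \<open>H\<^sup>1\<close> function \<open>u\<close> with weak gradient \<open>Du\<close>.  By the
  density of smooth functions and the trace theorem on a Lipschitz domain, every \<open>H\<^sup>1\<close>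
  function has a trace, and it is unique almost everywhere on the boundary.\<close>

definition has_trace ::
  "(plane \<Rightarrow> complex) \<Rightarrow> (plane \<Rightarrow> complex \<times> complex) \<Rightarrow> (plane \<Rightarrow> complex) \<Rightarrow> bool" where
  "has_trace u Du T \<longleftrightarrow> (\<forall>j\<in>{1..4}. in_L2 (side_measure j) T) \<and>
     (\<exists>\<phi> :: nat \<Rightarrow> plane \<Rightarrow> complex.
        (\<forall>n. smooth (\<phi> n)) \<and>
        (\<lambda>n. L2_norm square_measure (\<lambda>p. \<phi> n p - u p)) \<longlonglongrightarrow> 0 \<and>
        (\<lambda>n. L2_norm square_measure (\<lambda>p. grad (\<phi> n) p - Du p)) \<longlonglongrightarrow> 0 \<and>
        (\<forall>j\<in>{1..4}. (\<lambda>n. L2_norm (side_measure j) (\<lambda>p. \<phi> n p - T p)) \<longlonglongrightarrow> 0))"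


section \<open>The Helmholtz problem\<close>

text \<open>The operators \<open>u\<close>, \<open>\<partial>u/\<partial>\<nu>\<close> and \<open>\<partial>u/\<partial>\<nu> - \<i>ku\<close>; \<open>B j\<close> is the one prescribed on side \<open>j\<close>.\<close>

datatype boundary_operator = Dirichlet | Neumann | Impedance

text \<open>\<open>energy_space B v Dv S\<close>: \<open>v\<close> is in \<open>H\<^sup>1\<close> and vanishes on the Dirichlet sides, \<open>Dv\<close> is
  its weak gradient and \<open>S\<close> its trace.\<close>

definition energy_space ::
  "(nat \<Rightarrow> boundary_operator) \<Rightarrow> (plane \<Rightarrow> complex) \<Rightarrow> (plane \<Rightarrow> complex \<times> complex) \<Rightarrow>
   (plane \<Rightarrow> complex) \<Rightarrow> bool" where
  "energy_space B v Dv S \<longleftrightarrow> H1 v Dv \<and> has_trace v Dv S \<and>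
     (\<forall>j\<in>{1..4}. B j = Dirichlet \<longrightarrow> (AE p in side_measure j. S p = 0))"

text \<open>\<open>helmholtz_weak_solution k B f g u Du\<close>: \<open>u\<close>, with weak gradient \<open>Du\<close>, is a weak solution
  of \<open>\<Delta>u + k\<^sup>2u = -f\<close> with boundary conditions \<open>B j u = g j\<close> on side \<open>j\<close>.  Dirichlet
  data are homogeneous, so \<open>g j\<close> is not used when \<open>B j = Dirichlet\<close>.\<close>

definition helmholtz_weak_solution ::
  "real \<Rightarrow> (nat \<Rightarrow> boundary_operator) \<Rightarrow> (plane \<Rightarrow> complex) \<Rightarrow> (nat \<Rightarrow> plane \<Rightarrow> complex) \<Rightarrow>
   (plane \<Rightarrow> complex) \<Rightarrow> (plane \<Rightarrow> complex \<times> complex) \<Rightarrow> bool" where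
  "helmholtz_weak_solution k B f g u Du \<longleftrightarrow>
     (\<exists>T. energy_space B u Du T \<and>
       (\<forall>v Dv S. energy_space B v Dv S \<longrightarrow>
          (\<integral>p. (fst (Du p) * cnj (fst (Dv p)) + snd (Du p) * cnj (snd (Dv p)))
                - (complex_of_real k)\<^sup>2 * u p * cnj (v p) \<partial>square_measure)
          - \<i> * complex_of_real k *
            (\<Sum>j | j \<in> {1..4} \<and> B j = Impedance. \<integral>p. T p * cnj (S p) \<partial>side_measure j)
          = (\<integral>p. f p * cnj (v p) \<partial>square_measure)
            + (\<Sum>j | j \<in> {1..4} \<and> B j = Impedance. \<integral>p. g j p * cnj (S p) \<partial>side_measure j)
            + (\<Sum>j | j \<in> {1..4} \<and> B j = Neumann. \<integral>p. g j p * cnj (S p) \<partial>side_measure j)))"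

end

(* Fourier expansion in y reduces the problem to one ordinary differential equation
   w'' + (k^2 - l^2) w = 0 per mode, with impedance condition at x = 0.  Multiplier identities
   bound 2 k^2 |w|^2 + Re (g cnj (w 0)) by 6 max(k,1)^2 |g|^2 for each mode, hence in sum.  The
   energy identity (test with v = u) turns the left-hand side into |Du|^2 + k^2 |u|^2, which gives
   the constant sqrt 12.  Regularity of u is never used: the Fourier coefficients of u are
   identified with the classical solutions through the moments against the test functions
   (1 - x)^j phi_n(y). *)

theory Submission
  imports Defs "HOL-Real_Asymp.Real_Asymp"
begin

section \<open>Square-integrable functions\<close>

text \<open>The obstacle is that \<open>u\<close> is only an H1 function whose trace is a limit of
  restrictions of smooth functions, so its Fourier coefficients in y are not known to solve an
  equation pointwise. The weights (1 - x)^j meet this: they equal 1 on side 4, for j > 0 they vanish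
  on side 2 and are admissible under every condition there, and two x-derivatives lower j by 2. The
  difference between a coefficient and its classical candidate then has bounded moments obeying a
  two-step recurrence, whose only bounded solution is zero. The quantity bounded per mode contains
  no derivative of the coefficient, so the gradient is never expanded; it enters only through the
  energy identity. The factor 6 rounds up the worst of three cases: 1 for frequency zero, 17/3 for
  the other oscillating modes, 4 for evanescent ones. The last doubling comes from (s + t)^2 \<le> 2
  s^2 + 2 t^2. Completeness meets the difficulty that modes vanish on Dirichlet sides, so their span
  need not contain constants. Stone-Weierstrass is therefore applied to multipliers of the span, and
  the lowest mode, positive inside, is divided out afterwards.\<close>

lemma in_L2_measurable: "in_L2 M f \<Longrightarrow> f \<in> borel_measurable M"
  by (simp add: in_L2_def)

lemma in_L2_integrable_square: "in_L2 M f \<Longrightarrow> integrable M (\<lambda>x. (norm (f x))\<^sup>2)"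
  by (simp add: in_L2_def)

lemma L2_norm_nonneg: "L2_norm M f \<ge> 0"
  by (simp add: L2_norm_def)

lemma L2_norm_square: "(L2_norm M f)\<^sup>2 = (\<integral>x. (norm (f x))\<^sup>2 \<partial>M)"
  by (simp add: L2_norm_def)

lemma norm_add_square_le:
  fixes a b :: "'a::real_normed_vector"
  shows "(norm (a + b))\<^sup>2 \<le> 2 * (norm a)\<^sup>2 + 2 * (norm b)\<^sup>2"
proof -
  have "(norm (a + b))\<^sup>2 \<le> (norm a + norm b)\<^sup>2"
    by (intro power_mono norm_triangle_ineq norm_ge_zero)
  also have "\<dots> \<le> 2 * (norm a)\<^sup>2 + 2 * (norm b)\<^sup>2"
    using zero_le_power2[of "norm a - norm b"] by (simp add: power2_eq_square algebra_simps)
  finally show ?thesis .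
qed

lemma in_L2_add:
  fixes f h :: "'a \<Rightarrow> 'b::{real_normed_vector,second_countable_topology}"
  assumes f: "in_L2 M f" and h: "in_L2 M h"
  shows "in_L2 M (\<lambda>x. f x + h x)"
proof -
  note [measurable] = in_L2_measurable[OF f] in_L2_measurable[OF h]
  have "integrable M (\<lambda>x. (norm (f x + h x))\<^sup>2)"
  proof (rule Bochner_Integration.integrable_bound)
    show "integrable M (\<lambda>x. 2 * (norm (f x))\<^sup>2 + 2 * (norm (h x))\<^sup>2)"
      using in_L2_integrable_square[OF f] in_L2_integrable_square[OF h] by auto
    show "AE x in M. norm ((norm (f x + h x))\<^sup>2) \<le> norm (2 * (norm (f x))\<^sup>2 + 2 * (norm (h x))\<^sup>2)"
      using norm_add_square_le[of "f _" "h _"] by (intro AE_I2) simp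
  qed measurable
  then show ?thesis by (simp add: in_L2_def)
qed

text \<open>Comparison test; the codomains may differ, so that a component can be compared with its
  pair and a real part with a complex function.\<close>

lemma in_L2_bound:
  fixes f :: "'a \<Rightarrow> 'b::{real_normed_vector,second_countable_topology}"
    and h :: "'a \<Rightarrow> 'c::{real_normed_vector,second_countable_topology}"
  assumes h: "in_L2 M h" and f[measurable]: "f \<in> borel_measurable M"
    and le: "\<And>x. x \<in> space M \<Longrightarrow> norm (f x) \<le> c * norm (h x)"
  shows "in_L2 M f"
proof -
  have "integrable M (\<lambda>x. (norm (f x))\<^sup>2)"
  proof (rule Bochner_Integration.integrable_bound)
    show "integrable M (\<lambda>x. c\<^sup>2 * (norm (h x))\<^sup>2)"
      using in_L2_integrable_square[OF h] by auto
    show "AE x in M. norm ((norm (f x))\<^sup>2) \<le> norm (c\<^sup>2 * (norm (h x))\<^sup>2)"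
      using power_mono[OF le norm_ge_zero, of _ 2] by (intro AE_I2) (simp add: power_mult_distrib)
  qed measurable
  then show ?thesis by (simp add: in_L2_def)
qed

lemma in_L2_cmult:
  fixes f :: "'a \<Rightarrow> complex"
  assumes "in_L2 M f"
  shows "in_L2 M (\<lambda>x. c * f x)"
proof (rule in_L2_bound[OF assms])
  show "(\<lambda>x. c * f x) \<in> borel_measurable M"
    using in_L2_measurable[OF assms] by measurable
qed (auto simp: norm_mult)

lemma in_L2_minus:
  fixes f :: "'a \<Rightarrow> 'b::{real_normed_vector,second_countable_topology}"
  assumes "in_L2 M f"
  shows "in_L2 M (\<lambda>x. - f x)"
  using assms by (simp add: in_L2_def)

lemma in_L2_diff:
  fixes f h :: "'a \<Rightarrow> 'b::{real_normed_vector,second_countable_topology}"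
  assumes "in_L2 M f" "in_L2 M h"
  shows "in_L2 M (\<lambda>x. f x - h x)"
  using in_L2_add[OF assms(1) in_L2_minus[OF assms(2)]] by simp

lemma in_L2_cnj:
  assumes "in_L2 M f"
  shows "in_L2 M (\<lambda>x. cnj (f x))"
proof (rule in_L2_bound[OF assms, where c = 1])
  show "(\<lambda>x. cnj (f x)) \<in> borel_measurable M"
    using in_L2_measurable[OF assms] by (rule borel_measurable_continuous_on[rotated]) (intro continuous_intros)
qed simp

lemma in_L2_fst:
  fixes f :: "'a \<Rightarrow> complex \<times> complex"
  assumes "in_L2 M f"
  shows "in_L2 M (\<lambda>x. fst (f x))"
proof (rule in_L2_bound[OF assms, where c = 1])
  show "(\<lambda>x. fst (f x)) \<in> borel_measurable M"
    using in_L2_measurable[OF assms] by (rule borel_measurable_continuous_on[rotated]) (intro continuous_intros)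
qed (use norm_fst_le[of "fst z" "snd z" for z :: "complex \<times> complex"] in simp)

lemma in_L2_snd:
  fixes f :: "'a \<Rightarrow> complex \<times> complex"
  assumes "in_L2 M f"
  shows "in_L2 M (\<lambda>x. snd (f x))"
proof (rule in_L2_bound[OF assms, where c = 1])
  show "(\<lambda>x. snd (f x)) \<in> borel_measurable M"
    using in_L2_measurable[OF assms] by (rule borel_measurable_continuous_on[rotated]) (intro continuous_intros)
qed (use norm_snd_le[of "snd z" "fst z" for z :: "complex \<times> complex"] in simp)

lemma in_L2_sum:
  fixes f :: "'i \<Rightarrow> 'a \<Rightarrow> 'b::{real_normed_vector,second_countable_topology}"
  assumes "\<And>i. i \<in> I \<Longrightarrow> in_L2 M (f i)"
  shows "in_L2 M (\<lambda>x. \<Sum>i\<in>I. f i x)"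
  using assms
proof (induction I rule: infinite_finite_induct)
  case (insert i I)
  then show ?case using in_L2_add[of M "f i" "\<lambda>x. \<Sum>i\<in>I. f i x"] by simp
qed (simp_all add: in_L2_def)

section \<open>Pairings in L2: Cauchy-Schwarz, triangle inequality, limits, duality\<close>

lemma in_L2_prod_integrable:
  fixes f h :: "'a \<Rightarrow> complex"
  assumes f: "in_L2 M f" and h: "in_L2 M h"
  shows "integrable M (\<lambda>x. f x * h x)"
proof (rule Bochner_Integration.integrable_bound)
  show "integrable M (\<lambda>x. (norm (f x))\<^sup>2 + (norm (h x))\<^sup>2)"
    using in_L2_integrable_square[OF f] in_L2_integrable_square[OF h] by auto
  show "(\<lambda>x. f x * h x) \<in> borel_measurable M"
    using in_L2_measurable[OF f] in_L2_measurable[OF h] by measurable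
  have "norm a * norm b \<le> (norm a)\<^sup>2 + (norm b)\<^sup>2" for a b :: complex
    using sum_squares_bound[of "norm a" "norm b"] mult_nonneg_nonneg[of "norm a" "norm b"] by (simp del: mult_nonneg_nonneg)
  then show "AE x in M. norm (f x * h x) \<le> norm ((norm (f x))\<^sup>2 + (norm (h x))\<^sup>2)"
    by (intro AE_I2) (simp add: norm_mult)
qed

text \<open>The integral of (s |f| - |h|)^2 is nonnegative for every real s. A suitable s gives the
  claim, with the cases of vanishing norm treated apart because the optimal s divides by the norm of
  f.\<close>

lemma Cauchy_Schwarz_L2:
  fixes f h :: "'a \<Rightarrow> complex"
  assumes f: "in_L2 M f" and h: "in_L2 M h"
  shows "norm (\<integral>x. f x * h x \<partial>M) \<le> L2_norm M f * L2_norm M h"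
proof -
  define I where "I = (\<integral>x. norm (f x) * norm (h x) \<partial>M)"
  have int: "integrable M (\<lambda>x. norm (f x) * norm (h x))"
    using integrable_norm[OF in_L2_prod_integrable[OF f h]] by (simp add: norm_mult)
  have "I \<ge> 0" unfolding I_def by simp
  have quad: "2 * s * I \<le> s\<^sup>2 * (L2_norm M f)\<^sup>2 + (L2_norm M h)\<^sup>2" for s :: real
  proof -
    have "2 * s * I = (\<integral>x. 2 * s * (norm (f x) * norm (h x)) \<partial>M)"
      by (simp add: I_def)
    also have "\<dots> \<le> (\<integral>x. s\<^sup>2 * (norm (f x))\<^sup>2 + (norm (h x))\<^sup>2 \<partial>M)"
    proof (rule integral_mono)
      show "2 * s * (norm (f x) * norm (h x)) \<le> s\<^sup>2 * (norm (f x))\<^sup>2 + (norm (h x))\<^sup>2" for x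
        using sum_squares_bound[of "s * norm (f x)" "norm (h x)"]
        by (simp add: power_mult_distrib mult.assoc)
    qed (use int in_L2_integrable_square[OF f] in_L2_integrable_square[OF h] in auto)
    also have "\<dots> = s\<^sup>2 * (L2_norm M f)\<^sup>2 + (L2_norm M h)\<^sup>2"
      using in_L2_integrable_square[OF f] in_L2_integrable_square[OF h]
      by (simp add: L2_norm_square)
    finally show ?thesis .
  qed
  have "I \<le> L2_norm M f * L2_norm M h"
  proof (cases "L2_norm M f = 0")
    case True
    \<comment> \<open>Here 2 s I is bounded by the squared norm of h for all s; the s below makes it
      exceed this bound by 1.\<close>
    have "I \<le> 0"
    proof (rule ccontr)
      assume "\<not> I \<le> 0"
      then show False
        using quad[of "((L2_norm M h)\<^sup>2 + 1) / (2 * I)"] True by (simp add: field_simps)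
    qed
    then show ?thesis using True by simp
  next
    case False
    then have pos: "L2_norm M f > 0" using L2_norm_nonneg[of M f] by simp
    \<comment> \<open>The quotient of the norms balances the two terms on the right of
      \<open>quad\<close>. The result carries a factor \<open>L2_norm M h\<close>, which can be
      cancelled only when it is nonzero.\<close>
    have "2 * (L2_norm M h / L2_norm M f) * I \<le> 2 * (L2_norm M h)\<^sup>2"
      using quad[of "L2_norm M h / L2_norm M f"] pos by (simp add: power_divide)
    then have *: "L2_norm M h * I \<le> L2_norm M h * (L2_norm M f * L2_norm M h)"
      using pos by (simp add: field_simps power2_eq_square)
    show ?thesis
    proof (cases "L2_norm M h = 0")
      case True
      \<comment> \<open>With h of norm 0, the minimiser of s^2 ||f||^2 - 2 s I is s = I /
        ||f||^2.\<close>
      have "I \<le> 0"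
      proof (rule ccontr)
        assume neg: "\<not> I \<le> 0"
        have "2 * (I / (L2_norm M f)\<^sup>2) * I \<le> (I / (L2_norm M f)\<^sup>2)\<^sup>2 * (L2_norm M f)\<^sup>2"
          using quad[of "I / (L2_norm M f)\<^sup>2"] True by simp
        also have "\<dots> = (I / (L2_norm M f)\<^sup>2) * I"
          using pos by (simp add: field_simps power2_eq_square)
        finally have "(I / (L2_norm M f)\<^sup>2) * I \<le> 0" by linarith
        moreover have "(I / (L2_norm M f)\<^sup>2) * I > 0" using neg pos by simp
        ultimately show False by simp
      qed
      then show ?thesis using True by simp
    next
      case False
      then have "L2_norm M h > 0" using L2_norm_nonneg[of M h] by simp
      then show ?thesis using * by simp
    qed
  qed
  moreover have "norm (\<integral>x. f x * h x \<partial>M) \<le> I"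
    unfolding I_def using integral_norm_bound[of M "\<lambda>x. f x * h x"] by (simp add: norm_mult)
  ultimately show ?thesis by simp
qed

lemma L2_norm_cnj: "L2_norm M (\<lambda>x. cnj (f x)) = L2_norm M f"
  by (simp add: L2_norm_def)

lemma integral_cnj_self: "(\<integral>x. f x * cnj (f x) \<partial>M) = complex_of_real ((L2_norm M f)\<^sup>2)"
  by (simp only: L2_norm_square complex_norm_square[symmetric] integral_complex_of_real)

text \<open>Pair the sum s with itself, split the first factor, apply Cauchy-Schwarz to each part,
  and divide by the norm of s.\<close>

lemma L2_norm_add_le:
  fixes f h :: "'a \<Rightarrow> complex"
  assumes f: "in_L2 M f" and h: "in_L2 M h"
  shows "L2_norm M (\<lambda>x. f x + h x) \<le> L2_norm M f + L2_norm M h"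
proof -
  let ?s = "\<lambda>x. f x + h x"
  have s: "in_L2 M ?s" by (rule in_L2_add[OF f h])
  have "(\<integral>x. ?s x * cnj (?s x) \<partial>M) = (\<integral>x. f x * cnj (?s x) \<partial>M) + (\<integral>x. h x * cnj (?s x) \<partial>M)"
    using in_L2_prod_integrable[OF f in_L2_cnj[OF s]] in_L2_prod_integrable[OF h in_L2_cnj[OF s]]
    by (simp add: distrib_right)
  then have "norm (complex_of_real ((L2_norm M ?s)\<^sup>2))
      \<le> norm (\<integral>x. f x * cnj (?s x) \<partial>M) + norm (\<integral>x. h x * cnj (?s x) \<partial>M)"
    by (simp only: integral_cnj_self[symmetric] norm_triangle_ineq)
  also have "\<dots> \<le> L2_norm M f * L2_norm M ?s + L2_norm M h * L2_norm M ?s"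
    using Cauchy_Schwarz_L2[OF f in_L2_cnj[OF s]] Cauchy_Schwarz_L2[OF h in_L2_cnj[OF s]]
    by (intro add_mono) (simp_all only: L2_norm_cnj)
  finally have "L2_norm M ?s * L2_norm M ?s \<le> (L2_norm M f + L2_norm M h) * L2_norm M ?s"
    by (simp only: norm_of_real abs_power2 power2_eq_square distrib_right abs_mult_self_eq)
  then show ?thesis
    using L2_norm_nonneg[of M ?s] L2_norm_nonneg[of M f] L2_norm_nonneg[of M h]
    by (cases "L2_norm M ?s = 0") (auto simp: mult_le_cancel_right)
qed

text \<open>Cauchy-Schwarz applied to the difference. This is how the limits in the definition of
  the trace reach Green's formula.\<close>

lemma tendsto_integral_L2:
  fixes f h :: "'a \<Rightarrow> complex"
  assumes a: "\<And>n. in_L2 M (a n)" and f: "in_L2 M f" and h: "in_L2 M h"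
    and lim: "(\<lambda>n. L2_norm M (\<lambda>x. a n x - f x)) \<longlonglongrightarrow> 0"
  shows "(\<lambda>n. \<integral>x. a n x * h x \<partial>M) \<longlonglongrightarrow> (\<integral>x. f x * h x \<partial>M)"
proof -
  have "(\<lambda>n. (\<integral>x. a n x * h x \<partial>M) - (\<integral>x. f x * h x \<partial>M)) \<longlonglongrightarrow> 0"
  proof (rule Lim_null_comparison)
    show "(\<lambda>n. L2_norm M (\<lambda>x. a n x - f x) * L2_norm M h) \<longlonglongrightarrow> 0"
      using tendsto_mult_right[OF lim, of "L2_norm M h"] by simp
    have "(\<integral>x. a n x * h x \<partial>M) - (\<integral>x. f x * h x \<partial>M) = (\<integral>x. (a n x - f x) * h x \<partial>M)" for n
      using in_L2_prod_integrable[OF a h] in_L2_prod_integrable[OF f h]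
      by (simp add: left_diff_distrib)
    then show "\<forall>\<^sub>F n in sequentially. norm ((\<integral>x. a n x * h x \<partial>M) - (\<integral>x. f x * h x \<partial>M))
        \<le> L2_norm M (\<lambda>x. a n x - f x) * L2_norm M h"
      using Cauchy_Schwarz_L2[OF in_L2_diff[OF a f] h] by simp
  qed
  then show ?thesis by (rule LIM_zero_cancel)
qed

lemma L2_norm_mono_AE:
  fixes f :: "'a \<Rightarrow> 'b::{real_normed_vector,second_countable_topology}"
    and h :: "'a \<Rightarrow> 'c::{real_normed_vector,second_countable_topology}"
  assumes "in_L2 M f" "in_L2 M h" and le: "AE x in M. norm (f x) \<le> norm (h x)"
  shows "L2_norm M f \<le> L2_norm M h"
proof -
  have "AE x in M. (norm (f x))\<^sup>2 \<le> (norm (h x))\<^sup>2"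
    using le by eventually_elim (auto intro: power_mono)
  then show ?thesis
    unfolding L2_norm_def
    using assms by (intro real_sqrt_le_mono integral_mono_AE) (auto simp: in_L2_def)
qed

lemma L2_norm_mono:
  fixes f :: "'a \<Rightarrow> 'b::{real_normed_vector,second_countable_topology}"
    and h :: "'a \<Rightarrow> 'c::{real_normed_vector,second_countable_topology}"
  assumes "in_L2 M f" "in_L2 M h" "\<And>x. x \<in> space M \<Longrightarrow> norm (f x) \<le> norm (h x)"
  shows "L2_norm M f \<le> L2_norm M h"
  using assms by (intro L2_norm_mono_AE AE_I2)

text \<open>Replaces Riesz representation: a functional bound on a dense set bounds the norm.\<close>

lemma L2_norm_le_of_dense:
  fixes f :: "'a \<Rightarrow> complex"
  assumes f: "in_L2 M f" and A: "\<And>a. a \<in> A \<Longrightarrow> in_L2 M a"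
    and dense: "\<And>e. e > 0 \<Longrightarrow> \<exists>a\<in>A. L2_norm M (\<lambda>x. cnj (f x) - a x) < e"
    and bound: "\<And>a. a \<in> A \<Longrightarrow> norm (\<integral>x. f x * a x \<partial>M) \<le> R * L2_norm M a"
    and R: "R \<ge> 0"
  shows "L2_norm M f \<le> R"
proof -
  have "(L2_norm M f)\<^sup>2 \<le> R * L2_norm M f + e" if e: "e > 0" for e
  proof -
    \<comment> \<open>The pairing is bilinear, so the function to approximate is the conjugate of f.
      An approximation within d costs at most d (R + ||f||); the added 1 keeps the denominator
      positive.\<close>
    define d where "d = e / (R + L2_norm M f + 1)"
    have "R + L2_norm M f + 1 > 0" using R L2_norm_nonneg[of M f] by simp
    then have d: "d > 0" "d * (R + L2_norm M f) \<le> e"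
      using e by (simp_all add: d_def field_simps)
    obtain a where a: "a \<in> A" "L2_norm M (\<lambda>x. cnj (f x) - a x) < d" using dense[OF d(1)] by blast
    let ?r = "\<lambda>x. cnj (f x) - a x"
    have r: "in_L2 M ?r" by (intro in_L2_diff in_L2_cnj f A a)
    have "L2_norm M a \<le> L2_norm M (\<lambda>x. cnj (f x)) + L2_norm M (\<lambda>x. - ?r x)"
      using L2_norm_add_le[OF in_L2_cnj[OF f] in_L2_minus[OF r]] by simp
    also have "L2_norm M (\<lambda>x. - ?r x) = L2_norm M ?r" unfolding L2_norm_def norm_minus_cancel ..
    finally have na: "L2_norm M a \<le> L2_norm M f + d" using a(2) by (simp add: L2_norm_cnj)
    have "(\<integral>x. f x * cnj (f x) \<partial>M) = (\<integral>x. f x * a x \<partial>M) + (\<integral>x. f x * ?r x \<partial>M)"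
      using in_L2_prod_integrable[OF f A[OF a(1)]] in_L2_prod_integrable[OF f in_L2_cnj[OF f]]
      by (simp add: right_diff_distrib)
    then have "norm (complex_of_real ((L2_norm M f)\<^sup>2))
        \<le> norm (\<integral>x. f x * a x \<partial>M) + norm (\<integral>x. f x * ?r x \<partial>M)"
      by (simp only: integral_cnj_self[symmetric] norm_triangle_ineq)
    also have "\<dots> \<le> R * L2_norm M a + L2_norm M f * L2_norm M ?r"
      by (intro add_mono bound a Cauchy_Schwarz_L2 f r)
    also have "\<dots> \<le> R * (L2_norm M f + d) + L2_norm M f * d"
      using na a(2) R L2_norm_nonneg[of M f] by (intro add_mono mult_left_mono) auto
    also have "\<dots> \<le> R * L2_norm M f + e" using d(2) by (simp add: algebra_simps)
    finally show ?thesis by (simp only: norm_of_real abs_power2)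
  qed
  then have "(L2_norm M f)\<^sup>2 \<le> R * L2_norm M f" by (rule field_le_epsilon)
  then show ?thesis
    using L2_norm_nonneg[of M f] R
    by (cases "L2_norm M f = 0") (auto simp: power2_eq_square mult_le_cancel_right)
qed

section \<open>Integration over the square and its sides\<close>

definition unit_measure :: "real measure" where
  "unit_measure = restrict_space lborel {0<..<1}"

lemma space_unit_measure [simp]: "space unit_measure = {0<..<1}"
  by (simp add: unit_measure_def space_restrict_space)

lemma sets_unit_measure [measurable_cong]: "sets unit_measure = sets (restrict_space borel {0<..<1})"
  by (simp add: unit_measure_def sets_restrict_space)

lemma finite_measure_unit: "finite_measure unit_measure"
  by (rule finite_measureI) (simp add: unit_measure_def emeasure_restrict_space space_restrict_space)

lemma measure_unit_measure: "measure unit_measure {0<..<1} = 1"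
  by (simp add: unit_measure_def measure_restrict_space)

lemma space_square_measure [simp]: "space square_measure = unit_square"
  by (simp add: square_measure_def space_restrict_space)

lemma unit_square_borel [measurable]: "unit_square \<in> sets borel"
  by (simp add: unit_square_def open_Times borel_open)

lemma sets_square_measure [measurable_cong]: "sets square_measure = sets (restrict_space borel unit_square)"
  by (simp add: square_measure_def sets_restrict_space)

lemma finite_measure_square: "finite_measure square_measure"
proof -
  have "bounded unit_square"
    unfolding unit_square_def by (intro bounded_Times) auto
  then have "emeasure lborel unit_square < \<infinity>"
    by (rule emeasure_bounded_finite)
  then show ?thesis
    by (intro finite_measureI) (simp add: square_measure_def emeasure_restrict_space space_restrict_space)
qed

lemma continuous_side_param: "continuous_on A (side_param j)"
  by (cases "j = 1"; cases "j = 2"; cases "j = 3")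
    (auto simp: side_param_def[abs_def] intro!: continuous_intros)

lemma side_param_measurable [measurable]: "side_param j \<in> measurable unit_measure borel"
  unfolding unit_measure_def
  by (intro measurable_restrict_space1) (simp add: continuous_side_param borel_measurable_continuous_onI)

lemma side_measure_eq: "side_measure j = distr unit_measure borel (side_param j)"
  by (simp add: side_measure_def unit_measure_def)

lemma space_side_measure [simp]: "space (side_measure j) = UNIV"
  and sets_side_measure [simp, measurable_cong]: "sets (side_measure j) = sets borel"
  by (simp_all add: side_measure_def)

lemma finite_measure_side: "finite_measure (side_measure j)"
  unfolding side_measure_eq by (intro finite_measure.finite_measure_distr finite_measure_unit side_param_measurable)

lemma integral_side_measure:
  fixes f :: "plane \<Rightarrow> complex"
  assumes "f \<in> borel_measurable borel"
  shows "(\<integral>p. f p \<partial>side_measure j) = (\<integral>s. f (side_param j s) \<partial>unit_measure)"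
  unfolding side_measure_eq by (rule integral_distr) (use assms in auto)

text \<open>A side carries the image of \<open>unit_measure\<close>, so a pointwise check along the
  parametrisation suffices.\<close>

lemma AE_side_measure:
  assumes "\<And>s. 0 < s \<Longrightarrow> s < 1 \<Longrightarrow> P (side_param j s)" "{p. P p} \<in> sets borel"
  shows "AE p in side_measure j. P p"
  unfolding side_measure_eq using assms by (subst AE_distr_iff) auto

lemma in_L2_bounded:
  fixes f :: "'a \<Rightarrow> 'b::{real_normed_vector,second_countable_topology}"
  assumes M: "finite_measure M" and f: "f \<in> borel_measurable M"
    and B: "AE x in M. norm (f x) \<le> B"
  shows "in_L2 M f"
proof -
  have "integrable M (\<lambda>x. (norm (f x))\<^sup>2)"
  proof (rule finite_measure.integrable_const_bound[OF M, where B = "B\<^sup>2"])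
    show "AE x in M. norm ((norm (f x))\<^sup>2) \<le> B\<^sup>2"
      using B by eventually_elim (auto intro: power_mono)
  qed (use f in measurable)
  then show ?thesis using f by (simp add: in_L2_def)
qed

lemma compact_closed_square: "compact ({0..1} \<times> {0..1} :: plane set)"
  by (intro compact_Times compact_Icc)

lemma continuous_bounded_square:
  fixes f :: "plane \<Rightarrow> 'b::real_normed_vector"
  assumes "continuous_on UNIV f"
  obtains B where "\<And>p. p \<in> {0..1} \<times> {0..1} \<Longrightarrow> norm (f p) \<le> B"
proof -
  have "bounded (f ` ({0..1} \<times> {0..1}))"
    using assms by (intro compact_imp_bounded compact_continuous_image compact_closed_square)
      (auto intro: continuous_on_subset)
  then show thesis by (auto simp: bounded_iff intro: that)
qed

lemma borel_measurable_square:
  assumes "continuous_on UNIV f"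
  shows "f \<in> borel_measurable square_measure"
  unfolding square_measure_def
  by (intro measurable_restrict_space1) (use borel_measurable_continuous_onI[OF assms] in simp)

lemma in_L2_square_continuous:
  fixes f :: "plane \<Rightarrow> 'b::{real_normed_vector,second_countable_topology}"
  assumes "continuous_on UNIV f"
  shows "in_L2 square_measure f"
proof -
  obtain B where B: "\<And>p. p \<in> {0..1} \<times> {0..1} \<Longrightarrow> norm (f p) \<le> B"
    using continuous_bounded_square[OF assms] by metis
  show ?thesis
  proof (rule in_L2_bounded[OF finite_measure_square borel_measurable_square[OF assms]])
    show "AE x in square_measure. norm (f x) \<le> B"
      by (rule AE_I2) (auto simp: unit_square_def intro!: B)
  qed
qed

lemma in_L2_side_continuous:
  fixes f :: "plane \<Rightarrow> 'b::{real_normed_vector,second_countable_topology}"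
  assumes "continuous_on UNIV f"
  shows "in_L2 (side_measure j) f"
proof -
  obtain B where B: "\<And>p. p \<in> {0..1} \<times> {0..1} \<Longrightarrow> norm (f p) \<le> B"
    using continuous_bounded_square[OF assms] by metis
  have meas: "f \<in> borel_measurable borel" by (rule borel_measurable_continuous_onI[OF assms])
  show ?thesis
  proof (rule in_L2_bounded[OF finite_measure_side])
    show "f \<in> borel_measurable (side_measure j)" using meas by simp
    show "AE x in side_measure j. norm (f x) \<le> B"
    proof (rule AE_side_measure)
      show "{p. norm (f p) \<le> B} \<in> sets borel" using meas by measurable
    qed (auto simp: side_param_def intro!: B)
  qed
qed

lemma integrable_square_continuous:
  fixes f :: "plane \<Rightarrow> complex"
  assumes "continuous_on UNIV f"
  shows "integrable square_measure f"
  using in_L2_prod_integrable[OF in_L2_square_continuous[OF assms] in_L2_square_continuous[of "\<lambda>_. 1"]]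
  by simp

lemma continuous_bounded_unit:
  fixes f :: "real \<Rightarrow> 'b::real_normed_vector"
  assumes "continuous_on UNIV f"
  obtains B where "\<And>x. x \<in> {0..1} \<Longrightarrow> norm (f x) \<le> B"
proof -
  have "bounded (f ` {0..1})"
    using assms by (intro compact_imp_bounded compact_continuous_image compact_Icc)
      (auto intro: continuous_on_subset)
  then show thesis by (auto simp: bounded_iff intro: that)
qed

lemma integrable_unit_continuous:
  fixes f :: "real \<Rightarrow> 'b::euclidean_space"
  assumes "continuous_on UNIV f"
  shows "integrable unit_measure f"
proof -
  obtain B where B: "\<And>x. x \<in> {0..1} \<Longrightarrow> norm (f x) \<le> B"
    using continuous_bounded_unit[OF assms] by metis
  show ?thesis
  proof (rule finite_measure.integrable_const_bound[OF finite_measure_unit])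
    show "f \<in> borel_measurable unit_measure" unfolding unit_measure_def
      by (intro measurable_restrict_space1) (use borel_measurable_continuous_onI[OF assms] in simp)
    show "AE x in unit_measure. norm (f x) \<le> B" by (rule AE_I2) (auto intro: B)
  qed
qed

section \<open>The fundamental theorem of calculus on the interval and on the square\<close>

lemma unit_measure_FTC:
  fixes F :: "real \<Rightarrow> 'b::euclidean_space"
  assumes F: "\<And>x. (F has_vector_derivative f x) (at x)" and f: "continuous_on UNIV f"
  shows "(\<integral>x. f x \<partial>unit_measure) = F 1 - F 0"
proof -
  have "(\<integral>x. f x \<partial>unit_measure) = (\<integral>x. indicator {0<..<1} x *\<^sub>R f x \<partial>lborel)"
    unfolding unit_measure_def by (rule integral_restrict_space) simp
  also have "\<dots> = (\<integral>x. indicator {0..1} x *\<^sub>R f x \<partial>lborel)"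
  proof (rule integral_cong_AE)
    have "AE x in lborel. x \<noteq> (0::real)" "AE x in lborel. x \<noteq> (1::real)"
      by (rule AE_lborel_singleton)+
    then show "AE x in lborel. indicator {0<..<1} x *\<^sub>R f x = indicator {0..1} x *\<^sub>R f x"
      by eventually_elim (auto simp: indicator_def)
  qed (use borel_measurable_continuous_onI[OF f] in measurable)
  also have "\<dots> = F 1 - F 0"
    by (rule integral_FTC_atLeastAtMost)
      (use F f in \<open>auto intro: has_vector_derivative_at_within continuous_on_subset\<close>)
  finally show ?thesis .
qed

text \<open>Fubini for Lebesgue measure on the plane: the indicator of the square is the product of
  one indicator in each variable.\<close>

lemma integral_square_iterated:
  fixes f :: "plane \<Rightarrow> complex"
  assumes f: "continuous_on UNIV f"
  shows "(\<integral>p. f p \<partial>square_measure) = (\<integral>x. (\<integral>y. f (x, y) \<partial>unit_measure) \<partial>unit_measure)"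
    and "(\<integral>p. f p \<partial>square_measure) = (\<integral>y. (\<integral>x. f (x, y) \<partial>unit_measure) \<partial>unit_measure)"
proof -
  let ?I = "{0<..<1::real}"
  let ?h = "\<lambda>x y. indicator ?I x *\<^sub>R (indicator ?I y *\<^sub>R f (x, y))"
  have h: "indicator unit_square p *\<^sub>R f p = case_prod ?h p" for p
    by (auto simp: unit_square_def indicator_def split: prod.splits)
  have int: "integrable (lborel \<Otimes>\<^sub>M lborel) (case_prod ?h)"
    using integrable_square_continuous[OF f]
    by (simp add: square_measure_def integrable_restrict_space lborel_prod h)
  have eq: "(\<integral>p. f p \<partial>square_measure) = (\<integral>p. case_prod ?h p \<partial>(lborel \<Otimes>\<^sub>M lborel))"
    by (simp add: square_measure_def integral_restrict_space lborel_prod h)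
  have "(\<integral>x. \<integral>y. ?h x y \<partial>lborel \<partial>lborel) = (\<integral>p. case_prod ?h p \<partial>(lborel \<Otimes>\<^sub>M lborel))"
    using lborel_pair.integral_fst[OF int] by simp
  then show "(\<integral>p. f p \<partial>square_measure) = (\<integral>x. (\<integral>y. f (x, y) \<partial>unit_measure) \<partial>unit_measure)"
    by (simp add: eq unit_measure_def integral_restrict_space del: scaleR_scaleR)
  have "(\<integral>y. \<integral>x. ?h x y \<partial>lborel \<partial>lborel) = (\<integral>p. case_prod ?h p \<partial>(lborel \<Otimes>\<^sub>M lborel))"
    using lborel_pair.integral_snd[OF int] by simp
  moreover have "?h x y = indicator ?I y *\<^sub>R (indicator ?I x *\<^sub>R f (x, y))" for x y
    by (simp add: mult.commute)
  ultimately show "(\<integral>p. f p \<partial>square_measure) = (\<integral>y. (\<integral>x. f (x, y) \<partial>unit_measure) \<partial>unit_measure)"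
    by (simp add: eq unit_measure_def integral_restrict_space del: scaleR_scaleR)
qed

text \<open>The divergence theorem for the field (f, 0): integrating in x first leaves only the
  sides 2 and 4, where the outward normal is +1 and -1 in the x direction.\<close>

lemma integral_square_dx:
  fixes f :: "plane \<Rightarrow> complex"
  assumes f: "continuous_on UNIV f" and f': "continuous_on UNIV f'"
    and D: "\<And>x y. ((\<lambda>x. f (x, y)) has_vector_derivative f' (x, y)) (at x)"
  shows "(\<integral>p. f' p \<partial>square_measure) = (\<integral>p. f p \<partial>side_measure 2) - (\<integral>p. f p \<partial>side_measure 4)"
proof -
  have cont: "continuous_on UNIV (\<lambda>x. f' (x, y))" "continuous_on UNIV (\<lambda>y. f (x, y))" for x y
    by (rule continuous_on_compose2[OF f'] continuous_on_compose2[OF f]; auto intro!: continuous_intros)+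
  have "(\<integral>p. f' p \<partial>square_measure) = (\<integral>y. f (1, y) - f (0, y) \<partial>unit_measure)"
    unfolding integral_square_iterated(2)[OF f']
    by (simp add: unit_measure_FTC[OF D cont(1)])
  also have "\<dots> = (\<integral>y. f (1, y) \<partial>unit_measure) - (\<integral>y. f (0, y) \<partial>unit_measure)"
    by (intro Bochner_Integration.integral_diff integrable_unit_continuous cont)
  finally show ?thesis
    using borel_measurable_continuous_onI[OF f] by (simp add: integral_side_measure side_param_def)
qed

lemma integral_square_dy:
  fixes f :: "plane \<Rightarrow> complex"
  assumes f: "continuous_on UNIV f" and f': "continuous_on UNIV f'"
    and D: "\<And>x y. ((\<lambda>y. f (x, y)) has_vector_derivative f' (x, y)) (at y)"
  shows "(\<integral>p. f' p \<partial>square_measure) = (\<integral>p. f p \<partial>side_measure 3) - (\<integral>p. f p \<partial>side_measure 1)"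
proof -
  have cont: "continuous_on UNIV (\<lambda>y. f' (x, y))" "continuous_on UNIV (\<lambda>x. f (x, y))" for x y
    by (rule continuous_on_compose2[OF f'] continuous_on_compose2[OF f]; auto intro!: continuous_intros)+
  have "(\<integral>p. f' p \<partial>square_measure) = (\<integral>x. f (x, 1) - f (x, 0) \<partial>unit_measure)"
    unfolding integral_square_iterated(1)[OF f']
    by (simp add: unit_measure_FTC[OF D cont(1)])
  also have "\<dots> = (\<integral>x. f (x, 1) \<partial>unit_measure) - (\<integral>x. f (x, 0) \<partial>unit_measure)"
    by (intro Bochner_Integration.integral_diff integrable_unit_continuous cont)
  finally show ?thesis
    using borel_measurable_continuous_onI[OF f] by (simp add: integral_side_measure side_param_def)
qed

section \<open>The ordinary differential equation of a single mode\<close>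

text \<open>The solution is written with complex sine and cosine of z x, where z^2 = \<mu>, so the
  oscillating and the evanescent case share one formula. Only \<mu> = 0 is separate, because of the
  division by z.\<close>

lemma oscillator_initial_value_problem:
  fixes a b :: complex and \<mu> :: real
  obtains w w' where "\<And>x::real. (w has_vector_derivative w' x) (at x)"
    and "\<And>x::real. (w' has_vector_derivative - (complex_of_real \<mu> * w x)) (at x)"
    and "w 0 = a" and "w' 0 = b"
proof (cases "\<mu> = 0")
  case True
  have "((\<lambda>x. a + of_real x * b) has_vector_derivative b) (at x)" for x :: real
    by (auto intro!: derivative_eq_intros simp: has_vector_derivative_def scaleR_conv_of_real)
  then show thesis
    using that[of "\<lambda>x. a + of_real x * b" "\<lambda>_. b"] True by simp
next
  case False
  define z where "z = csqrt (complex_of_real \<mu>)"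
  have z: "z * z = of_real \<mu>" "z \<noteq> 0"
    using False power2_csqrt[of "complex_of_real \<mu>"] by (auto simp: z_def power2_eq_square)
  define W where "W = (\<lambda>x. a * cos (z * x) + b / z * sin (z * x))"
  define W' where "W' = (\<lambda>x. - (a * z * sin (z * x)) + b * cos (z * x))"
  have "(W has_field_derivative W' x) (at x)" for x
    unfolding W_def W'_def using z(2)
    by (auto intro!: derivative_eq_intros simp: field_simps)
  then have 1: "((\<lambda>x. W (of_real x)) has_vector_derivative W' (of_real x)) (at x)" for x
    by (intro has_vector_derivative_real_field)
  have "(W' has_field_derivative - (z * z * W x)) (at x)" for x
    unfolding W_def W'_def using z(2)
    by (auto intro!: derivative_eq_intros simp: field_simps)
  then have 2: "((\<lambda>x. W' (of_real x)) has_vector_derivative - (of_real \<mu> * W (of_real x))) (at x)" for x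
    unfolding z(1) by (intro has_vector_derivative_real_field)
  show thesis
    by (rule that[OF 1 2]) (simp_all add: W_def W'_def)
qed

text \<open>The bound rests on the conserved quantities \<open>Im (w' \<cdot> cnj w)\<close> and
  \<open>\<bar>w'\<bar>\<^sup>2 + \<mu> \<bar>w\<bar>\<^sup>2\<close>, where \<open>\<mu> = k\<^sup>2 - \<sigma>\<^sup>2\<close>; for an evanescent mode (\<open>\<mu> < 0\<close>) the function
  \<open>\<bar>w\<bar>\<^sup>2\<close> is convex and nonincreasing instead.\<close>

lemma mode_estimate:
  fixes w w' :: "real \<Rightarrow> complex" and k \<sigma> :: real
  assumes k: "k > 0" and \<sigma>: "\<sigma> = 0 \<or> \<sigma> \<ge> 3/2"
    and w: "\<And>x. (w has_vector_derivative w' x) (at x)"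
    and w': "\<And>x. (w' has_vector_derivative - (complex_of_real (k\<^sup>2 - \<sigma>\<^sup>2) * w x)) (at x)"
    and bc: "w 1 = 0 \<or> w' 1 = 0 \<or> w' 1 = \<i> * complex_of_real k * w 1"
    and g: "g = - w' 0 - \<i> * complex_of_real k * w 0"
  shows "2 * k\<^sup>2 * (\<integral>x. (norm (w x))\<^sup>2 \<partial>unit_measure) + Re (g * cnj (w 0))
    \<le> 6 * (max k 1)\<^sup>2 * (norm g)\<^sup>2"
proof -
  define \<mu> where "\<mu> = k\<^sup>2 - \<sigma>\<^sup>2"
  define p where "p = (\<lambda>x. Re (w x))"
  define q where "q = (\<lambda>x. Im (w x))"
  define p' where "p' = (\<lambda>x. Re (w' x))"
  define q' where "q' = (\<lambda>x. Im (w' x))"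
  have Dp [derivative_intros]: "(p has_real_derivative p' x) (at x)" for x
    unfolding p_def p'_def has_real_derivative_iff_has_vector_derivative
    by (rule bounded_linear.has_vector_derivative[OF bounded_linear_Re w])
  have Dq [derivative_intros]: "(q has_real_derivative q' x) (at x)" for x
    unfolding q_def q'_def has_real_derivative_iff_has_vector_derivative
    by (rule bounded_linear.has_vector_derivative[OF bounded_linear_Im w])
  have Dp' [derivative_intros]: "(p' has_real_derivative - \<mu> * p x) (at x)" for x
    using bounded_linear.has_vector_derivative[OF bounded_linear_Re w', of x]
    by (simp add: has_real_derivative_iff_has_vector_derivative p_def p'_def \<mu>_def algebra_simps)
  have Dq' [derivative_intros]: "(q' has_real_derivative - \<mu> * q x) (at x)" for x
    using bounded_linear.has_vector_derivative[OF bounded_linear_Im w', of x]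
    by (simp add: has_real_derivative_iff_has_vector_derivative q_def q'_def \<mu>_def algebra_simps)
  \<comment> \<open>\<open>n\<close> is |w|^2 and \<open>n'\<close> is |w'|^2, which is not the
    derivative of \<open>n\<close>. \<open>R\<close> and \<open>J\<close> are the real and imaginary
    parts of w' times the conjugate of w, so \<open>R\<close> is half the derivative of
    \<open>n\<close>.\<close>
  define n where "n = (\<lambda>x. (p x)\<^sup>2 + (q x)\<^sup>2)"
  define n' where "n' = (\<lambda>x. (p' x)\<^sup>2 + (q' x)\<^sup>2)"
  define R where "R = (\<lambda>x. p x * p' x + q x * q' x)"
  define J where "J = (\<lambda>x. p x * q' x - q x * p' x)"
  define G where "G = (norm g)\<^sup>2"
  define I where "I = (\<integral>x. n x \<partial>unit_measure)"
  have n_norm: "(norm (w x))\<^sup>2 = n x" for x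
    by (simp add: n_def p_def q_def cmod_power2)
  have n_pos: "n x \<ge> 0" "n' x \<ge> 0" for x by (simp_all add: n_def n'_def)
  have Dn: "(n has_real_derivative 2 * R x) (at x)" for x
    unfolding n_def R_def by (auto intro!: derivative_eq_intros)
  have DR: "(R has_real_derivative n' x - \<mu> * n x) (at x)" for x
    unfolding n_def n'_def R_def by (auto intro!: derivative_eq_intros simp: power2_eq_square algebra_simps)
  have R2: "(R x)\<^sup>2 \<le> n x * n' x" for x
  proof -
    have "n x * n' x = (R x)\<^sup>2 + (J x)\<^sup>2"
      by (simp add: n_def n'_def R_def J_def power2_eq_square algebra_simps)
    then show ?thesis by simp
  qed
  have cont_n: "continuous_on UNIV n"
    using Dn by (intro DERIV_continuous_on) (auto intro: DERIV_subset)
  have int_n: "integrable unit_measure n" by (rule integrable_unit_continuous[OF cont_n])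
  have J_const: "J 0 = J 1"
  proof (rule DERIV_isconst_all[where f = J])
    show "\<forall>x. (J has_real_derivative 0) (at x)"
      unfolding J_def by (auto intro!: derivative_eq_intros simp: algebra_simps)
  qed
  have K_const: "n' x + \<mu> * n x = n' 0 + \<mu> * n 0" for x
  proof (rule DERIV_isconst_all[where f = "\<lambda>x. n' x + \<mu> * n x"])
    show "\<forall>x. ((\<lambda>x. n' x + \<mu> * n x) has_real_derivative 0) (at x)"
      unfolding n_def n'_def by (auto intro!: derivative_eq_intros simp: algebra_simps)
  qed
  \<comment> \<open>Each of the three conditions makes w' times the conjugate of w at 1 equal to 0
    or to i k |w|^2: the real part vanishes and the imaginary part is nonnegative.\<close>
  have bc': "R 1 = 0" "J 1 \<ge> 0"
  proof -
    have "(p 1 = 0 \<and> q 1 = 0) \<or> (p' 1 = 0 \<and> q' 1 = 0) \<or> (p' 1 = - (k * q 1) \<and> q' 1 = k * p 1)"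
      using bc by (auto simp: p_def q_def p'_def q'_def)
    moreover have "p 1 * (k * p 1) + q 1 * (k * q 1) \<ge> 0"
      using k by (simp add: mult.left_commute[of _ k])
    ultimately show "R 1 = 0" "J 1 \<ge> 0" by (auto simp: R_def J_def)
  qed
  \<comment> \<open>Expand |w'(0) + i k w(0)|^2. The cross term 2 k J(0) = 2 k J(1) is nonnegative,
    so the datum controls w'(0) and k w(0) separately.\<close>
  have "G = n' 0 + k\<^sup>2 * n 0 + 2 * k * J 0"
    unfolding G_def g cmod_power2 n_def n'_def J_def
    by (simp add: p_def q_def p'_def q'_def power2_eq_square algebra_simps)
  then have G: "n' 0 + k\<^sup>2 * n 0 \<le> G" using bc'(2) J_const k by simp
  have G_pos: "G \<ge> 0" by (simp add: G_def)
  have Re_g: "Re (g * cnj (w 0)) = - R 0"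
    by (simp add: g R_def p_def q_def p'_def q'_def algebra_simps)
  \<comment> \<open>Integrate the derivative of \<open>R\<close>, which vanishes at 1, and express
    \<open>n'\<close> through the conserved quantity.\<close>
  have energy: "- R 0 = n' 0 + \<mu> * n 0 - 2 * \<mu> * I"
  proof -
    have eq: "n' x - \<mu> * n x = (n' 0 + \<mu> * n 0) - 2 * \<mu> * n x" for x
      using K_const[of x] by linarith
    have "- R 0 = (\<integral>x. n' x - \<mu> * n x \<partial>unit_measure)"
    proof -
      have "continuous_on UNIV (\<lambda>x. n' x - \<mu> * n x)"
        unfolding eq by (intro continuous_intros cont_n)
      then show ?thesis
        using unit_measure_FTC[of R "\<lambda>x. n' x - \<mu> * n x"] DR bc'
        by (simp add: has_real_derivative_iff_has_vector_derivative)
    qed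
    also have "\<dots> = (\<integral>x. (n' 0 + \<mu> * n 0) - 2 * \<mu> * n x \<partial>unit_measure)"
      unfolding eq ..
    also have "\<dots> = n' 0 + \<mu> * n 0 - 2 * \<mu> * I"
      using int_n finite_measure.integrable_const[OF finite_measure_unit, of "n' 0 + \<mu> * n 0"]
      by (simp add: I_def measure_unit_measure)
    finally show ?thesis .
  qed
  have I_le: "I \<le> (\<integral>x. f x \<partial>unit_measure)"
    if "\<And>x. 0 < x \<Longrightarrow> x < 1 \<Longrightarrow> n x \<le> f x" "continuous_on UNIV f" for f :: "real \<Rightarrow> real"
    unfolding I_def using that integrable_unit_continuous[OF that(2)] int_n
    by (intro integral_mono) auto
  define m where "m = max k 1"
  have m: "m \<ge> 1" "m \<ge> k" by (simp_all add: m_def)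
  have mG: "G \<le> m\<^sup>2 * G" using m G_pos mult_right_mono[of 1 "m\<^sup>2" G] by simp
  have "2 * k\<^sup>2 * I - R 0 \<le> 6 * m\<^sup>2 * G"
  proof (cases "\<mu> \<ge> 0")
    case True
    \<comment> \<open>The multiples of k^2 I cancel and leave 2 \<sigma>^2 I, so frequency zero
      needs no bound on I at all.\<close>
    have "2 * k\<^sup>2 * I - R 0 = n' 0 + \<mu> * n 0 + 2 * \<sigma>\<^sup>2 * I"
      using energy by (simp add: \<mu>_def algebra_simps)
    moreover have "\<mu> * n 0 \<le> k\<^sup>2 * n 0" using n_pos by (intro mult_right_mono) (auto simp: \<mu>_def)
    ultimately have *: "2 * k\<^sup>2 * I - R 0 \<le> G + 2 * \<sigma>\<^sup>2 * I" using G by simp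
    show ?thesis
    proof (cases "\<sigma> = 0")
      case True
      then show ?thesis using * mG G_pos by simp
    next
      case False
      then have lam: "\<sigma> \<ge> 3/2" using \<sigma> by simp
      have lk: "\<sigma>\<^sup>2 \<le> k\<^sup>2" using True by (simp add: \<mu>_def)
      then have "k \<ge> 3/2" using lam k power2_le_imp_le[of \<sigma> k] by simp
      then have k1: "k \<ge> 1" and "k\<^sup>2 \<ge> 1" by auto
      \<comment> \<open>For \<mu> \<ge> 0 the conserved quantity dominates |w'|^2 at every
        point.\<close>
      have s: "norm (w' x) \<le> norm g" for x
      proof -
        have "n' x \<le> n' x + \<mu> * n x" using True n_pos by simp
        also have "\<dots> \<le> G" using K_const[of x] G \<open>\<mu> * n 0 \<le> k\<^sup>2 * n 0\<close> by linarith
        finally have "(norm (w' x))\<^sup>2 \<le> (norm g)\<^sup>2"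
          by (simp add: n'_def p'_def q'_def cmod_power2 G_def)
        then show ?thesis by (rule power2_le_imp_le) simp
      qed
      have w0: "norm (w 0) \<le> norm g"
      proof -
        have "n 0 \<le> k\<^sup>2 * n 0" using \<open>k\<^sup>2 \<ge> 1\<close> n_pos mult_right_mono[of 1 "k\<^sup>2" "n 0"] by simp
        then have "(norm (w 0))\<^sup>2 \<le> (norm g)\<^sup>2" using G n_pos(2)[of 0] by (simp add: n_norm G_def)
        then show ?thesis by (rule power2_le_imp_le) simp
      qed
      \<comment> \<open>The value at 0 and the slope are both bounded by |g|, so |w| grows at most
        like (1 + x) |g|. The integral of (1 + x)^2 over the unit interval is 7/3.\<close>
      have "n x \<le> (1 + x)\<^sup>2 * G" if x: "0 < x" "x < 1" for x
      proof -
        have "continuous_on {0..x} w"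
          using w by (intro continuous_on_vector_derivative) (auto intro: has_vector_derivative_at_within)
        then obtain t where "norm (w x - w 0) \<le> norm ((x - 0) *\<^sub>R w' t)"
          using mvt_general[of 0 x w "\<lambda>t h. h *\<^sub>R w' t"] x w by (auto simp: has_vector_derivative_def)
        also have "\<dots> \<le> x * norm g" using x s by (simp add: mult_left_mono)
        finally have "norm (w x) \<le> (1 + x) * norm g"
          using w0 norm_triangle_sub[of "w x" "w 0"] by (simp add: algebra_simps)
        then have "(norm (w x))\<^sup>2 \<le> ((1 + x) * norm g)\<^sup>2" by (intro power_mono) auto
        then show ?thesis by (simp add: n_norm G_def power_mult_distrib)
      qed
      then have "I \<le> (\<integral>x. (1 + x)\<^sup>2 * G \<partial>unit_measure)"
        by (intro I_le continuous_intros) auto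
      also have "\<dots> = (1 + 1)^3 / 3 * G - (1 + 0)^3 / 3 * G"
      proof (rule unit_measure_FTC)
        show "((\<lambda>x. (1 + x)^3 / 3 * G) has_vector_derivative (1 + x)\<^sup>2 * G) (at x)" for x :: real
          unfolding has_real_derivative_iff_has_vector_derivative[symmetric]
          by (auto intro!: derivative_eq_intros simp: power2_eq_square)
      qed (auto intro!: continuous_intros)
      finally have "I \<le> 7/3 * G" by simp
      \<comment> \<open>Here \<sigma> \<le> k \<le> m. The resulting 14/3, with 1 for the term G,
        makes 17/3 \<le> 6.\<close>
      have "2 * \<sigma>\<^sup>2 * I \<le> (2 * m\<^sup>2) * (7/3 * G)"
        using lk m k G_pos order_trans[OF lk power_mono[of k m 2]] \<open>I \<le> 7/3 * G\<close>
        by (intro mult_mono) (auto simp: I_def n_pos intro!: Bochner_Integration.integral_nonneg)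
      also have "\<dots> = 14/3 * (m\<^sup>2 * G)" by simp
      finally have "2 * k\<^sup>2 * I - R 0 \<le> 6 * (m\<^sup>2 * G)" using * mG G_pos by linarith
      then show ?thesis by (simp only: mult.assoc)
    qed
  next
    case False
    \<comment> \<open>In the evanescent case \<open>R\<close> is nondecreasing and ends at 0, hence
      is nonpositive, and |w|^2 is largest at 0.\<close>
    have DR_pos: "n' x - \<mu> * n x \<ge> 0" for x
      using mult_nonpos_nonneg[of \<mu> "n x"] False n_pos[of x] by linarith
    have R_neg: "R x \<le> 0" if "x \<le> 1" for x
      using DERIV_nonneg_imp_nondecreasing[of x 1 R] DR DR_pos that bc'(1) by fastforce
    have n_dec: "n y \<le> n x" if "x \<le> y" "y \<le> 1" for x y
      using DERIV_nonpos_imp_nonincreasing[of x y n] Dn R_neg that by fastforce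
    have "I \<le> (\<integral>x. n 0 \<partial>unit_measure)" by (rule I_le) (use n_dec in auto)
    then have "I \<le> n 0" by (simp add: measure_unit_measure)
    then have "k\<^sup>2 * I \<le> k\<^sup>2 * n 0" by (intro mult_left_mono) auto
    then have kI: "k\<^sup>2 * I \<le> G" using G n_pos(2)[of 0] by linarith
    \<comment> \<open>The datum controls k^2 |w(0)|^2, which bounds |w(0)|^2 itself only for k \<ge>
      1. Below 1 the gap between k and the frequency takes over.\<close>
    have "- R 0 \<le> 2 * m\<^sup>2 * G"
    proof (cases "k \<ge> 1")
      case True
      have "(R 0)\<^sup>2 \<le> n 0 * n' 0" by (rule R2)
      also have "\<dots> \<le> G * G"
      proof (intro mult_mono)
        have "n 0 \<le> k\<^sup>2 * n 0" using True n_pos mult_right_mono[of 1 "k\<^sup>2" "n 0"] by simp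
        then show "n 0 \<le> G" using G n_pos(2)[of 0] by linarith
        show "n' 0 \<le> G" using G n_pos(1)[of 0] by (smt (verit) zero_le_mult_iff zero_le_power2)
      qed (use G_pos n_pos in auto)
      finally have "- R 0 \<le> G" using G_pos by (intro power2_le_imp_le[of "- R 0" G]) (simp_all add: power2_eq_square)
      then show ?thesis using mG G_pos by simp
    next
      case k1: False
      have k2: "k\<^sup>2 \<le> 1" using k k1 by (simp add: power_le_one)
      have "\<sigma> \<noteq> 0" using False k by (auto simp: \<mu>_def)
      then have "\<sigma> \<ge> 3/2" using \<sigma> by simp
      then have "\<sigma>\<^sup>2 \<ge> (3/2)\<^sup>2" by (intro power_mono) auto
      then have nu: "- \<mu> \<ge> 1" using k2 by (simp add: \<mu>_def power2_eq_square)
      have nu_n: "- \<mu> * n x \<ge> n x" for x using mult_right_mono[OF nu n_pos(1)[of x]] by simp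
      \<comment> \<open>The derivative 2 R + n' - \<mu> n is at least |w + w'|^2, because -\<mu>
        \<ge> 1.\<close>
      have "n 0 + R 0 \<le> n 1 + R 1"
      proof (rule DERIV_nonneg_imp_nondecreasing[of 0 1 "\<lambda>x. n x + R x"])
        fix x :: real
        have "2 * R x + n' x + n x = (p x + p' x)\<^sup>2 + (q x + q' x)\<^sup>2"
          by (simp add: R_def n_def n'_def power2_eq_square algebra_simps)
        then have "0 \<le> 2 * R x + (n' x - \<mu> * n x)"
          using nu_n[of x] zero_le_power2[of "p x + p' x"] zero_le_power2[of "q x + q' x"] by linarith
        then show "\<exists>y. ((\<lambda>x. n x + R x) has_real_derivative y) (at x) \<and> 0 \<le> y"
          using DERIV_add[OF Dn DR] by blast
      qed simp
      \<comment> \<open>The derivative of \<open>R\<close> is at least n(x) \<ge> n(1), so n(1)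
        \<le> -R(0). With the previous inequality this bounds |w(0)|^2 by -2 R(0).\<close>
      moreover have "R 0 - 0 * n 1 \<le> R 1 - 1 * n 1"
      proof (rule DERIV_nonneg_imp_nondecreasing[of 0 1 "\<lambda>x. R x - x * n 1"])
        fix x :: real
        assume x: "0 \<le> x" "x \<le> 1"
        have "0 \<le> (n' x - \<mu> * n x) - n 1"
          using nu_n[of x] n_pos(2)[of x] n_dec[OF x(2)] by simp
        moreover have "((\<lambda>x. R x - x * n 1) has_real_derivative (n' x - \<mu> * n x) - n 1) (at x)"
          by (auto intro!: derivative_eq_intros DR)
        ultimately show "\<exists>y. ((\<lambda>x. R x - x * n 1) has_real_derivative y) (at x) \<and> 0 \<le> y" by blast
      qed simp
      ultimately have n0: "n 0 \<le> - 2 * R 0" using bc'(1) by simp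
      \<comment> \<open>Dividing R(0)^2 \<le> -2 R(0) G by -R(0) gives a bound that does not
        degenerate as k tends to 0.\<close>
      have "(R 0)\<^sup>2 \<le> n 0 * n' 0" by (rule R2)
      also have "\<dots> \<le> (- 2 * R 0) * G"
      proof (intro mult_mono n0)
        show "n' 0 \<le> G" using G n_pos(1)[of 0] by (smt (verit) zero_le_mult_iff zero_le_power2)
      qed (use R_neg[of 0] n_pos in auto)
      finally have "(- R 0) * (- R 0) \<le> (- R 0) * (2 * G)" by (simp add: power2_eq_square)
      then have "- R 0 \<le> 2 * G"
        using R_neg[of 0] G_pos mult_le_cancel_left_pos[of "- R 0" "- R 0" "2 * G"] by (cases "R 0 = 0") auto
      then show ?thesis using mG by simp
    qed
    then show ?thesis using kI mG G_pos by (simp only: mult.assoc)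
  qed
  then show ?thesis by (simp only: n_norm Re_g I_def G_def m_def diff_conv_add_uminus)
qed

section \<open>Smooth functions and Green's formula\<close>

lemma smooth_continuous: "smooth \<phi> \<Longrightarrow> continuous_on UNIV \<phi>"
  unfolding smooth_def using C_diff.simps(1) by blast

lemma smooth_continuous_grad:
  assumes "smooth \<phi>"
  shows "continuous_on UNIV (\<lambda>p. fst (grad \<phi> p))" "continuous_on UNIV (\<lambda>p. snd (grad \<phi> p))"
    "continuous_on UNIV (grad \<phi>)"
proof -
  have "C_diff (Suc 0) \<phi>" using assms by (simp add: smooth_def)
  then show *: "continuous_on UNIV (\<lambda>p. fst (grad \<phi> p))" "continuous_on UNIV (\<lambda>p. snd (grad \<phi> p))"
    by simp_all
  show "continuous_on UNIV (grad \<phi>)"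
    using continuous_on_Pair[OF *] by simp
qed

text \<open>Compose the Frechet derivative with axis-parallel lines; by linearity its value at (h,
  0) is h times the first component of \<open>grad\<close>.\<close>

lemma smooth_partial_derivatives:
  assumes "smooth \<phi>"
  shows "((\<lambda>x. \<phi> (x, y)) has_vector_derivative fst (grad \<phi> (x, y))) (at x)"
    and "((\<lambda>y. \<phi> (x, y)) has_vector_derivative snd (grad \<phi> (x, y))) (at y)"
proof -
  have "C_diff (Suc 0) \<phi>" using assms by (simp add: smooth_def)
  then have "\<phi> differentiable at (x, y)" by (simp add: differentiable_on_def)
  then have D: "(\<phi> has_derivative frechet_derivative \<phi> (at (x, y))) (at (x, y))"
    by (simp add: frechet_derivative_works)
  interpret linear "frechet_derivative \<phi> (at (x, y))"
    using D by (rule has_derivative_linear)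
  have "((\<lambda>x. (x, y)) has_derivative (\<lambda>h. (h, 0))) (at x)"
    by (auto intro!: derivative_eq_intros)
  from has_derivative_compose[OF this D]
  show "((\<lambda>x. \<phi> (x, y)) has_vector_derivative fst (grad \<phi> (x, y))) (at x)"
    by (simp add: has_vector_derivative_def grad_def scale[symmetric])
  have "((\<lambda>y. (x, y)) has_derivative (\<lambda>h. (0, h))) (at y)"
    by (auto intro!: derivative_eq_intros)
  from has_derivative_compose[OF this D]
  show "((\<lambda>y. \<phi> (x, y)) has_vector_derivative snd (grad \<phi> (x, y))) (at y)"
    by (simp add: has_vector_derivative_def grad_def scale[symmetric])
qed

lemma integral_parts_dx:
  fixes f h :: "plane \<Rightarrow> complex"
  assumes f: "continuous_on UNIV f" and f': "continuous_on UNIV f'"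
    and h: "continuous_on UNIV h" and h': "continuous_on UNIV h'"
    and Df: "\<And>x y. ((\<lambda>x. f (x, y)) has_vector_derivative f' (x, y)) (at x)"
    and Dh: "\<And>x y. ((\<lambda>x. h (x, y)) has_vector_derivative h' (x, y)) (at x)"
  shows "(\<integral>p. f' p * h p \<partial>square_measure)
    = (\<integral>p. f p * h p \<partial>side_measure 2) - (\<integral>p. f p * h p \<partial>side_measure 4)
      - (\<integral>p. f p * h' p \<partial>square_measure)"
proof -
  have "(\<integral>p. f p * h' p + f' p * h p \<partial>square_measure)
      = (\<integral>p. f p * h p \<partial>side_measure 2) - (\<integral>p. f p * h p \<partial>side_measure 4)"
    by (rule integral_square_dx) (intro continuous_intros f f' h h' has_vector_derivative_mult Df Dh)+
  moreover have "integrable square_measure (\<lambda>p. f p * h' p)" "integrable square_measure (\<lambda>p. f' p * h p)"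
    by (intro integrable_square_continuous continuous_intros f f' h h')+
  ultimately show ?thesis by (simp add: algebra_simps)
qed

lemma integral_parts_dy:
  fixes f h :: "plane \<Rightarrow> complex"
  assumes f: "continuous_on UNIV f" and f': "continuous_on UNIV f'"
    and h: "continuous_on UNIV h" and h': "continuous_on UNIV h'"
    and Df: "\<And>x y. ((\<lambda>y. f (x, y)) has_vector_derivative f' (x, y)) (at y)"
    and Dh: "\<And>x y. ((\<lambda>y. h (x, y)) has_vector_derivative h' (x, y)) (at y)"
  shows "(\<integral>p. f' p * h p \<partial>square_measure)
    = (\<integral>p. f p * h p \<partial>side_measure 3) - (\<integral>p. f p * h p \<partial>side_measure 1)
      - (\<integral>p. f p * h' p \<partial>square_measure)"
proof -
  have "(\<integral>p. f p * h' p + f' p * h p \<partial>square_measure)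
      = (\<integral>p. f p * h p \<partial>side_measure 3) - (\<integral>p. f p * h p \<partial>side_measure 1)"
    by (rule integral_square_dy) (intro continuous_intros f f' h h' has_vector_derivative_mult Df Dh)+
  moreover have "integrable square_measure (\<lambda>p. f p * h' p)" "integrable square_measure (\<lambda>p. f' p * h p)"
    by (intro integrable_square_continuous continuous_intros f f' h h')+
  ultimately show ?thesis by (simp add: algebra_simps)
qed

text \<open>Green's formula needs only pairings with continuous functions, so the norm convergences
  in \<open>has_trace\<close> are reduced to convergence of such integrals. The norm of a pair
  dominates its components, which splits the gradient.\<close>

lemma has_trace_approximation:
  assumes "in_L2 square_measure u" "in_L2 square_measure Du" "has_trace u Du T"
  obtains \<phi> where "\<And>n. smooth (\<phi> n)"
    and "\<And>h. continuous_on UNIV h \<Longrightarrow>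
      (\<lambda>n. \<integral>p. \<phi> n p * h p \<partial>square_measure) \<longlonglongrightarrow> (\<integral>p. u p * h p \<partial>square_measure)"
    and "\<And>h. continuous_on UNIV h \<Longrightarrow>
      (\<lambda>n. \<integral>p. fst (grad (\<phi> n) p) * h p \<partial>square_measure) \<longlonglongrightarrow> (\<integral>p. fst (Du p) * h p \<partial>square_measure)"
    and "\<And>h. continuous_on UNIV h \<Longrightarrow>
      (\<lambda>n. \<integral>p. snd (grad (\<phi> n) p) * h p \<partial>square_measure) \<longlonglongrightarrow> (\<integral>p. snd (Du p) * h p \<partial>square_measure)"
    and "\<And>h j. continuous_on UNIV h \<Longrightarrow> j \<in> {1..4} \<Longrightarrow>
      (\<lambda>n. \<integral>p. \<phi> n p * h p \<partial>side_measure j) \<longlonglongrightarrow> (\<integral>p. T p * h p \<partial>side_measure j)"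
proof -
  obtain \<phi> where \<phi>: "\<And>n. smooth (\<phi> n)"
    and lim: "(\<lambda>n. L2_norm square_measure (\<lambda>p. \<phi> n p - u p)) \<longlonglongrightarrow> 0"
      "(\<lambda>n. L2_norm square_measure (\<lambda>p. grad (\<phi> n) p - Du p)) \<longlonglongrightarrow> 0"
      "\<And>j. j \<in> {1..4} \<Longrightarrow> (\<lambda>n. L2_norm (side_measure j) (\<lambda>p. \<phi> n p - T p)) \<longlonglongrightarrow> 0"
    using assms(3) unfolding has_trace_def by blast
  have T: "in_L2 (side_measure j) T" if "j \<in> {1..4}" for j
    using assms(3) that unfolding has_trace_def by blast
  note c = smooth_continuous[OF \<phi>] smooth_continuous_grad[OF \<phi>]
  have d: "in_L2 square_measure (\<lambda>p. grad (\<phi> n) p - Du p)" for n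
    by (intro in_L2_diff in_L2_square_continuous c assms)
  have le: "norm (fst z - fst z') \<le> norm (z - z')" "norm (snd z - snd z') \<le> norm (z - z')"
    for z z' :: "complex \<times> complex"
    using norm_fst_le[of "fst (z - z')" "snd (z - z')"] norm_snd_le[of "snd (z - z')" "fst (z - z')"]
    by (cases z; cases z'; simp)+
  have "L2_norm square_measure (\<lambda>p. fst (grad (\<phi> n) p) - fst (Du p))
      \<le> L2_norm square_measure (\<lambda>p. grad (\<phi> n) p - Du p)" for n
    using in_L2_fst[OF d] le by (intro L2_norm_mono d) auto
  then have lim_fst: "(\<lambda>n. L2_norm square_measure (\<lambda>p. fst (grad (\<phi> n) p) - fst (Du p))) \<longlonglongrightarrow> 0"
    by (intro tendsto_sandwich[OF _ _ tendsto_const lim(2)]) (auto simp: L2_norm_nonneg)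
  have "L2_norm square_measure (\<lambda>p. snd (grad (\<phi> n) p) - snd (Du p))
      \<le> L2_norm square_measure (\<lambda>p. grad (\<phi> n) p - Du p)" for n
    using in_L2_snd[OF d] le by (intro L2_norm_mono d) auto
  then have lim_snd: "(\<lambda>n. L2_norm square_measure (\<lambda>p. snd (grad (\<phi> n) p) - snd (Du p))) \<longlonglongrightarrow> 0"
    by (intro tendsto_sandwich[OF _ _ tendsto_const lim(2)]) (auto simp: L2_norm_nonneg)
  show thesis
  proof (rule that[OF \<phi>])
    fix h :: "plane \<Rightarrow> complex" and j :: nat
    assume h: "continuous_on UNIV h"
    note hs = in_L2_square_continuous[OF h]
    show "(\<lambda>n. \<integral>p. \<phi> n p * h p \<partial>square_measure) \<longlonglongrightarrow> (\<integral>p. u p * h p \<partial>square_measure)"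
      by (rule tendsto_integral_L2[OF in_L2_square_continuous[OF c(1)] assms(1) hs lim(1)])
    show "(\<lambda>n. \<integral>p. fst (grad (\<phi> n) p) * h p \<partial>square_measure) \<longlonglongrightarrow> (\<integral>p. fst (Du p) * h p \<partial>square_measure)"
      by (rule tendsto_integral_L2[OF in_L2_square_continuous[OF c(2)] in_L2_fst[OF assms(2)] hs lim_fst])
    show "(\<lambda>n. \<integral>p. snd (grad (\<phi> n) p) * h p \<partial>square_measure) \<longlonglongrightarrow> (\<integral>p. snd (Du p) * h p \<partial>square_measure)"
      by (rule tendsto_integral_L2[OF in_L2_square_continuous[OF c(3)] in_L2_snd[OF assms(2)] hs lim_snd])
    assume j: "j \<in> {1..4}"
    show "(\<lambda>n. \<integral>p. \<phi> n p * h p \<partial>side_measure j) \<longlonglongrightarrow> (\<integral>p. T p * h p \<partial>side_measure j)"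
      by (rule tendsto_integral_L2[OF in_L2_side_continuous[OF c(1)] T[OF j] in_L2_side_continuous[OF h] lim(3)[OF j]])
  qed
qed

text \<open>For smooth functions this is integration by parts, and every term passes to the limit
  along the sequence that defines the trace.\<close>

lemma Green_dx:
  assumes u: "in_L2 square_measure u" "in_L2 square_measure Du" "has_trace u Du T"
    and h: "continuous_on UNIV h" and h': "continuous_on UNIV h'"
    and D: "\<And>x y. ((\<lambda>x. h (x, y)) has_vector_derivative h' (x, y)) (at x)"
  shows "(\<integral>p. fst (Du p) * h p \<partial>square_measure)
    = (\<integral>p. T p * h p \<partial>side_measure 2) - (\<integral>p. T p * h p \<partial>side_measure 4)
      - (\<integral>p. u p * h' p \<partial>square_measure)"
proof (rule has_trace_approximation[OF u])
  fix \<phi> :: "nat \<Rightarrow> plane \<Rightarrow> complex"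
  assume \<phi>: "\<And>n. smooth (\<phi> n)"
    and lim: "\<And>h. continuous_on UNIV h \<Longrightarrow>
      (\<lambda>n. \<integral>p. \<phi> n p * h p \<partial>square_measure) \<longlonglongrightarrow> (\<integral>p. u p * h p \<partial>square_measure)"
    "\<And>h. continuous_on UNIV h \<Longrightarrow>
      (\<lambda>n. \<integral>p. fst (grad (\<phi> n) p) * h p \<partial>square_measure) \<longlonglongrightarrow> (\<integral>p. fst (Du p) * h p \<partial>square_measure)"
    "\<And>h j. continuous_on UNIV h \<Longrightarrow> j \<in> {1..4} \<Longrightarrow>
      (\<lambda>n. \<integral>p. \<phi> n p * h p \<partial>side_measure j) \<longlonglongrightarrow> (\<integral>p. T p * h p \<partial>side_measure j)"
  have "(\<lambda>n. \<integral>p. fst (grad (\<phi> n) p) * h p \<partial>square_measure)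
    \<longlonglongrightarrow> (\<integral>p. T p * h p \<partial>side_measure 2) - (\<integral>p. T p * h p \<partial>side_measure 4)
      - (\<integral>p. u p * h' p \<partial>square_measure)"
    unfolding integral_parts_dx[OF smooth_continuous[OF \<phi>] smooth_continuous_grad(1)[OF \<phi>] h h'
        smooth_partial_derivatives(1)[OF \<phi>] D]
    by (intro tendsto_intros lim h h') auto
  then show ?thesis using lim(2)[OF h] LIMSEQ_unique by blast
qed

lemma Green_dy:
  assumes u: "in_L2 square_measure u" "in_L2 square_measure Du" "has_trace u Du T"
    and h: "continuous_on UNIV h" and h': "continuous_on UNIV h'"
    and D: "\<And>x y. ((\<lambda>y. h (x, y)) has_vector_derivative h' (x, y)) (at y)"
  shows "(\<integral>p. snd (Du p) * h p \<partial>square_measure)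
    = (\<integral>p. T p * h p \<partial>side_measure 3) - (\<integral>p. T p * h p \<partial>side_measure 1)
      - (\<integral>p. u p * h' p \<partial>square_measure)"
proof (rule has_trace_approximation[OF u])
  fix \<phi> :: "nat \<Rightarrow> plane \<Rightarrow> complex"
  assume \<phi>: "\<And>n. smooth (\<phi> n)"
    and lim: "\<And>h. continuous_on UNIV h \<Longrightarrow>
      (\<lambda>n. \<integral>p. \<phi> n p * h p \<partial>square_measure) \<longlonglongrightarrow> (\<integral>p. u p * h p \<partial>square_measure)"
    "\<And>h. continuous_on UNIV h \<Longrightarrow>
      (\<lambda>n. \<integral>p. snd (grad (\<phi> n) p) * h p \<partial>square_measure) \<longlonglongrightarrow> (\<integral>p. snd (Du p) * h p \<partial>square_measure)"
    "\<And>h j. continuous_on UNIV h \<Longrightarrow> j \<in> {1..4} \<Longrightarrow>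
      (\<lambda>n. \<integral>p. \<phi> n p * h p \<partial>side_measure j) \<longlonglongrightarrow> (\<integral>p. T p * h p \<partial>side_measure j)"
  have "(\<lambda>n. \<integral>p. snd (grad (\<phi> n) p) * h p \<partial>square_measure)
    \<longlonglongrightarrow> (\<integral>p. T p * h p \<partial>side_measure 3) - (\<integral>p. T p * h p \<partial>side_measure 1)
      - (\<integral>p. u p * h' p \<partial>square_measure)"
    unfolding integral_parts_dy[OF smooth_continuous[OF \<phi>] smooth_continuous_grad(2)[OF \<phi>] h h'
        smooth_partial_derivatives(2)[OF \<phi>] D]
    by (intro tendsto_intros lim h h') auto
  then show ?thesis using lim(2)[OF h] LIMSEQ_unique by blast
qed

text \<open>The support lies in the open square and misses the sides. This removes the boundary
  terms when the classical gradient is shown to be a weak one.\<close>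

lemma test_function_side:
  assumes "test_function \<phi>"
  shows "(\<integral>p. f p * \<phi> p \<partial>side_measure j) = 0"
proof -
  have c: "continuous_on UNIV \<phi>" using assms by (simp add: test_function_def smooth_continuous)
  have "AE p in side_measure j. \<phi> p = 0"
  proof (rule AE_side_measure)
    fix s :: real
    have "side_param j s \<notin> unit_square" by (auto simp: side_param_def unit_square_def)
    then show "\<phi> (side_param j s) = 0"
      using assms closure_subset[of "{p. \<phi> p \<noteq> 0}"] by (auto simp: test_function_def)
    show "{p. \<phi> p = 0} \<in> sets borel"
      using borel_measurable_continuous_onI[OF c] by measurable
  qed
  then have "AE p in side_measure j. f p * \<phi> p = 0" by eventually_elim simp
  then show ?thesis by (rule integral_eq_zero_AE)
qed

lemma smooth_H1:
  assumes v: "smooth v"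
  shows "H1 v (grad v)"
  unfolding H1_def
proof (intro conjI allI impI)
  fix \<phi> :: "plane \<Rightarrow> complex"
  assume t: "test_function \<phi>"
  then have \<phi>: "smooth \<phi>" by (simp add: test_function_def)
  note c = smooth_continuous[OF v] smooth_continuous_grad(1,2)[OF v]
    smooth_continuous[OF \<phi>] smooth_continuous_grad(1,2)[OF \<phi>]
  show "(\<integral>p. v p * fst (grad \<phi> p) \<partial>square_measure) = - (\<integral>p. fst (grad v p) * \<phi> p \<partial>square_measure)"
    using integral_parts_dx[OF c(1,2,4,5) smooth_partial_derivatives(1)[OF v] smooth_partial_derivatives(1)[OF \<phi>]]
    by (simp add: test_function_side[OF t])
  show "(\<integral>p. v p * snd (grad \<phi> p) \<partial>square_measure) = - (\<integral>p. snd (grad v p) * \<phi> p \<partial>square_measure)"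
    using integral_parts_dy[OF c(1,3,4,6) smooth_partial_derivatives(2)[OF v] smooth_partial_derivatives(2)[OF \<phi>]]
    by (simp add: test_function_side[OF t])
qed (intro in_L2_square_continuous smooth_continuous smooth_continuous_grad v)+

text \<open>The constant sequence approximates at distance 0. Together with \<open>smooth_H1\<close>
  this admits smooth functions as tests in the weak formulation.\<close>

lemma smooth_has_trace:
  assumes v: "smooth v"
  shows "has_trace v (grad v) v"
  unfolding has_trace_def
proof (intro conjI ballI exI[of _ "\<lambda>_. v"])
  show "in_L2 (side_measure j) v" for j
    by (intro in_L2_side_continuous smooth_continuous v)
qed (use v in \<open>simp_all add: L2_norm_def\<close>)

section \<open>The modes\<close>

text \<open>Eigenfunctions of \<open>- d\<^sup>2/dy\<^sup>2\<close> on \<open>(0,1)\<close> with a Dirichlet condition at \<open>0\<close> (at \<open>1\<close>) if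
  \<open>a\<close> (if \<open>b\<close>) holds, and a Neumann condition otherwise.\<close>

definition freq :: "bool \<Rightarrow> bool \<Rightarrow> nat \<Rightarrow> real" where
  "freq a b n = (real n + (if a \<and> b then 1 else if a \<or> b then 1/2 else 0)) * pi"

definition phase :: "bool \<Rightarrow> real" where
  "phase a = (if a then 0 else pi / 2)"

text \<open>Normalisation in L2 of the unit interval: the squared sine has mean 1/2, except that the
  frequency-zero mode of the pure Neumann case is the constant 1.\<close>

definition amplitude :: "bool \<Rightarrow> bool \<Rightarrow> nat \<Rightarrow> real" where
  "amplitude a b n = (if freq a b n = 0 then 1 else sqrt 2)"

definition eigenmode :: "bool \<Rightarrow> bool \<Rightarrow> nat \<Rightarrow> real \<Rightarrow> real" where
  "eigenmode a b n y = amplitude a b n * sin (freq a b n * y + phase a)"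

definition eigenmode' :: "bool \<Rightarrow> bool \<Rightarrow> nat \<Rightarrow> real \<Rightarrow> real" where
  "eigenmode' a b n y = amplitude a b n * freq a b n * cos (freq a b n * y + phase a)"

lemma amplitude_nonzero: "amplitude a b n \<noteq> 0"
  by (simp add: amplitude_def)

lemma freq_nonneg: "freq a b n \<ge> 0"
  by (simp add: freq_def)

text \<open>The sine of pi/6 is 1/2 and is at most pi/6.\<close>

lemma pi_ge_three: "pi \<ge> 3"
  using sin_x_le_x[of "pi / 6"] sin_30 by simp

text \<open>The least positive frequency is pi/2, reached in the mixed case. A rational lower bound
  is enough for the gap used in \<open>mode_estimate\<close>.\<close>

lemma freq_zero_or_ge: "freq a b n = 0 \<or> freq a b n \<ge> 3/2"
proof -
  have "freq a b n = 0 \<or> real n + (if a \<and> b then 1 else if a \<or> b then 1/2 else 0) \<ge> 1/2"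
    by (cases n) (auto simp: freq_def)
  moreover have "freq a b n \<ge> 1/2 * 3" if "real n + (if a \<and> b then 1 else if a \<or> b then 1/2 else 0) \<ge> 1/2"
    unfolding freq_def using that pi_ge_three by (intro mult_mono) auto
  ultimately show ?thesis by auto
qed

lemma freq_inject: "freq a b m = freq a b n \<longleftrightarrow> m = n"
  by (auto simp: freq_def)

lemma DERIV_eigenmode [derivative_intros]:
  "(eigenmode a b n has_real_derivative eigenmode' a b n y) (at y)"
  unfolding eigenmode_def[abs_def] eigenmode'_def by (auto intro!: derivative_eq_intros)

lemma DERIV_eigenmode' [derivative_intros]:
  "(eigenmode' a b n has_real_derivative - ((freq a b n)\<^sup>2 * eigenmode a b n y)) (at y)"
  unfolding eigenmode_def eigenmode'_def[abs_def]
  by (auto intro!: derivative_eq_intros simp: power2_eq_square)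

lemma continuous_eigenmode [continuous_intros]:
  fixes f :: "'a::t2_space \<Rightarrow> real"
  shows "continuous_on A f \<Longrightarrow> continuous_on A (\<lambda>x. eigenmode a b n (f x))"
  unfolding eigenmode_def by (intro continuous_intros)

lemma continuous_eigenmode' [continuous_intros]:
  fixes f :: "'a::t2_space \<Rightarrow> real"
  shows "continuous_on A f \<Longrightarrow> continuous_on A (\<lambda>x. eigenmode' a b n (f x))"
  unfolding eigenmode'_def by (intro continuous_intros)

lemma eigenmode_boundary:
  "a \<Longrightarrow> eigenmode a b n 0 = 0" "\<not> a \<Longrightarrow> eigenmode' a b n 0 = 0"
  "b \<Longrightarrow> eigenmode a b n 1 = 0" "\<not> b \<Longrightarrow> eigenmode' a b n 1 = 0"
proof -
  have s: "sin (real n * pi) = 0" by simp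
  show "a \<Longrightarrow> eigenmode a b n 0 = 0" "\<not> a \<Longrightarrow> eigenmode' a b n 0 = 0"
    by (simp_all add: eigenmode_def eigenmode'_def phase_def)
  show "b \<Longrightarrow> eigenmode a b n 1 = 0" "\<not> b \<Longrightarrow> eigenmode' a b n 1 = 0"
    using s by (auto simp: eigenmode_def eigenmode'_def phase_def freq_def distrib_right sin_add cos_add)
qed

text \<open>Explicit antiderivatives whose boundary values vanish or are known, since at each end
  either the mode or its derivative is 0.\<close>

lemma eigenmode_orthonormal:
  "(\<integral>y. eigenmode a b m y * eigenmode a b n y \<partial>unit_measure) = (if m = n then 1 else 0)"
proof (cases "m = n")
  case False
  let ?e = "eigenmode a b" and ?e' = "eigenmode' a b"
  \<comment> \<open>The Wronskian of two modes: its derivative is the difference of the squared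
    frequencies times the product of the modes.\<close>
  define F where "F = (\<lambda>y. ?e' m y * ?e n y - ?e m y * ?e' n y)"
  define c where "c = (freq a b n)\<^sup>2 - (freq a b m)\<^sup>2"
  have "c \<noteq> 0"
    using False freq_inject[of a b m n] power2_eq_iff_nonneg[OF freq_nonneg freq_nonneg, of a b n a b m]
    by (auto simp: c_def)
  have "(\<integral>y. c * (?e m y * ?e n y) \<partial>unit_measure) = F 1 - F 0"
  proof (rule unit_measure_FTC)
    show "(F has_vector_derivative c * (?e m y * ?e n y)) (at y)" for y
      unfolding has_real_derivative_iff_has_vector_derivative[symmetric] F_def
      by (auto intro!: derivative_eq_intros simp: c_def algebra_simps)
  qed (intro continuous_intros)
  moreover have "F 0 = 0" "F 1 = 0"
    by (cases a; cases b; simp add: F_def eigenmode_boundary)+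
  ultimately show ?thesis using \<open>c \<noteq> 0\<close> False by simp
next
  case True
  let ?l = "freq a b n" and ?t = "phase a"
  show ?thesis
  proof (cases "?l = 0")
    case l: True
    then have "\<not> a" by (auto simp: freq_def split: if_splits)
    then have "eigenmode a b n y = 1" for y
      unfolding eigenmode_def amplitude_def l phase_def by simp
    then show ?thesis using True by (simp add: measure_unit_measure)
  next
    case l: False
    \<comment> \<open>The product of the mode with its derivative vanishes at both ends, so
      \<open>F\<close> increases by exactly 1.\<close>
    define F where "F = (\<lambda>y. y - 1 / (2 * ?l\<^sup>2) * (eigenmode a b n y * eigenmode' a b n y))"
    have "(\<integral>y. eigenmode a b n y * eigenmode a b n y \<partial>unit_measure) = F 1 - F 0"
    proof (rule unit_measure_FTC)
      fix y :: real
      have "1 - 1 / (2 * ?l\<^sup>2) * ((eigenmode' a b n y)\<^sup>2 - ?l\<^sup>2 * (eigenmode a b n y)\<^sup>2)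
          = 1 - (cos (?l * y + ?t))\<^sup>2 + (sin (?l * y + ?t))\<^sup>2"
        using l by (simp add: eigenmode_def eigenmode'_def amplitude_def power_mult_distrib field_simps)
      also have "\<dots> = 2 * (sin (?l * y + ?t))\<^sup>2"
        using sin_cos_squared_add[of "?l * y + ?t"] by linarith
      also have "\<dots> = (eigenmode a b n y)\<^sup>2"
        using l by (simp add: eigenmode_def amplitude_def power_mult_distrib)
      finally have eq: "1 - 1 / (2 * ?l\<^sup>2) * ((eigenmode' a b n y)\<^sup>2 - ?l\<^sup>2 * (eigenmode a b n y)\<^sup>2)
          = eigenmode a b n y * eigenmode a b n y" by (simp add: power2_eq_square)
      have "(F has_real_derivative 1 - 1 / (2 * ?l\<^sup>2) * ((eigenmode' a b n y)\<^sup>2 - ?l\<^sup>2 * (eigenmode a b n y)\<^sup>2)) (at y)"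
        unfolding F_def
        by (intro DERIV_diff DERIV_ident DERIV_cmult DERIV_cong[OF DERIV_mult'[OF DERIV_eigenmode DERIV_eigenmode']])
          (simp add: power2_eq_square)
      then show "(F has_vector_derivative eigenmode a b n y * eigenmode a b n y) (at y)"
        by (simp only: eq has_real_derivative_iff_has_vector_derivative)
    qed (intro continuous_intros)
    moreover have "eigenmode a b n 0 * eigenmode' a b n 0 = 0" "eigenmode a b n 1 * eigenmode' a b n 1 = 0"
      by (cases a; cases b; simp add: eigenmode_boundary)+
    ultimately show ?thesis using True by (simp add: F_def)
  qed
qed

text \<open>The product-to-sum formula shifts the frequency by pi in both directions, and
  neighbouring frequencies differ by pi. It makes the span of the modes stable under multiplication
  by cos (pi y).\<close>

lemma cos_mult_eigenmode:
  "\<exists>c d. \<forall>y. cos (pi * y) * eigenmode a b n y = c * eigenmode a b (Suc n) y + d * eigenmode a b (n - 1) y"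
proof -
  have sin_div: "sin (freq a b m * y + phase a) = eigenmode a b m y / amplitude a b m" for m y
    by (simp add: eigenmode_def amplitude_nonzero)
  have prod: "cos (pi * y) * eigenmode a b n y = amplitude a b n / 2 *
      (sin (freq a b (Suc n) * y + phase a) + sin ((freq a b n - pi) * y + phase a))" for y
  proof -
    have "freq a b (Suc n) * y + phase a = (freq a b n * y + phase a) + pi * y"
      "(freq a b n - pi) * y + phase a = (freq a b n * y + phase a) - pi * y"
      by (simp_all add: freq_def algebra_simps)
    then show ?thesis
      by (simp only: eigenmode_def sin_add[of "freq a b n * y + phase a" "pi * y"]
          sin_diff[of "freq a b n * y + phase a" "pi * y"]) (simp add: algebra_simps)
  qed
  show ?thesis
  proof (cases n)
    case (Suc m)
    then have eq: "freq a b n - pi = freq a b (n - 1)" by (simp add: freq_def algebra_simps)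
    have "cos (pi * y) * eigenmode a b n y
        = (amplitude a b n / 2 / amplitude a b (Suc n)) * eigenmode a b (Suc n) y
        + (amplitude a b n / 2 / amplitude a b (n - 1)) * eigenmode a b (n - 1) y" for y
      unfolding prod eq sin_div by (simp add: algebra_simps)
    then show ?thesis by blast
  next
    \<comment> \<open>The lower frequency falls out of the family. It gives 0 in the pure Dirichlet
      case, mode 1 in the pure Neumann case, and plus or minus mode 0 in the mixed cases; the last
      fits the statement because \<open>n - 1\<close> is 0 for n = 0.\<close>
    case 0
    have "\<exists>e. \<forall>y. amplitude a b 0 / 2 * sin ((freq a b 0 - pi) * y + phase a)
        = e * sin (freq a b 1 * y + phase a) + (if a \<or> b then (if a \<and> b then 0 else if a then - 1/2 else 1/2) else 0) * eigenmode a b 0 y"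
    proof (cases "a \<or> b")
      case True
      have "sin (pi / 2 - pi * y / 2) = cos (pi * y / 2)" for y
        by (simp add: cos_sin_eq)
      then show ?thesis using True
        by (intro exI[of _ 0]) (cases a; cases b; simp add: freq_def phase_def eigenmode_def amplitude_def sin_add)
    next
      case False
      then show ?thesis
        by (intro exI[of _ "1/2"]) (simp add: freq_def phase_def amplitude_def sin_add, simp add: cos_sin_eq)
    qed
    then obtain e d where "\<And>y. amplitude a b 0 / 2 * sin ((freq a b 0 - pi) * y + phase a)
        = e * sin (freq a b 1 * y + phase a) + d * eigenmode a b 0 y" by blast
    then have "cos (pi * y) * eigenmode a b n y
        = ((amplitude a b 0 / 2 + e) / amplitude a b (Suc n)) * eigenmode a b (Suc n) y
        + d * eigenmode a b (n - 1) y" for y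
      unfolding prod by (simp add: 0 sin_div distrib_left distrib_right add_divide_distrib)
    then show ?thesis by blast
  qed
qed

text \<open>The lowest mode has no interior zero, which allows it to be divided out in the density
  proof.\<close>

lemma eigenmode_0_pos:
  assumes "0 < y" "y < 1"
  shows "eigenmode a b 0 y > 0"
proof -
  have "pi * y < pi" using assms by simp
  then have "sin (pi * y) > 0" "sin (pi * y / 2) > 0" "cos (pi * y / 2) > 0"
    using assms by (auto intro!: sin_gt_zero cos_gt_zero)
  then show ?thesis
    by (cases a; cases b) (auto simp: eigenmode_def freq_def phase_def amplitude_def sin_add mult.commute)
qed

text \<open>Powers of 1 - x rather than of x: the weight is 1 on side 4, where the data live, and
  for j > 0 it satisfies a Dirichlet condition on side 2.\<close>

definition mode_function :: "bool \<Rightarrow> bool \<Rightarrow> nat \<Rightarrow> nat \<Rightarrow> plane \<Rightarrow> complex" where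
  "mode_function a b j n p = complex_of_real ((1 - fst p) ^ j * eigenmode a b n (snd p))"

text \<open>The family c (1 - x)^j sin (l y + t) is closed under both partial derivatives, the
  cosine being a sine with phase shifted by pi/2. Generalising over c, j and t makes the induction
  on the order immediate.\<close>

lemma smooth_mode_function: "smooth (mode_function a b j n)"
proof -
  have D: "((\<lambda>p::plane. complex_of_real (c * (1 - fst p) ^ j * sin (l * snd p + t))) has_derivative
      (\<lambda>h. complex_of_real (c * (- real j * (1 - fst p) ^ (j - 1)) * sin (l * snd p + t)) * complex_of_real (fst h)
        + complex_of_real (c * (1 - fst p) ^ j * (l * cos (l * snd p + t))) * complex_of_real (snd h))) (at p)"
    for c l t :: real and j :: nat and p :: plane
  proof -
    have "((\<lambda>p::plane. c * (1 - fst p) ^ j * sin (l * snd p + t)) has_derivative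
      (\<lambda>h. (c * (- real j * (1 - fst p) ^ (j - 1)) * sin (l * snd p + t)) * fst h
        + (c * (1 - fst p) ^ j * (l * cos (l * snd p + t))) * snd h)) (at p)"
      by (auto intro!: derivative_eq_intros simp: algebra_simps)
    from has_derivative_of_real[OF this, where 'a = complex] show ?thesis by simp
  qed
  have G: "grad (\<lambda>p::plane. complex_of_real (c * (1 - fst p) ^ j * sin (l * snd p + t))) p
      = (complex_of_real (c * (- real j) * (1 - fst p) ^ (j - 1) * sin (l * snd p + t)),
         complex_of_real (c * l * (1 - fst p) ^ j * sin (l * snd p + (t + pi / 2))))"
    for c l t :: real and j :: nat and p :: plane
    unfolding grad_def frechet_derivative_at[OF D, symmetric]
    by (simp add: sin_add cos_add algebra_simps)
  have "C_diff m (\<lambda>p::plane. complex_of_real (c * (1 - fst p) ^ j * sin (l * snd p + t)))"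
    for m c l t j
  proof (induction m arbitrary: c j t)
    case 0
    show ?case by (auto intro!: continuous_intros)
  next
    case (Suc m)
    have "(\<lambda>p::plane. complex_of_real (c * (1 - fst p) ^ j * sin (l * snd p + t))) differentiable_on UNIV"
      unfolding differentiable_on_def differentiable_def using has_derivative_at_withinI[OF D] by blast
    then show ?case
      unfolding C_diff.simps G fst_conv snd_conv by (intro conjI Suc.IH)
  qed
  from this[of _ "amplitude a b n" j "freq a b n" "phase a"] show ?thesis
    by (simp add: smooth_def mode_function_def[abs_def] eigenmode_def mult.left_commute mult.assoc)
qed

lemma continuous_mode_function [continuous_intros]: "continuous_on A (mode_function a b j n)"
  using smooth_continuous[OF smooth_mode_function] by (rule continuous_on_subset) simp

text \<open>For j = 0 the truncated index j - 1 does no harm, as its coefficient is 0.\<close>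

lemma mode_function_dx:
  "((\<lambda>x. mode_function a b j n (x, y)) has_vector_derivative
     - of_nat j * mode_function a b (j - 1) n (x, y)) (at x)"
proof -
  have "((\<lambda>x. (1 - x) ^ j * eigenmode a b n y) has_real_derivative
      - real j * ((1 - x) ^ (j - 1) * eigenmode a b n y)) (at x)"
    by (auto intro!: derivative_eq_intros)
  then show ?thesis
    unfolding has_real_derivative_iff_has_vector_derivative mode_function_def
    using bounded_linear.has_vector_derivative[OF bounded_linear_of_real[where 'a = complex]] by fastforce
qed

definition mode_function_dy :: "bool \<Rightarrow> bool \<Rightarrow> nat \<Rightarrow> nat \<Rightarrow> plane \<Rightarrow> complex" where
  "mode_function_dy a b j n p = complex_of_real ((1 - fst p) ^ j * eigenmode' a b n (snd p))"

lemma mode_function_dy: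
  "((\<lambda>y. mode_function a b j n (x, y)) has_vector_derivative mode_function_dy a b j n (x, y)) (at y)"
  "((\<lambda>y. mode_function_dy a b j n (x, y)) has_vector_derivative
     - of_real ((freq a b n)\<^sup>2) * mode_function a b j n (x, y)) (at y)"
proof -
  have "((\<lambda>y. (1 - x) ^ j * eigenmode a b n y) has_real_derivative (1 - x) ^ j * eigenmode' a b n y) (at y)"
    "((\<lambda>y. (1 - x) ^ j * eigenmode' a b n y) has_real_derivative
      - ((freq a b n)\<^sup>2) * ((1 - x) ^ j * eigenmode a b n y)) (at y)"
    by (auto intro!: derivative_eq_intros)
  then show "((\<lambda>y. mode_function a b j n (x, y)) has_vector_derivative mode_function_dy a b j n (x, y)) (at y)"
    "((\<lambda>y. mode_function_dy a b j n (x, y)) has_vector_derivative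
     - of_real ((freq a b n)\<^sup>2) * mode_function a b j n (x, y)) (at y)"
    unfolding has_real_derivative_iff_has_vector_derivative mode_function_def mode_function_dy_def
    using bounded_linear.has_vector_derivative[OF bounded_linear_of_real[where 'a = complex]] by fastforce+
qed

lemma continuous_mode_function_dy: "continuous_on UNIV (mode_function_dy a b j n)"
  unfolding mode_function_dy_def[abs_def] by (intro continuous_intros)

lemma grad_mode_function:
  "fst (grad (mode_function a b j n) p) = - of_nat j * mode_function a b (j - 1) n p"
  "snd (grad (mode_function a b j n) p) = mode_function_dy a b j n p"
  using vector_derivative_unique_at[OF smooth_partial_derivatives(1)[OF smooth_mode_function] mode_function_dx]
    vector_derivative_unique_at[OF smooth_partial_derivatives(2)[OF smooth_mode_function] mode_function_dy(1)]
  by (cases p; simp)+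

section \<open>Identification of the Fourier coefficients of a weak solution\<close>

lemma integral_scaled_factor:
  fixes f h :: "'a \<Rightarrow> complex"
  shows "(\<integral>x. f x * (c * h x) \<partial>M) = c * (\<integral>x. f x * h x \<partial>M)"
proof -
  have "f x * (c * h x) = c * (f x * h x)" for x by (rule mult.left_commute)
  then show ?thesis by (simp only: integral_mult_right_zero)
qed

lemma integral_side_scaled:
  fixes f h h' :: "plane \<Rightarrow> complex"
  assumes "in_L2 (side_measure j) f" "continuous_on UNIV h" "continuous_on UNIV h'"
    and eq: "\<And>s. h (side_param j s) = c * h' (side_param j s)"
  shows "(\<integral>p. f p * h p \<partial>side_measure j) = c * (\<integral>p. f p * h' p \<partial>side_measure j)"
proof -
  have [measurable]: "f \<in> borel_measurable borel" "h \<in> borel_measurable borel" "h' \<in> borel_measurable borel"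
    using in_L2_measurable[OF assms(1)] assms(2,3) by (simp_all add: borel_measurable_continuous_onI)
  show ?thesis by (simp add: integral_side_measure eq mult.left_commute)
qed

text \<open>On x = 1 the weight is \<open>0 ^ j\<close>, which is 1 for j = 0; only that test sees
  the trace on side 2.\<close>

lemma mode_function_side:
  assumes "in_L2 (side_measure 2) f"
  shows "(\<integral>p. f p * mode_function a b j n p \<partial>side_measure 2)
    = 0 ^ j * (\<integral>p. f p * mode_function a b 0 n p \<partial>side_measure 2)"
  by (rule integral_side_scaled[OF assms continuous_mode_function continuous_mode_function])
    (simp add: mode_function_def side_param_def)

lemma mode_function_side':
  assumes "in_L2 (side_measure 4) f"
  shows "(\<integral>p. f p * mode_function a b j n p \<partial>side_measure 4)
    = (\<integral>p. f p * mode_function a b 0 n p \<partial>side_measure 4)"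
  using integral_side_scaled[OF assms continuous_mode_function continuous_mode_function,
      of a b j n 1 a b 0 n]
  by (simp add: mode_function_def side_param_def)

text \<open>Iterating the recurrence gives \<open>\<bar>A j\<bar> \<le> C \<bar>\<mu>\<bar>\<^sup>r j! / (j + 2r)!\<close> for all \<open>r\<close>.\<close>

lemma moments_vanish:
  fixes A :: "nat \<Rightarrow> complex" and \<mu> C :: real
  assumes rec: "\<And>j. of_nat (j + 2) * of_nat (j + 1) * A j + of_real \<mu> * A (j + 2) = 0"
    and bound: "\<And>j. norm (A j) \<le> C"
  shows "A j = 0"
proof -
  have C: "C \<ge> 0" using bound[of 0] norm_ge_zero order_trans by blast
  have iter: "norm (A j) \<le> C * \<bar>\<mu>\<bar> ^ r * fact j / fact (j + 2 * r)" for r j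
  proof (induction r arbitrary: j)
    case 0
    show ?case using bound by simp
  next
    case (Suc r)
    have "of_nat ((j + 2) * (j + 1)) * A j = - (of_real \<mu> * A (j + 2))"
      using rec[of j] by (simp only: of_nat_mult eq_neg_iff_add_eq_0)
    then have "norm (of_nat ((j + 2) * (j + 1)) * A j) = \<bar>\<mu>\<bar> * norm (A (j + 2))"
      by (simp only: norm_minus_cancel norm_mult norm_of_real)
    then have "real ((j + 2) * (j + 1)) * norm (A j) = \<bar>\<mu>\<bar> * norm (A (j + 2))"
      by (simp only: norm_mult norm_of_nat)
    also have "\<dots> \<le> \<bar>\<mu>\<bar> * (C * \<bar>\<mu>\<bar> ^ r * fact (j + 2) / fact (j + 2 + 2 * r))"
      by (intro mult_left_mono Suc.IH) simp
    also have "\<dots> = real ((j + 2) * (j + 1)) * (C * \<bar>\<mu>\<bar> ^ Suc r * fact j / fact (j + 2 * Suc r))"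
      by (simp add: algebra_simps)
    finally show ?case by (rule mult_left_le_imp_le) (simp only: of_nat_0_less_iff, simp)
  qed
  \<comment> \<open>Weakening (j + 2 r)! to r! leaves terms of the exponential series, which tend to
    0.\<close>
  have "norm (A j) \<le> C * fact j * (inverse (fact r) * \<bar>\<mu>\<bar> ^ r)" for r
  proof -
    have "C * \<bar>\<mu>\<bar> ^ r * fact j / fact (j + 2 * r) \<le> C * \<bar>\<mu>\<bar> ^ r * fact j / fact r"
      using C by (intro divide_left_mono mult_nonneg_nonneg fact_mono) auto
    with iter[of j r] have "norm (A j) \<le> C * \<bar>\<mu>\<bar> ^ r * fact j / fact r" by (rule order_trans)
    then show ?thesis by (simp add: divide_inverse mult_ac)
  qed
  moreover have "(\<lambda>r. C * fact j * (inverse (fact r) * \<bar>\<mu>\<bar> ^ r)) \<longlonglongrightarrow> C * fact j * 0"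
    by (intro tendsto_intros summable_LIMSEQ_zero summable_exp)
  ultimately have "norm (A j) \<le> C * fact j * 0"
    by (intro LIMSEQ_le_const) auto
  then show ?thesis by simp
qed

text \<open>The solution is tested with \<open>(1 - x)\<^sup>j \<phi>\<^sub>n(y)\<close>.  The tests with \<open>j \<ge> 2\<close> identify the Fourier
  coefficient of \<open>u\<close> with the solution of an initial value problem at \<open>x = 0\<close>; those with
  \<open>j = 1\<close> and \<open>j = 0\<close> give its boundary condition at \<open>x = 1\<close>.\<close>

lemma mode_solution:
  fixes k :: real and a b d imp :: bool and n :: nat
  assumes u: "in_L2 square_measure u" "in_L2 square_measure Du" "has_trace u Du T"
    and zero: "a \<Longrightarrow> AE p in side_measure 1. T p = 0" "d \<Longrightarrow> AE p in side_measure 2. T p = 0"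
      "b \<Longrightarrow> AE p in side_measure 3. T p = 0"
    and g: "in_L2 (side_measure 4) g" and imp: "d \<Longrightarrow> \<not> imp"
    and weak: "\<And>j v. v = mode_function a b j n \<Longrightarrow> (d \<Longrightarrow> j > 0) \<Longrightarrow>
      (\<integral>p. fst (Du p) * fst (grad v p) \<partial>square_measure) + (\<integral>p. snd (Du p) * snd (grad v p) \<partial>square_measure)
        - of_real (k\<^sup>2) * (\<integral>p. u p * v p \<partial>square_measure)
        - \<i> * of_real k * ((\<integral>p. T p * v p \<partial>side_measure 4) + (if imp then \<integral>p. T p * v p \<partial>side_measure 2 else 0))
      = (\<integral>p. g p * v p \<partial>side_measure 4)"
  obtains w w' where "\<And>x::real. (w has_vector_derivative w' x) (at x)"
    and "\<And>x::real. (w' has_vector_derivative - (complex_of_real (k\<^sup>2 - (freq a b n)\<^sup>2) * w x)) (at x)"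
    and "w 1 = 0 \<or> w' 1 = 0 \<or> w' 1 = \<i> * complex_of_real k * w 1"
    and "(\<integral>p. g p * mode_function a b 0 n p \<partial>side_measure 4) = - w' 0 - \<i> * complex_of_real k * w 0"
    and "(\<integral>p. T p * mode_function a b 0 n p \<partial>side_measure 4) = w 0"
    and "\<And>j. (\<integral>p. u p * mode_function a b j n p \<partial>square_measure)
        = (\<integral>x. w x * of_real ((1 - x) ^ j) \<partial>unit_measure)"
proof -
  define V where "V = (\<lambda>j. mode_function a b j n)"
  define \<mu> where "\<mu> = k\<^sup>2 - (freq a b n)\<^sup>2"
  define G where "G = (\<integral>p. g p * V 0 p \<partial>side_measure 4)"
  define T4 where "T4 = (\<integral>p. T p * V 0 p \<partial>side_measure 4)"
  define T2 where "T2 = (\<integral>p. T p * V 0 p \<partial>side_measure 2)"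
  define U where "U = (\<lambda>j. \<integral>p. u p * V j p \<partial>square_measure)"
  have T: "in_L2 (side_measure j) T" if "j \<in> {1..4}" for j
    using u(3) that unfolding has_trace_def by blast
  have cV: "continuous_on UNIV (V j)" for j unfolding V_def by (rule continuous_mode_function)
  have side2: "(\<integral>p. T p * V j p \<partial>side_measure 2) = 0 ^ j * T2" for j
    unfolding V_def T2_def by (rule mode_function_side) (simp add: T)
  have side4: "(\<integral>p. T p * V j p \<partial>side_measure 4) = T4" "(\<integral>p. g p * V j p \<partial>side_measure 4) = G" for j
    unfolding V_def T4_def G_def by (intro mode_function_side' g T; simp)+
  \<comment> \<open>Green's formula moves the second x-derivative onto the test. The side 2 term
    survives only for j = 1: for larger j the power of 0 vanishes, and for j = 0 the factor j
    does.\<close>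
  have du1: "(\<integral>p. fst (Du p) * fst (grad (V j) p) \<partial>square_measure)
      = - of_nat j * 0 ^ (j - 1) * T2 + of_nat j * T4 - of_nat j * of_nat (j - 1) * U (j - 2)" for j
  proof -
    have D: "((\<lambda>x. - of_nat j * V (j - 1) (x, y)) has_vector_derivative
        - of_nat j * (- of_nat (j - 1) * V (j - 2) (x, y))) (at x)" for x y
      using has_vector_derivative_mult_right[OF mode_function_dx[of a b "j - 1" n y x], of "- of_nat j"]
      by (simp add: V_def numeral_2_eq_2)
    have "(\<integral>p. fst (Du p) * (- of_nat j * V (j - 1) p) \<partial>square_measure)
      = (\<integral>p. T p * (- of_nat j * V (j - 1) p) \<partial>side_measure 2)
        - (\<integral>p. T p * (- of_nat j * V (j - 1) p) \<partial>side_measure 4)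
        - (\<integral>p. u p * (- of_nat j * (- of_nat (j - 1) * V (j - 2) p)) \<partial>square_measure)"
      by (intro Green_dx[OF u _ _ D] continuous_intros cV)
    moreover have "fst (grad (V j) p) = - of_nat j * V (j - 1) p" for p
      by (simp add: V_def grad_mode_function)
    ultimately show ?thesis
      by (simp only: integral_scaled_factor side2 side4 U_def) (simp add: algebra_simps)
  qed
  \<comment> \<open>On sides 1 and 3 either the trace vanishes (Dirichlet) or the y-derivative of
    the mode does (Neumann), so only the eigenvalue remains.\<close>
  have du2: "(\<integral>p. snd (Du p) * snd (grad (V j) p) \<partial>square_measure) = of_real ((freq a b n)\<^sup>2) * U j" for j
  proof -
    let ?W = "mode_function_dy a b j n"
    have "(\<integral>p. T p * ?W p \<partial>side_measure 3) = 0"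
    proof (rule integral_eq_zero_AE, cases b)
      case True
      from zero(3)[OF this] show "AE p in side_measure 3. T p * ?W p = 0" by eventually_elim simp
    next
      case False
      have "AE p in side_measure 3. ?W p = 0"
      proof (rule AE_side_measure)
        show "?W (side_param 3 s) = 0" for s
          using False by (simp add: mode_function_dy_def side_param_def eigenmode_boundary)
      qed (use borel_measurable_continuous_onI[OF continuous_mode_function_dy] in measurable)
      then show "AE p in side_measure 3. T p * ?W p = 0" by eventually_elim simp
    qed
    moreover have "(\<integral>p. T p * ?W p \<partial>side_measure 1) = 0"
    proof (rule integral_eq_zero_AE, cases a)
      case True
      from zero(1)[OF this] show "AE p in side_measure 1. T p * ?W p = 0" by eventually_elim simp
    next
      case False
      have "AE p in side_measure 1. ?W p = 0"
      proof (rule AE_side_measure)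
        show "?W (side_param 1 s) = 0" for s
          using False by (simp add: mode_function_dy_def side_param_def eigenmode_boundary)
      qed (use borel_measurable_continuous_onI[OF continuous_mode_function_dy] in measurable)
      then show "AE p in side_measure 1. T p * ?W p = 0" by eventually_elim simp
    qed
    moreover have "(\<integral>p. snd (Du p) * ?W p \<partial>square_measure)
      = (\<integral>p. T p * ?W p \<partial>side_measure 3) - (\<integral>p. T p * ?W p \<partial>side_measure 1)
        - (\<integral>p. u p * (- of_real ((freq a b n)\<^sup>2) * V j p) \<partial>square_measure)"
      unfolding V_def
      by (intro Green_dy[OF u _ _ mode_function_dy(2)] continuous_intros continuous_mode_function_dy)
    ultimately show ?thesis
      by (simp only: V_def U_def grad_mode_function integral_scaled_factor)
        (simp only: diff_self mult_minus_left minus_minus diff_0)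
  qed
  have eq_u: "of_nat j * of_nat (j - 1) * U (j - 2) + of_real \<mu> * U j
      = of_nat j * T4 - of_nat j * 0 ^ (j - 1) * T2 - \<i> * of_real k * T4
        - (if imp then \<i> * of_real k * 0 ^ j * T2 else 0) - G"
    if "d \<Longrightarrow> j > 0" for j
  proof -
    have "V j = mode_function a b j n" by (simp add: V_def)
    from weak[OF this that]
    have "(- of_nat j * 0 ^ (j - 1) * T2 + of_nat j * T4 - of_nat j * of_nat (j - 1) * U (j - 2))
        + of_real ((freq a b n)\<^sup>2) * U j - of_real (k\<^sup>2) * U j
        - \<i> * of_real k * (T4 + (if imp then 0 ^ j * T2 else 0)) = G"
      by (simp only: du1 du2 side2 side4 U_def)
    then show ?thesis by (cases imp) (simp_all add: \<mu>_def algebra_simps)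
  qed
  \<comment> \<open>The initial value is the coefficient of the trace on side 4, and the slope is
    what the impedance condition prescribes there, the outward derivative at x = 0 being
    -w'.\<close>
  obtain w w' where w: "\<And>x::real. (w has_vector_derivative w' x) (at x)"
    and w': "\<And>x::real. (w' has_vector_derivative - (complex_of_real \<mu> * w x)) (at x)"
    and w0: "w 0 = T4" and w'0: "w' 0 = - G - \<i> * of_real k * T4"
    using oscillator_initial_value_problem[where \<mu> = \<mu> and a = T4 and b = "- G - \<i> * of_real k * T4"] by blast
  define X where "X = (\<lambda>j x. complex_of_real ((1 - x) ^ j))"
  define W where "W = (\<lambda>j. \<integral>x. w x * X j x \<partial>unit_measure)"
  have cw: "continuous_on UNIV w" "continuous_on UNIV w'"
    using w w' by (auto intro!: continuous_on_vector_derivative intro: has_vector_derivative_at_within)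
  have cX: "continuous_on UNIV (X j)" for j unfolding X_def by (intro continuous_intros)
  have DX: "(X j has_vector_derivative - of_nat j * X (j - 1) x) (at x)" for j x
  proof -
    have "((\<lambda>x. (1 - x) ^ j) has_real_derivative - real j * (1 - x) ^ (j - 1)) (at x)"
      by (auto intro!: derivative_eq_intros)
    then show ?thesis
      unfolding has_real_derivative_iff_has_vector_derivative X_def
      using bounded_linear.has_vector_derivative[OF bounded_linear_of_real[where 'a = complex]] by fastforce
  qed
  \<comment> \<open>The classical solution obeys the same moment identity, by integrating the
    derivative of w times the derivative of the weight, minus w' times the weight.\<close>
  have eq_w: "of_nat j * of_nat (j - 1) * W (j - 2) + of_real \<mu> * W j
      = - (of_nat j * 0 ^ (j - 1) * w 1) - 0 ^ j * w' 1 + of_nat j * w 0 + w' 0" for j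
  proof -
    define F where "F = (\<lambda>x. w x * (- of_nat j * X (j - 1) x) - w' x * X j x)"
    have "(\<integral>x. of_nat j * of_nat (j - 1) * (w x * X (j - 2) x) + of_real \<mu> * (w x * X j x) \<partial>unit_measure)
        = F 1 - F 0"
    proof (rule unit_measure_FTC)
      fix x :: real
      have "(F has_vector_derivative
          w x * (- of_nat j * (- of_nat (j - 1) * X (j - 1 - 1) x)) + w' x * (- of_nat j * X (j - 1) x)
          - (w' x * (- of_nat j * X (j - 1) x) + - (of_real \<mu> * w x) * X j x)) (at x)"
        unfolding F_def
        by (intro has_vector_derivative_diff has_vector_derivative_mult has_vector_derivative_mult_right w w' DX)
      then show "(F has_vector_derivative
          of_nat j * of_nat (j - 1) * (w x * X (j - 2) x) + of_real \<mu> * (w x * X j x)) (at x)"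
        by (rule has_vector_derivative_eq_rhs) (simp add: algebra_simps numeral_2_eq_2)
    qed (intro continuous_intros cw cX)
    moreover have "F 1 = - (of_nat j * 0 ^ (j - 1) * w 1) - 0 ^ j * w' 1" "F 0 = - of_nat j * w 0 - w' 0"
      by (simp_all add: F_def X_def)
    moreover have "integrable unit_measure (\<lambda>x. w x * X i x)" for i
      by (intro integrable_unit_continuous continuous_intros cw cX)
    ultimately show ?thesis by (simp add: W_def)
  qed
  define A where "A = (\<lambda>j. U j - W j)"
  \<comment> \<open>The terms at x = 0 cancel by the choice of initial values. The remaining terms
    live at x = 1 and vanish for j \<ge> 2.\<close>
  have eq_A: "of_nat j * of_nat (j - 1) * A (j - 2) + of_real \<mu> * A j
      = of_nat j * 0 ^ (j - 1) * (w 1 - T2)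
        + 0 ^ j * (w' 1 - (if imp then \<i> * of_real k * T2 else 0))" if "d \<Longrightarrow> j > 0" for j
  proof -
    have "of_nat j * of_nat (j - 1) * A (j - 2) + of_real \<mu> * A j
        = (of_nat j * of_nat (j - 1) * U (j - 2) + of_real \<mu> * U j)
          - (of_nat j * of_nat (j - 1) * W (j - 2) + of_real \<mu> * W j)"
      by (simp add: A_def algebra_simps)
    also have "\<dots> = (of_nat j * T4 - of_nat j * 0 ^ (j - 1) * T2 - \<i> * of_real k * T4
          - (if imp then \<i> * of_real k * 0 ^ j * T2 else 0) - G)
        - (- (of_nat j * 0 ^ (j - 1) * w 1) - 0 ^ j * w' 1 + of_nat j * w 0 + w' 0)"
      using eq_u[OF that] eq_w[of j] by (rule arg_cong2[where f = minus])
    finally show ?thesis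
      unfolding w0 w'0 by (cases imp) (simp_all add: algebra_simps)
  qed
  \<comment> \<open>The recurrence uses only j + 2, hence only tests vanishing on side 2. The
    weights are at most 1 on the square, so the moments are bounded uniformly in j.\<close>
  have A: "A j = 0" for j
  proof (rule moments_vanish)
    show "of_nat (j + 2) * of_nat (j + 1) * A j + of_real \<mu> * A (j + 2) = 0" for j
      using eq_A[of "j + 2"] by simp
    show "norm (A j) \<le> L2_norm square_measure u * L2_norm square_measure (V 0)
        + (\<integral>x. norm (w x) \<partial>unit_measure)" for j
    proof -
      have "L2_norm square_measure (V j) \<le> L2_norm square_measure (V 0)"
      proof (rule L2_norm_mono)
        show "norm (V j p) \<le> norm (V 0 p)" if "p \<in> space square_measure" for p
        proof -
          have "\<bar>1 - fst p\<bar> ^ j \<le> 1" using that by (intro power_le_one) (auto simp: unit_square_def)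
          then show ?thesis
            unfolding V_def mode_function_def norm_of_real abs_mult power_abs
            by (intro mult_right_mono) auto
        qed
      qed (intro in_L2_square_continuous cV)+
      then have "norm (U j) \<le> L2_norm square_measure u * L2_norm square_measure (V 0)"
        unfolding U_def using Cauchy_Schwarz_L2[OF u(1) in_L2_square_continuous[OF cV[of j]]]
          mult_left_mono[OF _ L2_norm_nonneg[of square_measure u]] by force
      moreover have "norm (W j) \<le> (\<integral>x. norm (w x) \<partial>unit_measure)"
        unfolding W_def
      proof (rule order_trans[OF integral_norm_bound integral_mono])
        show "integrable unit_measure (\<lambda>x. norm (w x * X j x))" "integrable unit_measure (\<lambda>x. norm (w x))"
          by (intro integrable_unit_continuous continuous_intros cw cX)+
        show "norm (w x * X j x) \<le> norm (w x)" if "x \<in> space unit_measure" for x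
        proof -
          have "\<bar>1 - x\<bar> ^ j \<le> 1" using that by (intro power_le_one) auto
          then show ?thesis
            unfolding X_def norm_mult norm_of_real power_abs by (intro mult_right_le_one_le) auto
        qed
      qed
      ultimately show ?thesis unfolding A_def using norm_triangle_ineq4[of "U j" "W j"] by linarith
    qed
  qed
  \<comment> \<open>With all moments zero, the test with j = 1 reads off the value at x = 1.\<close>
  have T2: "T2 = w 1" using eq_A[of 1] A by simp
  have bc: "w 1 = 0 \<or> w' 1 = 0 \<or> w' 1 = \<i> * of_real k * w 1"
  proof (cases d)
    case True
    have "AE p in side_measure 2. T p * V 0 p = 0"
      using zero(2)[OF True] by eventually_elim simp
    then have "T2 = 0" unfolding T2_def by (rule integral_eq_zero_AE)
    then show ?thesis using T2 by simp
  next
    case False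
    \<comment> \<open>The test with j = 0 is admissible here and yields the Neumann or impedance
      condition for w at 1.\<close>
    then show ?thesis using eq_A[of 0] A T2 by (cases imp) auto
  qed
  show thesis
  proof (rule that[OF w w'[unfolded \<mu>_def] bc])
    show "(\<integral>p. g p * mode_function a b 0 n p \<partial>side_measure 4) = - w' 0 - \<i> * of_real k * w 0"
      using w0 w'0 by (simp add: G_def V_def)
    show "(\<integral>p. T p * mode_function a b 0 n p \<partial>side_measure 4) = w 0"
      using w0 by (simp add: T4_def V_def)
    show "(\<integral>p. u p * mode_function a b j n p \<partial>square_measure)
        = (\<integral>x. w x * of_real ((1 - x) ^ j) \<partial>unit_measure)" for j
      using A[of j] by (simp only: A_def U_def W_def V_def X_def right_minus_eq)
  qed
qed

section \<open>Completeness of the modes\<close>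

text \<open>Closure in the L2 seminorm, stated for representatives because functions equal almost
  everywhere are not identified.\<close>

definition L2_closure :: "'a measure \<Rightarrow> ('a \<Rightarrow> complex) set \<Rightarrow> ('a \<Rightarrow> complex) \<Rightarrow> bool" where
  "L2_closure M A f \<longleftrightarrow> in_L2 M f \<and> (\<forall>e>0. \<exists>a\<in>A. L2_norm M (\<lambda>x. f x - a x) < e)"

lemma L2_norm_cmult: "L2_norm M (\<lambda>x. c * f x) = norm c * L2_norm M f" for f :: "'a \<Rightarrow> complex"
  by (simp add: L2_norm_def norm_mult power_mult_distrib real_sqrt_mult)

text \<open>Dominated convergence for |f - h_i|^2, with dominating function 4 W^2.\<close>

lemma tendsto_L2_dominated:
  fixes f :: "'a \<Rightarrow> complex" and h :: "nat \<Rightarrow> 'a \<Rightarrow> complex" and W :: "'a \<Rightarrow> real"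
  assumes h: "\<And>i. h i \<in> borel_measurable M" and f: "f \<in> borel_measurable M" and W: "in_L2 M W"
    and lim: "AE x in M. (\<lambda>i. h i x) \<longlonglongrightarrow> f x"
    and bound: "\<And>i. AE x in M. norm (h i x) \<le> W x" "AE x in M. norm (f x) \<le> W x"
  shows "(\<lambda>i. L2_norm M (\<lambda>x. f x - h i x)) \<longlonglongrightarrow> 0"
proof -
  have "(\<lambda>i. \<integral>x. (norm (f x - h i x))\<^sup>2 \<partial>M) \<longlonglongrightarrow> (\<integral>x. 0 \<partial>M)"
  proof (rule integral_dominated_convergence[where w = "\<lambda>x. 4 * (norm (W x))\<^sup>2"])
    show "integrable M (\<lambda>x. 4 * (norm (W x))\<^sup>2)"
      using in_L2_integrable_square[OF W] by simp
    show "AE x in M. (\<lambda>i. (norm (f x - h i x))\<^sup>2) \<longlonglongrightarrow> 0"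
      using lim
    proof eventually_elim
      case (elim x)
      have "(\<lambda>i. (norm (f x - h i x))\<^sup>2) \<longlonglongrightarrow> (norm (f x - f x))\<^sup>2"
        by (intro tendsto_intros elim)
      then show ?case by simp
    qed
    show "AE x in M. norm ((norm (f x - h i x))\<^sup>2) \<le> 4 * (norm (W x))\<^sup>2" for i
      using bound(1)[of i] bound(2)
    proof eventually_elim
      case (elim x)
      have "norm (f x - h i x) \<le> 2 * W x" using elim norm_triangle_ineq4[of "f x" "h i x"] by linarith
      then have "(norm (f x - h i x))\<^sup>2 \<le> (2 * W x)\<^sup>2" by (intro power_mono) auto
      then show ?case by (simp add: power_mult_distrib)
    qed
  qed (use h f in measurable)
  then have "(\<lambda>i. sqrt (\<integral>x. (norm (f x - h i x))\<^sup>2 \<partial>M)) \<longlonglongrightarrow> sqrt 0"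
    by (intro tendsto_intros) simp
  then show ?thesis by (simp add: L2_norm_def)
qed

text \<open>The measure-theoretic part of completeness uses only that the approximating functions
  form a linear space inside L2.\<close>

locale L2_subspace =
  fixes M :: "'a measure" and A :: "('a \<Rightarrow> complex) set"
  assumes in_L2: "f \<in> A \<Longrightarrow> in_L2 M f"
    and add: "f \<in> A \<Longrightarrow> h \<in> A \<Longrightarrow> (\<lambda>x. f x + h x) \<in> A"
    and scale: "f \<in> A \<Longrightarrow> (\<lambda>x. c * f x) \<in> A"
begin

lemma closure_base: "f \<in> A \<Longrightarrow> L2_closure M A f"
  unfolding L2_closure_def using in_L2 by (auto intro!: bexI[of _ f] simp: L2_norm_def)

lemma closure_closed:
  assumes f: "in_L2 M f" and approx: "\<And>e. e > 0 \<Longrightarrow> \<exists>h. L2_closure M A h \<and> L2_norm M (\<lambda>x. f x - h x) < e"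
  shows "L2_closure M A f"
  unfolding L2_closure_def
proof (intro conjI allI impI f)
  fix e :: real assume "e > 0"
  then obtain h where h: "L2_closure M A h" "L2_norm M (\<lambda>x. f x - h x) < e / 2"
    using approx[of "e / 2"] by auto
  obtain a where a: "a \<in> A" "L2_norm M (\<lambda>x. h x - a x) < e / 2"
    using h(1) \<open>e > 0\<close> unfolding L2_closure_def by (meson half_gt_zero)
  have hL: "in_L2 M h" using h(1) by (simp add: L2_closure_def)
  have "L2_norm M (\<lambda>x. f x - a x) \<le> L2_norm M (\<lambda>x. f x - h x) + L2_norm M (\<lambda>x. h x - a x)"
    using L2_norm_add_le[OF in_L2_diff[OF f hL] in_L2_diff[OF hL in_L2[OF a(1)]]] by simp
  then show "\<exists>a\<in>A. L2_norm M (\<lambda>x. f x - a x) < e" using a h(2) by force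
qed

lemma closure_add:
  assumes f: "L2_closure M A f" and h: "L2_closure M A h"
  shows "L2_closure M A (\<lambda>x. f x + h x)"
  unfolding L2_closure_def
proof (intro conjI allI impI)
  show "in_L2 M (\<lambda>x. f x + h x)" using f h by (auto simp: L2_closure_def intro: in_L2_add)
  fix e :: real assume "e > 0"
  then obtain a b where a: "a \<in> A" "L2_norm M (\<lambda>x. f x - a x) < e / 2"
    and b: "b \<in> A" "L2_norm M (\<lambda>x. h x - b x) < e / 2"
    using f h unfolding L2_closure_def by (meson half_gt_zero)
  have "in_L2 M (\<lambda>x. f x - a x)" "in_L2 M (\<lambda>x. h x - b x)"
    using f h in_L2[OF a(1)] in_L2[OF b(1)] by (simp_all add: L2_closure_def in_L2_diff)
  from L2_norm_add_le[OF this]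
  have "L2_norm M (\<lambda>x. (f x + h x) - (a x + b x)) < e" using a b by (simp add: algebra_simps)
  then show "\<exists>c\<in>A. L2_norm M (\<lambda>x. (f x + h x) - c x) < e"
    using add[OF a(1) b(1)] by (intro bexI) auto
qed

lemma closure_scale:
  assumes f: "L2_closure M A f"
  shows "L2_closure M A (\<lambda>x. c * f x)"
  unfolding L2_closure_def
proof (intro conjI allI impI)
  show "in_L2 M (\<lambda>x. c * f x)" using f by (auto simp: L2_closure_def intro: in_L2_cmult)
  fix e :: real assume e: "e > 0"
  have pos: "norm c + 1 > 0" by (simp add: add_nonneg_pos)
  then have "e / (norm c + 1) > 0" using e by simp
  then obtain a where a: "a \<in> A" "L2_norm M (\<lambda>x. f x - a x) < e / (norm c + 1)"
    using f unfolding L2_closure_def by blast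
  have "L2_norm M (\<lambda>x. c * f x - c * a x) = norm c * L2_norm M (\<lambda>x. f x - a x)"
    by (simp only: right_diff_distrib[symmetric] L2_norm_cmult)
  also have "\<dots> \<le> (norm c + 1) * L2_norm M (\<lambda>x. f x - a x)"
    by (intro mult_right_mono L2_norm_nonneg) simp
  also have "\<dots> < e" using a(2) pos by (simp add: field_simps)
  finally show "\<exists>d\<in>A. L2_norm M (\<lambda>x. c * f x - d x) < e"
    using scale[OF a(1)] by (intro bexI) auto
qed

lemma closure_diff:
  assumes "L2_closure M A f" "L2_closure M A h"
  shows "L2_closure M A (\<lambda>x. f x - h x)"
  using closure_add[OF assms(1) closure_scale[OF assms(2), of "-1"]] by simp

lemma closure_dominated:
  fixes W :: "'a \<Rightarrow> real"
  assumes h: "\<And>i::nat. L2_closure M A (h i)" and f: "f \<in> borel_measurable M" and W: "in_L2 M W"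
    and lim: "AE x in M. (\<lambda>i. h i x) \<longlonglongrightarrow> f x"
    and bound: "\<And>i. AE x in M. norm (h i x) \<le> W x" "AE x in M. norm (f x) \<le> W x"
  shows "L2_closure M A f"
proof (rule closure_closed)
  have "integrable M (\<lambda>x. (norm (f x))\<^sup>2)"
  proof (rule Bochner_Integration.integrable_bound[OF in_L2_integrable_square[OF W]])
    show "AE x in M. norm ((norm (f x))\<^sup>2) \<le> norm ((norm (W x))\<^sup>2)"
      using bound(2) by eventually_elim (auto intro: power_mono)
  qed (use f in measurable)
  then show "in_L2 M f" using f by (simp add: in_L2_def)
  have lim0: "(\<lambda>i. L2_norm M (\<lambda>x. f x - h i x)) \<longlonglongrightarrow> 0"
    using h by (intro tendsto_L2_dominated[OF _ f W lim bound]) (auto simp: L2_closure_def in_L2_def)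
  show "\<exists>h. L2_closure M A h \<and> L2_norm M (\<lambda>x. f x - h x) < e" if "e > 0" for e
    using order_tendstoD(2)[OF lim0 that] h by (auto simp: eventually_sequentially)
qed

end

lemma L2_closure_cong:
  assumes "\<And>x. x \<in> space M \<Longrightarrow> f x = h x"
  shows "L2_closure M A f \<longleftrightarrow> L2_closure M A h"
proof -
  have "in_L2 M f \<longleftrightarrow> in_L2 M h"
    unfolding in_L2_def using assms
    by (intro conj_cong measurable_cong Bochner_Integration.integrable_cong) auto
  moreover have "L2_norm M (\<lambda>x. f x - a x) = L2_norm M (\<lambda>x. h x - a x)" for a
    unfolding L2_norm_def using assms
    by (intro arg_cong[where f = sqrt] Bochner_Integration.integral_cong) auto
  ultimately show ?thesis by (simp add: L2_closure_def)
qed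

lemma in_L2_const:
  fixes c :: "'b::{real_normed_vector,second_countable_topology}"
  assumes "finite_measure M"
  shows "in_L2 M (\<lambda>_. c)"
  by (rule in_L2_bounded[OF assms, where B = "norm c"]) auto

section \<open>From indicator functions to all square-integrable functions\<close>

context L2_subspace
begin

text \<open>Induction along simple functions and monotone limits for nonnegative functions, with
  square-integrability carried as a premise so that each limit is dominated by the final function.
  The positive and negative parts of Re and Im then give the complex case.\<close>

lemma closure_of_indicators:
  fixes f :: "'a \<Rightarrow> complex"
  assumes fin: "finite_measure M"
    and ind: "\<And>B. B \<in> sets M \<Longrightarrow> L2_closure M A (\<lambda>x. complex_of_real (indicator B x))"
    and f: "in_L2 M f"
  shows "L2_closure M A f"
proof -
  have real: "L2_closure M A (\<lambda>x. complex_of_real (u x))"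
    if "u \<in> borel_measurable M" "\<And>x. 0 \<le> u x" "in_L2 M u" for u :: "'a \<Rightarrow> real"
    using that
  proof (induction u rule: borel_measurable_induct_real)
    case (set B)
    then show ?case by (intro ind)
  next
    case (mult u c)
    show ?case
    proof (cases "c = 0")
      case True
      then show ?thesis using ind[of "{}"] by simp
    next
      case False
      then have "in_L2 M u"
        using mult by (intro in_L2_bound[OF mult.prems, where c = "1 / c"]) auto
      then show ?thesis using closure_scale[OF mult.IH, of "of_real c"] by simp
    qed
  next
    case (add u v)
    have "in_L2 M u" "in_L2 M v"
      using add by (auto intro!: in_L2_bound[OF add.prems, where c = 1])
    then show ?case using closure_add[OF add.IH(2) add.IH(1)] by simp
  next
    case (seq U)
    have u_meas: "u \<in> borel_measurable M" using seq.prems by (simp add: in_L2_def)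
    have le: "U i x \<le> u x" if "x \<in> space M" for i x
      using seq.hyps that by (intro incseq_le[of "\<lambda>i. U i x"]) (auto simp: incseq_def le_fun_def)
    have pos: "0 \<le> u x" if "x \<in> space M" for x using le[OF that, of 0] seq.hyps(2)[of 0 x] by linarith
    have U: "in_L2 M (U i)" for i
      using seq.hyps le pos by (intro in_L2_bound[OF seq.prems, where c = 1]) auto
    show ?case
    proof (rule closure_dominated[OF seq.IH[OF U] _ seq.prems])
      show "(\<lambda>x. complex_of_real (u x)) \<in> borel_measurable M" using u_meas by measurable
      show "AE x in M. (\<lambda>i. complex_of_real (U i x)) \<longlonglongrightarrow> complex_of_real (u x)"
        by (intro AE_I2 tendsto_intros seq.hyps)
      show "AE x in M. norm (complex_of_real (U i x)) \<le> u x" for i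
        using le seq.hyps by (intro AE_I2) auto
      show "AE x in M. norm (complex_of_real (u x)) \<le> u x"
        using pos by (intro AE_I2) auto
    qed
  qed
  have part: "L2_closure M A (\<lambda>x. complex_of_real (max 0 (q (f x))))"
    if "q \<in> borel_measurable borel" "\<And>z. \<bar>q z\<bar> \<le> norm z" for q :: "complex \<Rightarrow> real"
  proof -
    have meas: "(\<lambda>x. max 0 (q (f x))) \<in> borel_measurable M"
      using measurable_compose[OF in_L2_measurable[OF f] that(1)] by measurable
    have "in_L2 M (\<lambda>x. max 0 (q (f x)))"
    proof (rule in_L2_bound[OF f meas, where c = 1])
      show "norm (max 0 (q (f x))) \<le> 1 * norm (f x)" for x
        using that(2)[of "f x"] unfolding real_norm_def by linarith
    qed
    then show ?thesis using meas by (intro real) auto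
  qed
  have "L2_closure M A (\<lambda>x.
      (complex_of_real (max 0 (Re (f x))) - complex_of_real (max 0 (- Re (f x))))
      + \<i> * (complex_of_real (max 0 (Im (f x))) - complex_of_real (max 0 (- Im (f x)))))"
    by (intro closure_add closure_scale closure_diff part)
      (auto simp: abs_Re_le_cmod abs_Im_le_cmod)
  moreover have "(complex_of_real (max 0 (Re z)) - complex_of_real (max 0 (- Re z)))
      + \<i> * (complex_of_real (max 0 (Im z)) - complex_of_real (max 0 (- Im z))) = z" for z
    by (simp add: complex_eq_iff max_def)
  ultimately show ?thesis by simp
qed

text \<open>A Dynkin argument: the sets whose indicators are approximable admit complements, by
  subtraction from \<open>UNIV\<close>, and countable disjoint unions, by dominated convergence with
  the constant 1 in a finite measure.\<close>

lemma closure_of_generator: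
  fixes f :: "'a \<Rightarrow> complex"
  assumes fin: "finite_measure M"
    and sets: "sets M = sets (restrict_space (N :: 'a measure) \<Omega>)"
    and gen: "sets N = sigma_sets UNIV E" "Int_stable E" "UNIV \<in> E"
    and ind: "\<And>K. K \<in> E \<Longrightarrow> L2_closure M A (\<lambda>x. complex_of_real (indicator K x))"
    and f: "in_L2 M f"
  shows "L2_closure M A f"
proof (rule closure_of_indicators[OF fin _ f])
  have spN: "space N = UNIV"
    using sets.top[of N] sets.sets_into_space[of UNIV N] gen(3) by (auto simp: gen(1))
  have sp: "space M = \<Omega>"
    using sets_eq_imp_space_eq[OF sets] by (simp add: space_restrict_space spN)
  have meas: "(\<lambda>x. complex_of_real (indicator B x)) \<in> borel_measurable M" if "B \<in> sets N" for B
  proof -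
    have "(\<lambda>x. complex_of_real (indicator B x)) \<in> borel_measurable N" using that by measurable
    from measurable_restrict_space1[OF this, of \<Omega>] show ?thesis
      using measurable_cong_sets[OF sets refl] by auto
  qed
  have borel: "L2_closure M A (\<lambda>x. complex_of_real (indicator B x))" if "B \<in> sigma_sets UNIV E" for B
    using gen(2) subset_UNIV[of E, folded Pow_UNIV] that
  proof (induction rule: sigma_sets_induct_disjoint)
    case (basic K)
    then show ?case by (rule ind)
  next
    case empty
    show ?case using closure_scale[OF ind[OF gen(3)], of 0] by simp
  next
    case (compl B)
    have "complex_of_real (indicator (UNIV - B) x)
        = complex_of_real (indicator UNIV x) - complex_of_real (indicator B x)" for x
      by (simp add: indicator_def)
    then show ?case using closure_diff[OF ind[OF gen(3)] compl.IH] by simp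
  next
    case (union B)
    have fin_sum: "L2_closure M A (\<lambda>x. \<Sum>i<n. complex_of_real (indicator (B i) x))" for n
    proof (induction n)
      case 0
      show ?case using closure_scale[OF ind[OF gen(3)], of 0] by simp
    next
      case (Suc n)
      then show ?case using closure_add[OF Suc union.IH[of n]] by simp
    qed
    \<comment> \<open>Disjointness turns each partial sum into a single indicator, which keeps it
      below 1.\<close>
    have eq: "(\<Sum>i<n. complex_of_real (indicator (B i) x)) = complex_of_real (indicator (\<Union>i<n. B i) x)" for n x
      using union.hyps(1)
      by (simp add: indicator_UN_disjoint disjoint_family_on_mono[of "{..<n}" UNIV] flip: of_real_sum)
    show ?case
    proof (rule closure_dominated[OF fin_sum _ in_L2_const[OF fin, of 1]])
      show "AE x in M. (\<lambda>n. \<Sum>i<n. complex_of_real (indicator (B i) x)) \<longlonglongrightarrow> complex_of_real (indicator (\<Union>i. B i) x)"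
        unfolding eq
        by (intro AE_I2 tendsto_intros LIMSEQ_indicator_UN)
      have "(\<Union>i. B i) \<in> sets N"
        unfolding gen(1) using union.hyps(2) by (intro sigma_sets.Union) auto
      then show "(\<lambda>x. complex_of_real (indicator (\<Union>i. B i) x)) \<in> borel_measurable M" by (rule meas)
    qed (unfold eq, auto simp: indicator_def)
  qed
  fix B assume "B \<in> sets M"
  then obtain B' where B': "B' \<in> sets N" "B = \<Omega> \<inter> B'" by (auto simp: sets sets_restrict_space)
  then show "L2_closure M A (\<lambda>x. complex_of_real (indicator B x))"
    using borel[of B'] gen(1) L2_closure_cong[of M "\<lambda>x. complex_of_real (indicator B x)"
        "\<lambda>x. complex_of_real (indicator B' x)" A]
    by (simp add: sp indicator_def)
qed

end

subsection \<open>The span of the mode functions\<close>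

text \<open>The inductive form lets linear properties be proved by rule induction from the mode
  functions alone.\<close>

inductive_set mode_span :: "bool \<Rightarrow> bool \<Rightarrow> (plane \<Rightarrow> complex) set" for a b :: bool where
  base: "mode_function a b j n \<in> mode_span a b"
| add: "f \<in> mode_span a b \<Longrightarrow> h \<in> mode_span a b \<Longrightarrow> (\<lambda>p. f p + h p) \<in> mode_span a b"
| scale: "f \<in> mode_span a b \<Longrightarrow> (\<lambda>p. c * f p) \<in> mode_span a b"

lemma continuous_mode_span: "f \<in> mode_span a b \<Longrightarrow> continuous_on UNIV f"
  by (induction rule: mode_span.induct) (auto intro!: continuous_intros)

lemma mode_span_diff: "f \<in> mode_span a b \<Longrightarrow> h \<in> mode_span a b \<Longrightarrow> (\<lambda>p. f p - h p) \<in> mode_span a b"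
  using mode_span.add[OF _ mode_span.scale[of h a b "-1"], of f] by simp

text \<open>Multiplication by 1 - x raises j by one, and x is 1 minus this factor.\<close>

lemma mode_span_mult_fst:
  assumes "f \<in> mode_span a b"
  shows "(\<lambda>p. complex_of_real (fst p) * f p) \<in> mode_span a b"
proof -
  have "(\<lambda>p. complex_of_real (1 - fst p) * f p) \<in> mode_span a b"
    using assms
  proof (induction rule: mode_span.induct)
    case (base j n)
    have "(\<lambda>p. complex_of_real (1 - fst p) * mode_function a b j n p) = mode_function a b (Suc j) n"
      by (simp add: fun_eq_iff mode_function_def)
    then show ?case by (simp add: mode_span.base)
  next
    case (add f h)
    then show ?case using mode_span.add[OF add.IH] by (simp add: distrib_left)
  next
    case (scale f c)
    then show ?case using mode_span.scale[OF scale.IH, of c] by (simp add: mult.left_commute)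
  qed
  from mode_span_diff[OF assms this] show ?thesis by (simp add: algebra_simps)
qed

lemma mode_span_mult_cos:
  assumes "f \<in> mode_span a b"
  shows "(\<lambda>p. complex_of_real (cos (pi * snd p)) * f p) \<in> mode_span a b"
  using assms
proof (induction rule: mode_span.induct)
  case (base j n)
  obtain c d where cd: "\<And>y. cos (pi * y) * eigenmode a b n y
      = c * eigenmode a b (Suc n) y + d * eigenmode a b (n - 1) y"
    using cos_mult_eigenmode[of a b n] by blast
  have "cos (pi * snd p) * ((1 - fst p) ^ j * eigenmode a b n (snd p))
      = c * ((1 - fst p) ^ j * eigenmode a b (Suc n) (snd p))
        + d * ((1 - fst p) ^ j * eigenmode a b (n - 1) (snd p))" for p :: plane
    unfolding mult.left_commute[of "cos (pi * snd p)"] cd by (simp add: algebra_simps)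
  then have "complex_of_real (cos (pi * snd p)) * mode_function a b j n p
      = of_real c * mode_function a b j (Suc n) p + of_real d * mode_function a b j (n - 1) p" for p
    unfolding mode_function_def by (simp only: of_real_mult[symmetric] of_real_add[symmetric])
  then show ?case
    using mode_span.add[OF mode_span.scale[OF mode_span.base] mode_span.scale[OF mode_span.base]] by simp
next
  case (add f h)
  then show ?case using mode_span.add[OF add.IH] by (simp add: distrib_left)
next
  case (scale f c)
  then show ?case using mode_span.scale[OF scale.IH, of c] by (simp add: mult.left_commute)
qed

text \<open>The real functions that multiply the span into itself form an algebra containing \<open>x\<close> and
  \<open>cos (\<pi> y)\<close>, so the Stone-Weierstrass theorem applies to it.\<close>

lemma mode_span_multiplier:
  fixes r :: "plane \<Rightarrow> real"
  assumes r: "continuous_on UNIV r" and e: "e > 0"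
  obtains q where "\<And>f. f \<in> mode_span a b \<Longrightarrow> (\<lambda>p. complex_of_real (q p) * f p) \<in> mode_span a b"
    and "\<And>p. p \<in> {0..1} \<times> {0..1} \<Longrightarrow> \<bar>r p - q p\<bar> < e"
proof -
  define P where "P = (\<lambda>q :: plane \<Rightarrow> real. continuous_on UNIV q \<and>
    (\<forall>f\<in>mode_span a b. (\<lambda>p. complex_of_real (q p) * f p) \<in> mode_span a b))"
  have "\<exists>q. P q \<and> (\<forall>p\<in>{0..1} \<times> {0..1}. \<bar>r p - q p\<bar> < e)"
  proof (rule Stone_Weierstrass_HOL)
    show "compact ({0..1} \<times> {0..1} :: plane set)" by (rule compact_closed_square)
    show "P (\<lambda>_. c)" for c by (auto simp: P_def intro: mode_span.scale)
    show "continuous_on ({0..1} \<times> {0..1}) q" if "P q" for q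
      using that by (auto simp: P_def intro: continuous_on_subset)
    show "P (\<lambda>p. q p + q' p)" if "P q \<and> P q'" for q q'
      using that by (auto simp: P_def distrib_right intro!: continuous_intros mode_span.add)
    show "P (\<lambda>p. q p * q' p)" if "P q \<and> P q'" for q q'
      using that by (auto simp: P_def mult.assoc intro!: continuous_intros)
    show "\<exists>q. P q \<and> q x \<noteq> q y"
      if xy: "x \<in> {0..1} \<times> {0..1} \<and> y \<in> {0..1} \<times> {0..1} \<and> x \<noteq> y" for x y :: plane
    proof (cases "fst x = fst y")
      case False
      then show ?thesis
        by (intro exI[of _ fst]) (auto simp: P_def mode_span_mult_fst intro!: continuous_intros)
    next
      case True
      then have "snd x \<noteq> snd y" using xy by (auto simp: prod_eq_iff)
      moreover have "pi * snd x \<in> {0..pi}" "pi * snd y \<in> {0..pi}" using xy by auto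
      \<comment> \<open>The cosine is injective on [0, pi], so points with equal first coordinates
        are separated by cos (pi y).\<close>
      ultimately have "cos (pi * snd x) \<noteq> cos (pi * snd y)"
        using cos_inj_pi[of "pi * snd x" "pi * snd y"] by auto
      then show ?thesis
        by (intro exI[of _ "\<lambda>p. cos (pi * snd p)"])
          (auto simp: P_def mode_span_mult_cos intro!: continuous_intros)
    qed
    show "continuous_on ({0..1} \<times> {0..1}) r" using r by (rule continuous_on_subset) simp
  qed (rule e)
  then show thesis using that unfolding P_def by blast
qed

text \<open>Multipliers show that every continuous multiple of the lowest mode lies in the closure.
  Dividing by that mode where it is positive then reaches indicators of closed sets, which generate
  the Borel sets. The support condition is closed in x and open in y so that it covers both the
  square and side 4.\<close>

lemma mode_span_dense:
  assumes fin: "finite_measure M"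
    and sets: "sets M = sets (restrict_space borel \<Omega>)"
    and supp: "AE p in M. p \<in> {0..1} \<times> {0<..<1}"
    and f: "in_L2 M f"
  shows "L2_closure M (mode_span a b) f"
proof -
  have cont_meas: "h \<in> borel_measurable M" if "continuous_on UNIV h" for h :: "plane \<Rightarrow> 'b::real_normed_vector"
    using measurable_restrict_space1[OF borel_measurable_continuous_onI[OF that], of \<Omega>]
      measurable_cong_sets[OF sets refl] by auto
  have L2c: "in_L2 M h" if h: "continuous_on UNIV h" for h :: "plane \<Rightarrow> complex"
  proof -
    obtain C where C: "\<And>p. p \<in> {0..1} \<times> {0..1} \<Longrightarrow> norm (h p) \<le> C"
      using continuous_bounded_square[OF h] by metis
    show ?thesis
    proof (rule in_L2_bounded[OF fin cont_meas[OF h]])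
      show "AE p in M. norm (h p) \<le> C"
        using supp by eventually_elim (auto intro!: C)
    qed
  qed
  interpret L2_subspace M "mode_span a b"
    by unfold_locales (auto intro: mode_span.add mode_span.scale L2c continuous_mode_span)
  let ?\<phi> = "\<lambda>p :: plane. eigenmode a b 0 (snd p)"
  have \<phi>: "mode_function a b 0 0 p = complex_of_real (?\<phi> p)" for p by (simp add: mode_function_def)
  have c\<phi>: "continuous_on UNIV ?\<phi>" by (intro continuous_intros)
  \<comment> \<open>The multiplier q approximates r uniformly, so the error is at most d times the
    norm of the lowest mode.\<close>
  have step: "L2_closure M (mode_span a b) (\<lambda>p. complex_of_real (r p) * mode_function a b 0 0 p)"
    if r: "continuous_on UNIV r" for r :: "plane \<Rightarrow> real"
    unfolding L2_closure_def
  proof (intro conjI allI impI)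
    let ?N = "L2_norm M (mode_function a b 0 0)"
    have rL2: "in_L2 M (\<lambda>p. complex_of_real (r p) * mode_function a b 0 0 p)"
      by (intro L2c continuous_intros r)
    then show "in_L2 M (\<lambda>p. complex_of_real (r p) * mode_function a b 0 0 p)" .
    fix e :: real assume e: "e > 0"
    define d where "d = e / (?N + 1)"
    have N: "?N + 1 > 0" using L2_norm_nonneg[of M "mode_function a b 0 0"] by linarith
    then have d: "d > 0" using e by (simp add: d_def)
    obtain q where q: "\<And>f. f \<in> mode_span a b \<Longrightarrow> (\<lambda>p. complex_of_real (q p) * f p) \<in> mode_span a b"
      and qr: "\<And>p. p \<in> {0..1} \<times> {0..1} \<Longrightarrow> \<bar>r p - q p\<bar> < d"
      using mode_span_multiplier[OF r d, of a b] by metis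
    note qs = q[OF mode_span.base[of a b 0 0]]
    have "L2_norm M (\<lambda>p. complex_of_real (r p) * mode_function a b 0 0 p - complex_of_real (q p) * mode_function a b 0 0 p)
        \<le> L2_norm M (\<lambda>p. complex_of_real d * mode_function a b 0 0 p)"
    proof (rule L2_norm_mono_AE)
      show "in_L2 M (\<lambda>p. complex_of_real (r p) * mode_function a b 0 0 p - complex_of_real (q p) * mode_function a b 0 0 p)"
        by (intro in_L2_diff rL2 in_L2 qs)
      show "in_L2 M (\<lambda>p. complex_of_real d * mode_function a b 0 0 p)"
        by (intro in_L2_cmult in_L2 mode_span.base)
      show "AE p in M. norm (complex_of_real (r p) * mode_function a b 0 0 p - complex_of_real (q p) * mode_function a b 0 0 p)
          \<le> norm (complex_of_real d * mode_function a b 0 0 p)"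
        using supp
      proof eventually_elim
        case (elim p)
        then have "\<bar>r p - q p\<bar> \<le> \<bar>d\<bar>" using qr[of p] d by force
        then show ?case
          unfolding left_diff_distrib[symmetric] of_real_diff[symmetric] norm_mult norm_of_real
          by (intro mult_right_mono) auto
      qed
    qed
    also have "\<dots> = d * ?N" using d by (simp add: L2_norm_cmult)
    also have "\<dots> < e" using N e by (simp add: d_def field_simps)
    finally show "\<exists>h\<in>mode_span a b. L2_norm M (\<lambda>p. complex_of_real (r p) * mode_function a b 0 0 p - h p) < e"
      using qs by (intro bexI[where x = "\<lambda>p. complex_of_real (q p) * mode_function a b 0 0 p"])
  qed
  show ?thesis
  proof (rule closure_of_generator[OF fin sets _ _ _ _ f])
    show "sets borel = sigma_sets (UNIV :: plane set) (Collect closed)"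
      by (subst borel_eq_closed) simp
    show "Int_stable (Collect closed :: plane set set)" by (auto simp: Int_stable_def)
    show "UNIV \<in> (Collect closed :: plane set set)" by simp
    fix K :: "plane set" assume "K \<in> Collect closed"
    then have K: "closed K" by simp
    show "L2_closure M (mode_span a b) (\<lambda>p. complex_of_real (indicator K p))"
    proof (cases "K = {}")
      case True
      then show ?thesis using closure_scale[OF closure_base[OF mode_span.base], of 0] by simp
    next
      case False
      \<comment> \<open>\<open>c\<close> decreases to the indicator of K, while \<open>s\<close> is
        a regularised quotient of the squared mode by itself and tends to 1 where the mode is
        nonzero. The product is the continuous \<open>r\<close> times the lowest mode and stays
        between 0 and 1.\<close>
      define c where "c = (\<lambda>(i::nat) p. max 0 (1 - real i * infdist p K))"
      define s where "s = (\<lambda>(i::nat) p. real i * (?\<phi> p)\<^sup>2 / (real i * (?\<phi> p)\<^sup>2 + 1))"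
      define r where "r = (\<lambda>(i::nat) p. c i p * (real i * ?\<phi> p / (real i * (?\<phi> p)\<^sup>2 + 1)))"
      have pos: "real i * (?\<phi> p)\<^sup>2 + 1 > 0" for i p by (simp add: add_nonneg_pos)
      have "continuous_on UNIV (r i)" for i
        unfolding r_def c_def using pos[of i] by (intro continuous_intros c\<phi>) (metis less_irrefl)
      note cl = step[OF this]
      have eq: "complex_of_real (r i p) * mode_function a b 0 0 p = complex_of_real (c i p * s i p)" for i p
        by (simp add: \<phi> r_def s_def power2_eq_square)
      have c01: "0 \<le> c i p" "c i p \<le> 1" for i p by (auto simp: c_def infdist_nonneg)
      have s01: "0 \<le> s i p" "s i p \<le> 1" for i p using pos[of i p] by (auto simp: s_def)
      show ?thesis
      proof (rule closure_dominated[OF cl _ in_L2_const[OF fin, of 1]])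
        have "(\<lambda>p. complex_of_real (indicator K p)) \<in> borel_measurable borel"
          using borel_closed[OF K] by measurable
        from measurable_restrict_space1[OF this, of \<Omega>]
        show "(\<lambda>p. complex_of_real (indicator K p)) \<in> borel_measurable M"
          using measurable_cong_sets[OF sets refl] by auto
        show "AE p in M. (\<lambda>i. complex_of_real (r i p) * mode_function a b 0 0 p) \<longlonglongrightarrow> complex_of_real (indicator K p)"
          using supp
        proof eventually_elim
          case (elim p)
          then have "?\<phi> p > 0" by (intro eigenmode_0_pos) auto
          then have z: "(?\<phi> p)\<^sup>2 > 0" by simp
          have "(\<lambda>i. s i p) \<longlonglongrightarrow> 1"
            unfolding s_def using z by real_asymp
          moreover have "(\<lambda>i. c i p) \<longlonglongrightarrow> indicator K p"
          proof (cases "p \<in> K")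
            case True
            then show ?thesis by (simp add: c_def)
          next
            case notin: False
            then have "infdist p K > 0"
              using in_closed_iff_infdist_zero[OF K False, of p] infdist_nonneg[of p K] by linarith
            then obtain m :: nat where m: "real m * infdist p K > 1" using reals_Archimedean3 by blast
            have "\<forall>\<^sub>F i in sequentially. c i p = 0"
              unfolding eventually_sequentially
            proof (intro exI[of _ m] allI impI)
              fix i assume "m \<le> i"
              then have "real m * infdist p K \<le> real i * infdist p K"
                by (intro mult_right_mono infdist_nonneg) simp
              then show "c i p = 0" using m by (simp add: c_def)
            qed
            then have "(\<lambda>i. c i p) \<longlonglongrightarrow> 0" by (rule tendsto_eventually)
            then show ?thesis using notin by simp
          qed
          ultimately have "(\<lambda>i. complex_of_real (c i p * s i p)) \<longlonglongrightarrow> complex_of_real (indicator K p * 1)"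
            by (intro tendsto_intros)
          then show ?case unfolding eq by simp
        qed
        show "AE p in M. norm (complex_of_real (r i p) * mode_function a b 0 0 p) \<le> 1" for i
          unfolding eq norm_of_real abs_mult using c01 s01
          by (intro AE_I2 mult_le_one) auto
        show "AE p in M. norm (complex_of_real (indicator K p)) \<le> 1" by (simp add: indicator_def)
      qed
    qed
  qed
qed

lemma mode_span_dense_square:
  "in_L2 square_measure f \<Longrightarrow> L2_closure square_measure (mode_span a b) f"
  by (rule mode_span_dense[OF finite_measure_square sets_square_measure])
    (auto intro!: AE_I2 simp: unit_square_def)

lemma mode_span_dense_side:
  assumes "in_L2 (side_measure 4) f"
  shows "L2_closure (side_measure 4) (mode_span a b) f"
proof (rule mode_span_dense[OF finite_measure_side _ _ assms])
  show "sets (side_measure 4) = sets (restrict_space borel UNIV)" by simp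
  have "({0..1} \<times> {0<..<1} :: plane set) \<in> sets borel" by (simp add: borel_prod[symmetric])
  then show "AE p in side_measure 4. p \<in> {0..1} \<times> {0<..<1}"
    by (intro AE_side_measure) (auto simp: side_param_def)
qed

section \<open>The stability estimate\<close>

lemma L2_norm_orthogonal_sum:
  fixes E :: "'i \<Rightarrow> 'a \<Rightarrow> complex"
  assumes I: "finite I" and E: "\<And>i. i \<in> I \<Longrightarrow> in_L2 M (E i)"
    and orth: "\<And>i j. i \<in> I \<Longrightarrow> j \<in> I \<Longrightarrow>
      (\<integral>x. E i x * cnj (E j x) \<partial>M) = (if i = j then complex_of_real (c i) else 0)"
  shows "(L2_norm M (\<lambda>x. \<Sum>i\<in>I. E i x))\<^sup>2 = (\<Sum>i\<in>I. c i)"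
proof -
  have int: "integrable M (\<lambda>x. E i x * cnj (E j x))" if "i \<in> I" "j \<in> I" for i j
    by (intro in_L2_prod_integrable in_L2_cnj E that)
  have "complex_of_real ((L2_norm M (\<lambda>x. \<Sum>i\<in>I. E i x))\<^sup>2)
      = (\<integral>x. (\<Sum>i\<in>I. \<Sum>j\<in>I. E i x * cnj (E j x)) \<partial>M)"
    unfolding integral_cnj_self[symmetric] by (simp add: sum_product)
  also have "\<dots> = (\<Sum>i\<in>I. \<Sum>j\<in>I. \<integral>x. E i x * cnj (E j x) \<partial>M)"
    using int by (subst Bochner_Integration.integral_sum; (intro Bochner_Integration.integrable_sum sum.cong refl)?)
      (auto intro!: Bochner_Integration.integral_sum)
  also have "\<dots> = (\<Sum>i\<in>I. complex_of_real (c i))"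
    using I by (intro sum.cong refl) (simp add: orth)
  finally show ?thesis by (simp only: of_real_sum[symmetric] of_real_eq_iff)
qed

text \<open>The projection P of f has squared norm s and pairing s with f. Cauchy-Schwarz and the
  arithmetic-geometric mean give s \<le> (||f||^2 + s) / 2.\<close>

lemma Bessel_inequality:
  fixes e :: "'i \<Rightarrow> 'a \<Rightarrow> complex"
  assumes I: "finite I" and e: "\<And>i. i \<in> I \<Longrightarrow> in_L2 M (e i)" and f: "in_L2 M f"
    and orth: "\<And>i j. i \<in> I \<Longrightarrow> j \<in> I \<Longrightarrow> (\<integral>x. e i x * cnj (e j x) \<partial>M) = (if i = j then 1 else 0)"
  shows "(\<Sum>i\<in>I. (norm (\<integral>x. f x * cnj (e i x) \<partial>M))\<^sup>2) \<le> (L2_norm M f)\<^sup>2"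
proof -
  define h where "h = (\<lambda>i. \<integral>x. f x * cnj (e i x) \<partial>M)"
  define s where "s = (\<Sum>i\<in>I. (norm (h i))\<^sup>2)"
  define P where "P = (\<lambda>x. \<Sum>i\<in>I. h i * e i x)"
  have P: "in_L2 M P" unfolding P_def by (intro in_L2_sum in_L2_cmult e)
  have nP: "(L2_norm M P)\<^sup>2 = s"
    unfolding P_def s_def
  proof (rule L2_norm_orthogonal_sum[OF I in_L2_cmult[OF e]])
    fix i j assume ij: "i \<in> I" "j \<in> I"
    have "(\<integral>x. h i * e i x * cnj (h j * e j x) \<partial>M) = h i * cnj (h j) * (\<integral>x. e i x * cnj (e j x) \<partial>M)"
      by (simp add: mult_ac flip: integral_mult_right_zero)
    then show "(\<integral>x. h i * e i x * cnj (h j * e j x) \<partial>M) = (if i = j then complex_of_real ((norm (h i))\<^sup>2) else 0)"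
      by (simp add: orth[OF ij] complex_norm_square[symmetric] del: of_real_power)
  qed auto
  have "(\<integral>x. f x * cnj (P x) \<partial>M) = (\<integral>x. (\<Sum>i\<in>I. cnj (h i) * (f x * cnj (e i x))) \<partial>M)"
    by (simp add: P_def sum_distrib_left mult_ac)
  also have "\<dots> = (\<Sum>i\<in>I. \<integral>x. cnj (h i) * (f x * cnj (e i x)) \<partial>M)"
    by (intro Bochner_Integration.integral_sum integrable_mult_right in_L2_prod_integrable in_L2_cnj f e)
  also have "\<dots> = (\<Sum>i\<in>I. complex_of_real ((norm (h i))\<^sup>2))"
    by (intro sum.cong refl) (simp only: integral_mult_right_zero complex_norm_square, simp add: h_def mult.commute)
  also have "\<dots> = complex_of_real s" by (simp add: s_def)
  finally have "s \<le> L2_norm M f * L2_norm M P"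
    using Cauchy_Schwarz_L2[OF f in_L2_cnj[OF P]] by (simp add: L2_norm_cnj)
  also have "\<dots> \<le> ((L2_norm M f)\<^sup>2 + (L2_norm M P)\<^sup>2) / 2"
    using sum_squares_bound[of "L2_norm M f" "L2_norm M P"] by simp
  finally show ?thesis unfolding nP by (simp add: s_def h_def)
qed

lemma cnj_mode_function [simp]: "cnj (mode_function a b j n p) = mode_function a b j n p"
  by (simp add: mode_function_def)

lemma mode_function_orthonormal_side:
  "(\<integral>p. mode_function a b j m p * mode_function a b 0 n p \<partial>side_measure 4) = (if m = n then 1 else 0)"
proof -
  have "(\<lambda>p. mode_function a b j m p * mode_function a b 0 n p) \<in> borel_measurable borel"
    by (intro borel_measurable_continuous_onI continuous_intros)
  then have "(\<integral>p. mode_function a b j m p * mode_function a b 0 n p \<partial>side_measure 4)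
      = (\<integral>s. complex_of_real (eigenmode a b m s * eigenmode a b n s) \<partial>unit_measure)"
    by (simp add: integral_side_measure mode_function_def side_param_def)
  then show ?thesis by (simp only: integral_complex_of_real eigenmode_orthonormal) simp
qed

lemma Bessel_side:
  assumes "in_L2 (side_measure 4) f"
  shows "(\<Sum>n<N. (norm (\<integral>p. f p * mode_function a b 0 n p \<partial>side_measure 4))\<^sup>2) \<le> (L2_norm (side_measure 4) f)\<^sup>2"
  using Bessel_inequality[of "{..<N}" "side_measure 4" "mode_function a b 0" f] assms
  by (simp add: mode_function_orthonormal_side in_L2_side_continuous continuous_mode_function)

text \<open>The error \<open>D\<close> of the truncated sum is conjugate-linear in h and, by Bessel,
  bounded by 2 ||f|| ||h|| uniformly in N. It vanishes eventually on each element of the span, so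
  density makes it tend to 0 for every h.\<close>

lemma Parseval_side:
  assumes f: "in_L2 (side_measure 4) f" and h: "in_L2 (side_measure 4) h"
  shows "(\<lambda>N. \<Sum>n<N. (\<integral>p. f p * mode_function a b 0 n p \<partial>side_measure 4)
      * cnj (\<integral>p. h p * mode_function a b 0 n p \<partial>side_measure 4))
    \<longlonglongrightarrow> (\<integral>p. f p * cnj (h p) \<partial>side_measure 4)"
proof -
  let ?M = "side_measure 4" and ?e = "mode_function a b 0"
  define C where "C = (\<lambda>f n. \<integral>p. f p * ?e n p \<partial>?M)"
  define D where "D = (\<lambda>N h. (\<Sum>n<N. C f n * cnj (C h n)) - (\<integral>p. f p * cnj (h p) \<partial>?M))"
  have eL2: "in_L2 ?M (?e n)" for n by (intro in_L2_side_continuous continuous_intros)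
  have C_add: "C (\<lambda>p. h1 p + h2 p) n = C h1 n + C h2 n" if "in_L2 ?M h1" "in_L2 ?M h2" for h1 h2 n
    using in_L2_prod_integrable[OF that(1) eL2] in_L2_prod_integrable[OF that(2) eL2]
    by (simp add: C_def distrib_right)
  have C_scale: "C (\<lambda>p. c * h p) n = c * C h n" for c h n
    by (simp add: C_def mult.assoc)
  have D_add: "D N (\<lambda>p. h1 p + h2 p) = D N h1 + D N h2" if "in_L2 ?M h1" "in_L2 ?M h2" for N h1 h2
    using in_L2_prod_integrable[OF f in_L2_cnj[OF that(1)]] in_L2_prod_integrable[OF f in_L2_cnj[OF that(2)]]
    by (simp add: D_def C_add[OF that] distrib_left sum.distrib)
  have D_scale: "D N (\<lambda>p. c * h p) = cnj c * D N h" for N c h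
  proof -
    have "(\<Sum>n<N. C f n * cnj (C (\<lambda>p. c * h p) n)) = cnj c * (\<Sum>n<N. C f n * cnj (C h n))"
      unfolding C_scale complex_cnj_mult sum_distrib_left by (intro sum.cong refl mult.left_commute)
    then show ?thesis by (simp only: D_def complex_cnj_mult integral_scaled_factor right_diff_distrib)
  qed
  have D_bound: "norm (D N h) \<le> 2 * L2_norm ?M f * L2_norm ?M h" if h: "in_L2 ?M h" for N h
  proof -
    have "norm (\<Sum>n<N. C f n * cnj (C h n)) \<le> (\<Sum>n<N. \<bar>norm (C f n)\<bar> * \<bar>norm (C h n)\<bar>)"
      by (rule order_trans[OF norm_sum]) (simp add: norm_mult)
    also have "\<dots> \<le> L2_set (\<lambda>n. norm (C f n)) {..<N} * L2_set (\<lambda>n. norm (C h n)) {..<N}"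
      by (rule L2_set_mult_ineq)
    also have "\<dots> \<le> L2_norm ?M f * L2_norm ?M h"
      unfolding L2_set_def C_def
      by (intro mult_mono real_le_lsqrt Bessel_side f h) (auto simp: L2_norm_nonneg sum_nonneg)
    finally have "norm (\<Sum>n<N. C f n * cnj (C h n)) \<le> L2_norm ?M f * L2_norm ?M h" .
    moreover have "norm (\<integral>p. f p * cnj (h p) \<partial>?M) \<le> L2_norm ?M f * L2_norm ?M h"
      using Cauchy_Schwarz_L2[OF f in_L2_cnj[OF h]] by (simp add: L2_norm_cnj)
    ultimately show ?thesis
      unfolding D_def
      using norm_triangle_ineq4[of "\<Sum>n<N. C f n * cnj (C h n)" "\<integral>p. f p * cnj (h p) \<partial>?M"] by linarith
  qed
  have exact: "\<exists>N0. \<forall>N\<ge>N0. D N q = 0" if "q \<in> mode_span a b" for q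
    using that
  proof (induction rule: mode_span.induct)
    case (base j n)
    have "D N (mode_function a b j n) = 0" if "N \<ge> Suc n" for N
    proof -
      \<comment> \<open>On side 4 the weight is 1, so a mode function has a single nonzero
        coefficient, included as soon as N > n.\<close>
      have "(\<Sum>m<N. C f m * cnj (C (mode_function a b j n) m)) = (\<Sum>m<N. if m = n then C f n else 0)"
        by (intro sum.cong refl) (auto simp: C_def mode_function_orthonormal_side)
      also have "\<dots> = C f n" using that by simp
      finally show ?thesis
        using mode_function_side'[OF f, of a b j n] by (simp add: D_def C_def)
    qed
    then show ?case by blast
  next
    case (add q1 q2)
    then obtain N1 N2 where "\<forall>N\<ge>N1. D N q1 = 0" "\<forall>N\<ge>N2. D N q2 = 0" by blast
    then have "\<forall>N\<ge>max N1 N2. D N (\<lambda>p. q1 p + q2 p) = 0"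
      using D_add[OF in_L2_side_continuous[OF continuous_mode_span[OF add.hyps(1)]]
          in_L2_side_continuous[OF continuous_mode_span[OF add.hyps(2)]]] by simp
    then show ?case by blast
  next
    case (scale q c)
    then show ?case by (auto simp: D_scale)
  qed
  have "(\<lambda>N. D N h) \<longlonglongrightarrow> 0"
  proof (rule LIMSEQ_I)
    fix r :: real assume r: "r > 0"
    define d where "d = r / (2 * L2_norm ?M f + 1)"
    have pos: "2 * L2_norm ?M f + 1 > 0" using L2_norm_nonneg[of ?M f] by linarith
    then have "d > 0" using r by (simp add: d_def)
    then obtain q where q: "q \<in> mode_span a b" "L2_norm ?M (\<lambda>p. h p - q p) < d"
      using mode_span_dense_side[OF h, of a b] unfolding L2_closure_def by blast
    obtain N0 where N0: "\<forall>N\<ge>N0. D N q = 0" using exact[OF q(1)] by blast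
    have qL2: "in_L2 ?M q" by (intro in_L2_side_continuous continuous_mode_span[OF q(1)])
    have hq: "in_L2 ?M (\<lambda>p. h p - q p)" by (intro in_L2_diff h qL2)
    have "norm (D N h - 0) < r" if "N \<ge> N0" for N
    proof -
      have "D N h = D N (\<lambda>p. h p - q p)" using D_add[OF hq qL2, of N] N0 that by simp
      also have "norm \<dots> \<le> 2 * L2_norm ?M f * L2_norm ?M (\<lambda>p. h p - q p)" by (rule D_bound[OF hq])
      also have "\<dots> \<le> (2 * L2_norm ?M f + 1) * L2_norm ?M (\<lambda>p. h p - q p)"
        by (intro mult_right_mono L2_norm_nonneg) simp
      also have "\<dots> < r" using q(2) pos by (simp add: d_def field_simps)
      finally show ?thesis by simp
    qed
    then show "\<exists>N0. \<forall>N\<ge>N0. norm (D N h - 0) < r" by blast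
  qed
  then show ?thesis unfolding D_def C_def by (rule LIM_zero_cancel)
qed

lemma integral_square_tensor:
  fixes f h :: "real \<Rightarrow> complex"
  assumes "continuous_on UNIV f" "continuous_on UNIV h"
  shows "(\<integral>p. f (fst p) * h (snd p) \<partial>square_measure) = (\<integral>x. f x \<partial>unit_measure) * (\<integral>y. h y \<partial>unit_measure)"
proof -
  have "continuous_on UNIV (\<lambda>p::plane. f (fst p) * h (snd p))"
    by (intro continuous_intros continuous_on_compose2[OF assms(1)] continuous_on_compose2[OF assms(2)]) auto
  from integral_square_iterated(1)[OF this] show ?thesis by simp
qed

text \<open>\<open>u\<close> pairs with the elements of the span as its truncated expansion does, so a bound on
  the truncations passes to \<open>u\<close> by density.\<close>

lemma mode_expansion_bound:
  fixes u :: "plane \<Rightarrow> complex" and w :: "nat \<Rightarrow> real \<Rightarrow> complex"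
  assumes u: "in_L2 square_measure u"
    and w: "\<And>n. continuous_on UNIV (w n)"
    and coeff: "\<And>n j. (\<integral>p. u p * mode_function a b j n p \<partial>square_measure)
        = (\<integral>x. w n x * of_real ((1 - x) ^ j) \<partial>unit_measure)"
    and bound: "\<forall>\<^sub>F N in sequentially. (\<Sum>n<N. \<integral>x. (norm (w n x))\<^sup>2 \<partial>unit_measure) \<le> C"
  shows "(L2_norm square_measure u)\<^sup>2 \<le> C"
proof -
  let ?M = "square_measure"
  define E where "E = (\<lambda>n p. w n (fst p) * complex_of_real (eigenmode a b n (snd p)))"
  have ortho: "(\<integral>y. complex_of_real (eigenmode a b m y * eigenmode a b n y) \<partial>unit_measure) = (if m = n then 1 else 0)" for m n
    by (simp only: integral_complex_of_real eigenmode_orthonormal) simp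
  have cE: "continuous_on UNIV (E n)" for n
    unfolding E_def by (intro continuous_intros continuous_on_compose2[OF w]) auto
  have EL2: "in_L2 ?M (E n)" for n by (rule in_L2_square_continuous[OF cE])
  define S where "S = (\<lambda>N p. \<Sum>n<N. E n p)"
  have SL2: "in_L2 ?M (S N)" for N unfolding S_def by (intro in_L2_sum EL2)
  have EE: "(\<integral>p. E m p * cnj (E n p) \<partial>?M)
      = (if m = n then complex_of_real (\<integral>x. (norm (w m x))\<^sup>2 \<partial>unit_measure) else 0)" for m n
  proof -
    have "(\<integral>p. E m p * cnj (E n p) \<partial>?M)
        = (\<integral>p. (w m (fst p) * cnj (w n (fst p))) * complex_of_real (eigenmode a b m (snd p) * eigenmode a b n (snd p)) \<partial>?M)"
      by (simp add: E_def mult_ac)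
    also have "\<dots> = (\<integral>x. w m x * cnj (w n x) \<partial>unit_measure)
        * (\<integral>y. complex_of_real (eigenmode a b m y * eigenmode a b n y) \<partial>unit_measure)"
      by (rule integral_square_tensor) (intro continuous_intros w)+
    finally show ?thesis
      unfolding ortho using integral_cnj_self[of unit_measure "w m"]
      by (cases "m = n") (simp_all add: L2_norm_square)
  qed
  have nS: "(L2_norm ?M (S N))\<^sup>2 = (\<Sum>n<N. \<integral>x. (norm (w n x))\<^sup>2 \<partial>unit_measure)" for N
    unfolding S_def by (rule L2_norm_orthogonal_sum) (auto simp: EL2 EE)
  \<comment> \<open>By orthonormality in y, the assumed bound on the sums is a bound on the norms of
    the truncations, valid for large N.\<close>
  obtain N1 where N1: "\<And>N. N \<ge> N1 \<Longrightarrow> (L2_norm ?M (S N))\<^sup>2 \<le> C"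
    using bound unfolding nS[symmetric] eventually_sequentially by blast
  then have C: "C \<ge> 0" using order_trans[OF zero_le_power2] by blast
  \<comment> \<open>A generator of index n is orthogonal to all other modes, so from N = n + 1 on
    the truncation pairs with it exactly as u does.\<close>
  have exact: "\<exists>N0. \<forall>N\<ge>N0. (\<integral>p. u p * q p \<partial>?M) = (\<integral>p. S N p * q p \<partial>?M)" if "q \<in> mode_span a b" for q
    using that
  proof (induction rule: mode_span.induct)
    case (base j n)
    have VL2: "in_L2 ?M (mode_function a b j n)" by (intro in_L2_square_continuous continuous_intros)
    have EV: "(\<integral>p. E m p * mode_function a b j n p \<partial>?M)
        = (if m = n then \<integral>x. w n x * of_real ((1 - x) ^ j) \<partial>unit_measure else 0)" for m
    proof -
      have "(\<integral>p. E m p * mode_function a b j n p \<partial>?M)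
          = (\<integral>p. (w m (fst p) * of_real ((1 - fst p) ^ j)) * complex_of_real (eigenmode a b m (snd p) * eigenmode a b n (snd p)) \<partial>?M)"
        by (simp add: E_def mode_function_def mult_ac)
      also have "\<dots> = (\<integral>x. w m x * of_real ((1 - x) ^ j) \<partial>unit_measure)
          * (\<integral>y. complex_of_real (eigenmode a b m y * eigenmode a b n y) \<partial>unit_measure)"
        by (rule integral_square_tensor) (intro continuous_intros w)+
      finally show ?thesis unfolding ortho by simp
    qed
    have "(\<integral>p. S N p * mode_function a b j n p \<partial>?M) = (\<integral>p. u p * mode_function a b j n p \<partial>?M)"
      if "N \<ge> Suc n" for N
    proof -
      have "(\<integral>p. S N p * mode_function a b j n p \<partial>?M) = (\<Sum>m<N. \<integral>p. E m p * mode_function a b j n p \<partial>?M)"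
        unfolding S_def sum_distrib_right
        by (intro Bochner_Integration.integral_sum in_L2_prod_integrable EL2 VL2)
      then show ?thesis using that by (simp add: EV coeff)
    qed
    then show ?case by metis
  next
    case (add q1 q2)
    then obtain N1 N2 where N12: "\<forall>N\<ge>N1. (\<integral>p. u p * q1 p \<partial>?M) = (\<integral>p. S N p * q1 p \<partial>?M)"
      "\<forall>N\<ge>N2. (\<integral>p. u p * q2 p \<partial>?M) = (\<integral>p. S N p * q2 p \<partial>?M)" by blast
    have dist: "(\<integral>p. f p * (q1 p + q2 p) \<partial>?M) = (\<integral>p. f p * q1 p \<partial>?M) + (\<integral>p. f p * q2 p \<partial>?M)"
      if "in_L2 ?M f" for f
      using in_L2_prod_integrable[OF that in_L2_square_continuous[OF continuous_mode_span[OF add.hyps(1)]]]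
        in_L2_prod_integrable[OF that in_L2_square_continuous[OF continuous_mode_span[OF add.hyps(2)]]]
      by (simp add: distrib_left)
    have "\<forall>N\<ge>max N1 N2. (\<integral>p. u p * (q1 p + q2 p) \<partial>?M) = (\<integral>p. S N p * (q1 p + q2 p) \<partial>?M)"
    proof (intro allI impI)
      fix N assume "max N1 N2 \<le> N"
      then show "(\<integral>p. u p * (q1 p + q2 p) \<partial>?M) = (\<integral>p. S N p * (q1 p + q2 p) \<partial>?M)"
        unfolding dist[OF u] dist[OF SL2] using N12(1)[rule_format, of N] N12(2)[rule_format, of N] by simp
    qed
    then show ?case by blast
  next
    case (scale q c)
    then show ?case by (auto simp: integral_scaled_factor)
  qed
  have "L2_norm ?M u \<le> sqrt C"
  proof (rule L2_norm_le_of_dense[OF u])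
    show "in_L2 ?M q" if "q \<in> mode_span a b" for q
      by (intro in_L2_square_continuous continuous_mode_span[OF that])
    show "\<exists>q\<in>mode_span a b. L2_norm ?M (\<lambda>p. cnj (u p) - q p) < e" if "e > 0" for e
      using mode_span_dense_square[OF in_L2_cnj[OF u]] that unfolding L2_closure_def by blast
    show "norm (\<integral>p. u p * q p \<partial>?M) \<le> sqrt C * L2_norm ?M q" if q: "q \<in> mode_span a b" for q
    proof -
      \<comment> \<open>One index beyond both thresholds serves: the pairing is then exact and the
        norm of the truncation is bounded.\<close>
      obtain N0 where "\<forall>N\<ge>N0. (\<integral>p. u p * q p \<partial>?M) = (\<integral>p. S N p * q p \<partial>?M)" using exact[OF q] by blast
      then have "norm (\<integral>p. u p * q p \<partial>?M) = norm (\<integral>p. S (max N0 N1) p * q p \<partial>?M)"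
        by (metis max.cobounded1)
      also have "\<dots> \<le> L2_norm ?M (S (max N0 N1)) * L2_norm ?M q"
        by (intro Cauchy_Schwarz_L2 SL2 in_L2_square_continuous continuous_mode_span[OF q])
      also have "\<dots> \<le> sqrt C * L2_norm ?M q"
        by (intro mult_right_mono L2_norm_nonneg real_le_rsqrt N1) simp
      finally show ?thesis .
    qed
  qed (use C in simp)
  then have "(L2_norm ?M u)\<^sup>2 \<le> (sqrt C)\<^sup>2" by (intro power_mono L2_norm_nonneg)
  then show ?thesis using C by simp
qed

section \<open>Assembly of the estimate\<close>

lemma AE_mode_function_side:
  assumes "j \<in> {1..4}" "j = 1 \<Longrightarrow> a" "j = 2 \<Longrightarrow> i > 0" "j = 3 \<Longrightarrow> b" "j \<noteq> 4"
  shows "AE p in side_measure j. mode_function a b i n p = 0"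
proof (rule AE_side_measure)
  have "j = 1 \<or> j = 2 \<or> j = 3" using assms(1,5) by auto
  then show "mode_function a b i n (side_param j s) = 0" for s
    using assms(2-4) by (auto simp: mode_function_def side_param_def eigenmode_boundary)
  show "{p. mode_function a b i n p = 0} \<in> sets borel"
    using borel_measurable_continuous_onI[OF continuous_mode_function[of UNIV a b i n]] by measurable
qed

theorem theorem2p2:
  fixes k :: real
    and B :: "nat \<Rightarrow> boundary_operator"
    and g :: "nat \<Rightarrow> real \<times> real \<Rightarrow> complex"
    and u :: "real \<times> real \<Rightarrow> complex"
    and Du :: "real \<times> real \<Rightarrow> complex \<times> complex"
  assumes "k > 0"
    and "B 1 \<in> {Dirichlet, Neumann}"
    and "B 2 \<in> {Dirichlet, Neumann, Impedance}"
    and "B 3 \<in> {Dirichlet, Neumann}"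
    and "B 4 = Impedance"
    and "\<forall>j\<in>{1,2,3}. AE p in side_measure j. g j p = 0"
    and "in_L2 (side_measure 4) (g 4)"
    and "helmholtz_weak_solution k B (\<lambda>_. 0) g u Du"
  shows "L2_norm square_measure Du + k * L2_norm square_measure u
           \<le> sqrt 12 * max k 1 * L2_norm (side_measure 4) (g 4)"
proof -
  let ?Q = "square_measure" and ?G = "side_measure 4"
  note k = \<open>k > 0\<close> and g4 = \<open>in_L2 (side_measure 4) (g 4)\<close>
  obtain T where T: "energy_space B u Du T"
    and weak: "\<And>v Dv S. energy_space B v Dv S \<Longrightarrow>
          (\<integral>p. (fst (Du p) * cnj (fst (Dv p)) + snd (Du p) * cnj (snd (Dv p)))
                - (complex_of_real k)\<^sup>2 * u p * cnj (v p) \<partial>?Q)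
          - \<i> * complex_of_real k *
            (\<Sum>j | j \<in> {1..4} \<and> B j = Impedance. \<integral>p. T p * cnj (S p) \<partial>side_measure j)
          = (\<Sum>j | j \<in> {1..4} \<and> B j = Impedance. \<integral>p. g j p * cnj (S p) \<partial>side_measure j)
            + (\<Sum>j | j \<in> {1..4} \<and> B j = Neumann. \<integral>p. g j p * cnj (S p) \<partial>side_measure j)"
    using \<open>helmholtz_weak_solution k B (\<lambda>_. 0) g u Du\<close> unfolding helmholtz_weak_solution_def by auto
  have u: "in_L2 ?Q u" "in_L2 ?Q Du" "has_trace u Du T"
    and T0: "\<And>j. j \<in> {1..4} \<Longrightarrow> B j = Dirichlet \<Longrightarrow> AE p in side_measure j. T p = 0"
    using T by (auto simp: energy_space_def H1_def)
  have T4: "in_L2 ?G T" using u(3) unfolding has_trace_def by auto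
  define a where "a \<longleftrightarrow> B 1 = Dirichlet"
  define b where "b \<longleftrightarrow> B 3 = Dirichlet"
  define d where "d \<longleftrightarrow> B 2 = Dirichlet"
  define imp where "imp \<longleftrightarrow> B 2 = Impedance"
  have imp_sum: "(\<Sum>j | j \<in> {1..4} \<and> B j = Impedance. F j) = F 4 + (if imp then F 2 else 0)"
    for F :: "nat \<Rightarrow> complex"
  proof -
    have "{j. j \<in> {1..4} \<and> B j = Impedance} = (if imp then {2, 4} else {4})"
    proof -
      have "j \<in> {1..4} \<longleftrightarrow> j = 1 \<or> j = 2 \<or> j = 3 \<or> j = 4" for j :: nat by auto
      moreover have "B 1 \<noteq> Impedance" "B 3 \<noteq> Impedance" using assms(2,4) by auto
      ultimately have "j \<in> {1..4} \<and> B j = Impedance \<longleftrightarrow> j = 4 \<or> (imp \<and> j = 2)" for j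
        unfolding imp_def using assms(5) by metis
      then show ?thesis by (simp only:) auto
    qed
    then show ?thesis by simp
  qed
  have g0: "(\<integral>p. g j p * S p \<partial>side_measure j) = 0" if "j \<in> {1, 2, 3}" for j S
  proof (rule integral_eq_zero_AE)
    from assms(6) that have "AE p in side_measure j. g j p = 0" by blast
    then show "AE p in side_measure j. g j p * S p = 0" by eventually_elim simp
  qed
  \<comment> \<open>The weak formulation with the integral split and all homogeneous data removed.
    It is applied both to the mode functions and to u itself.\<close>
  have form: "(\<integral>p. fst (Du p) * cnj (fst (Dv p)) \<partial>?Q) + (\<integral>p. snd (Du p) * cnj (snd (Dv p)) \<partial>?Q)
      - of_real (k\<^sup>2) * (\<integral>p. u p * cnj (v p) \<partial>?Q)
      - \<i> * of_real k * ((\<integral>p. T p * cnj (S p) \<partial>?G)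
          + (if imp then \<integral>p. T p * cnj (S p) \<partial>side_measure 2 else 0))
    = (\<integral>p. g 4 p * cnj (S p) \<partial>?G)" if v: "energy_space B v Dv S" for v Dv S
  proof -
    have vL2: "in_L2 ?Q v" "in_L2 ?Q Dv" using v by (auto simp: energy_space_def H1_def)
    have int: "integrable ?Q (\<lambda>p. fst (Du p) * cnj (fst (Dv p)))"
      "integrable ?Q (\<lambda>p. snd (Du p) * cnj (snd (Dv p)))" "integrable ?Q (\<lambda>p. u p * cnj (v p))"
      by (intro in_L2_prod_integrable in_L2_fst in_L2_snd in_L2_cnj u vL2)+
    have "(\<integral>p. (fst (Du p) * cnj (fst (Dv p)) + snd (Du p) * cnj (snd (Dv p)))
                - (complex_of_real k)\<^sup>2 * u p * cnj (v p) \<partial>?Q)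
        = (\<integral>p. fst (Du p) * cnj (fst (Dv p)) \<partial>?Q) + (\<integral>p. snd (Du p) * cnj (snd (Dv p)) \<partial>?Q)
          - of_real (k\<^sup>2) * (\<integral>p. u p * cnj (v p) \<partial>?Q)"
      using int by (simp add: mult.assoc)
    moreover have "(\<Sum>j | j \<in> {1..4} \<and> B j = Neumann. \<integral>p. g j p * cnj (S p) \<partial>side_measure j) = 0"
    proof (rule sum.neutral, safe)
      fix j assume "j \<in> {1..4}" "B j = Neumann"
      then have "j \<noteq> 4" using assms(5) by auto
      then have "j \<in> {1, 2, 3}" using \<open>j \<in> {1..4}\<close> by auto
      then show "(\<integral>p. g j p * cnj (S p) \<partial>side_measure j) = 0" by (rule g0)
    qed
    ultimately show ?thesis
      using weak[OF v, unfolded imp_sum] g0[of 2 "\<lambda>p. cnj (S p)"] by (cases imp) simp_all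
  qed
  let ?\<phi> = "mode_function a b 0"
  define gc where "gc = (\<lambda>n. \<integral>p. g 4 p * ?\<phi> n p \<partial>?G)"
  define Tc where "Tc = (\<lambda>n. \<integral>p. T p * ?\<phi> n p \<partial>?G)"
  have mode_energy: "energy_space B (mode_function a b j n) (grad (mode_function a b j n)) (mode_function a b j n)"
    if "d \<Longrightarrow> j > 0" for j n
    unfolding energy_space_def
  proof (intro conjI ballI impI smooth_H1 smooth_has_trace smooth_mode_function)
    fix i assume i: "i \<in> {1..4}" "B i = Dirichlet"
    then show "AE p in side_measure i. mode_function a b j n p = 0"
      using that assms(5) by (intro AE_mode_function_side) (auto simp: a_def b_def d_def)
  qed
  \<comment> \<open>Packing the conclusions into one predicate allows a simultaneous choice of w and
    w' for all n.\<close>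
  define sol where "sol n w w' \<longleftrightarrow> (\<forall>x::real. (w has_vector_derivative w' x) (at x))
      \<and> (\<forall>x. (w' has_vector_derivative - (complex_of_real (k\<^sup>2 - (freq a b n)\<^sup>2) * w x)) (at x))
      \<and> (w 1 = 0 \<or> w' 1 = 0 \<or> w' 1 = \<i> * complex_of_real k * w 1)
      \<and> gc n = - w' 0 - \<i> * complex_of_real k * w 0 \<and> Tc n = w 0
      \<and> (\<forall>j. (\<integral>p. u p * mode_function a b j n p \<partial>?Q) = (\<integral>x. w x * of_real ((1 - x) ^ j) \<partial>unit_measure))" for n and w w' :: "real \<Rightarrow> complex"
  have "\<exists>w w'. sol n w w'" for n
  proof (rule mode_solution[OF u, of a d b "g 4" imp n k])
    fix j v assume v: "v = mode_function a b j n" and j: "d \<Longrightarrow> 0 < j"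
    \<comment> \<open>The modes are real, so the sesquilinear form becomes the bilinear one required
      by \<open>mode_solution\<close>.\<close>
    have real: "cnj (fst (grad (mode_function a b j n) p)) = fst (grad (mode_function a b j n) p)"
      "cnj (snd (grad (mode_function a b j n) p)) = snd (grad (mode_function a b j n) p)" for p
      by (simp_all add: grad_mode_function mode_function_dy_def)
    show "(\<integral>p. fst (Du p) * fst (grad v p) \<partial>?Q) + (\<integral>p. snd (Du p) * snd (grad v p) \<partial>?Q)
        - of_real (k\<^sup>2) * (\<integral>p. u p * v p \<partial>?Q)
        - \<i> * of_real k * ((\<integral>p. T p * v p \<partial>?G) + (if imp then \<integral>p. T p * v p \<partial>side_measure 2 else 0))
      = (\<integral>p. g 4 p * v p \<partial>?G)"
      using form[OF mode_energy[OF j], of n] unfolding v real cnj_mode_function .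
  next
    fix w w' :: "real \<Rightarrow> complex"
    assume "\<And>x. (w has_vector_derivative w' x) (at x)"
      "\<And>x. (w' has_vector_derivative - (complex_of_real (k\<^sup>2 - (freq a b n)\<^sup>2) * w x)) (at x)"
      "w 1 = 0 \<or> w' 1 = 0 \<or> w' 1 = \<i> * complex_of_real k * w 1"
      "(\<integral>p. g 4 p * ?\<phi> n p \<partial>?G) = - w' 0 - \<i> * complex_of_real k * w 0"
      "(\<integral>p. T p * ?\<phi> n p \<partial>?G) = w 0"
      "\<And>j. (\<integral>p. u p * mode_function a b j n p \<partial>?Q) = (\<integral>x. w x * of_real ((1 - x) ^ j) \<partial>unit_measure)"
    then show ?thesis unfolding sol_def gc_def Tc_def by blast
  qed (use T0 g4 in \<open>auto simp: a_def b_def d_def imp_def\<close>)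
  then obtain w w' where sol: "\<And>n. sol n (w n) (w' n)" by metis
  then have w: "\<And>n x::real. (w n has_vector_derivative w' n x) (at x)"
    and w': "\<And>n x. (w' n has_vector_derivative - (complex_of_real (k\<^sup>2 - (freq a b n)\<^sup>2) * w n x)) (at x)"
    and bc: "\<And>n. w n 1 = 0 \<or> w' n 1 = 0 \<or> w' n 1 = \<i> * complex_of_real k * w n 1"
    and gc: "\<And>n. gc n = - w' n 0 - \<i> * complex_of_real k * w n 0" and Tc: "\<And>n. Tc n = w n 0"
    and coeff: "\<And>n j. (\<integral>p. u p * mode_function a b j n p \<partial>?Q) = (\<integral>x. w n x * of_real ((1 - x) ^ j) \<partial>unit_measure)"
    unfolding sol_def by blast+
  define m where "m = max k 1"
  define R where "R = 6 * m\<^sup>2 * (L2_norm ?G (g 4))\<^sup>2"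
  define J where "J = (\<integral>p. g 4 p * cnj (T p) \<partial>?G)"
  \<comment> \<open>The mode estimates are added and Bessel bounds the sum of the squared data
    coefficients.\<close>
  have partial: "2 * k\<^sup>2 * (\<Sum>n<N. \<integral>x. (norm (w n x))\<^sup>2 \<partial>unit_measure) + Re (\<Sum>n<N. gc n * cnj (Tc n)) \<le> R" for N
  proof -
    have "2 * k\<^sup>2 * (\<Sum>n<N. \<integral>x. (norm (w n x))\<^sup>2 \<partial>unit_measure) + Re (\<Sum>n<N. gc n * cnj (Tc n))
        = (\<Sum>n<N. 2 * k\<^sup>2 * (\<integral>x. (norm (w n x))\<^sup>2 \<partial>unit_measure) + Re (gc n * cnj (w n 0)))"
      by (simp only: Tc sum.distrib sum_distrib_left Re_sum)
    also have "\<dots> \<le> (\<Sum>n<N. 6 * m\<^sup>2 * (norm (gc n))\<^sup>2)"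
      unfolding m_def by (intro sum_mono mode_estimate[OF k freq_zero_or_ge w w' bc gc])
    also have "\<dots> \<le> R"
      unfolding R_def sum_distrib_left[symmetric] gc_def by (intro mult_left_mono Bessel_side g4) simp
    finally show ?thesis .
  qed
  \<comment> \<open>The terms have no fixed sign, so Bessel would not do; Parseval identifies the
    limit.\<close>
  have lim: "(\<lambda>N. Re (\<Sum>n<N. gc n * cnj (Tc n))) \<longlonglongrightarrow> Re J"
    unfolding gc_def Tc_def J_def by (intro tendsto_Re Parseval_side g4 T4)
  have "2 * k\<^sup>2 * (L2_norm ?Q u)\<^sup>2 + Re J \<le> R"
  \<comment> \<open>At a finite N the real part is close to its limit only up to e, and only for
    large N.\<close>
  proof (rule field_le_epsilon)
    fix e :: real assume "e > 0"
    then have "\<forall>\<^sub>F N in sequentially. Re J - e < Re (\<Sum>n<N. gc n * cnj (Tc n))"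
      by (intro order_tendstoD(1)[OF lim]) simp
    then have "\<forall>\<^sub>F N in sequentially. (\<Sum>n<N. \<integral>x. (norm (w n x))\<^sup>2 \<partial>unit_measure) \<le> (R - Re J + e) / (2 * k\<^sup>2)"
    proof eventually_elim
      case (elim N)
      then have "2 * k\<^sup>2 * (\<Sum>n<N. \<integral>x. (norm (w n x))\<^sup>2 \<partial>unit_measure) \<le> R - Re J + e"
        using partial[of N] by simp
      then show ?case using k by (simp add: field_simps)
    qed
    then have "(L2_norm ?Q u)\<^sup>2 \<le> (R - Re J + e) / (2 * k\<^sup>2)"
      using w by (intro mode_expansion_bound[OF u(1) _ coeff] continuous_on_vector_derivative)
        (auto intro: has_vector_derivative_at_within)
    then show "2 * k\<^sup>2 * (L2_norm ?Q u)\<^sup>2 + Re J \<le> R + e" using k by (simp add: field_simps)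
  qed
  \<comment> \<open>Test with v = u and take real parts: the impedance terms are purely
    imaginary.\<close>
  moreover have "(L2_norm ?Q Du)\<^sup>2 - k\<^sup>2 * (L2_norm ?Q u)\<^sup>2 = Re J"
  proof -
    have "(L2_norm ?Q Du)\<^sup>2 = (L2_norm ?Q (\<lambda>p. fst (Du p)))\<^sup>2 + (L2_norm ?Q (\<lambda>p. snd (Du p)))\<^sup>2"
      using in_L2_integrable_square[OF in_L2_fst[OF u(2)]] in_L2_integrable_square[OF in_L2_snd[OF u(2)]]
      by (simp add: L2_norm_square norm_prod_def)
    then show ?thesis
      using arg_cong[OF form[OF T], of Re] unfolding integral_cnj_self J_def[symmetric]
      by (cases imp) simp_all
  qed
  ultimately have "(L2_norm ?Q Du)\<^sup>2 + (k * L2_norm ?Q u)\<^sup>2 \<le> R" by (simp add: power_mult_distrib)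
  \<comment> \<open>The square of the sum is at most twice the sum of the squares, which turns 6
    into 12.\<close>
  then have "(L2_norm ?Q Du + k * L2_norm ?Q u)\<^sup>2 \<le> 12 * m\<^sup>2 * (L2_norm ?G (g 4))\<^sup>2"
    using norm_add_square_le[of "L2_norm ?Q Du" "k * L2_norm ?Q u"] by (simp add: R_def)
  then have "(L2_norm ?Q Du + k * L2_norm ?Q u)\<^sup>2 \<le> (sqrt 12 * m * L2_norm ?G (g 4))\<^sup>2"
    by (simp add: power_mult_distrib)
  then show ?thesis
    unfolding m_def by (rule power2_le_imp_le) (auto simp: L2_norm_nonneg)
qed

end
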